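(* Let $(\mu_k)_{k\ge1}$ be a sequence of positive Radon measures on $\mathbb{R}^d$ converging weakly to a positive Radon measure $\mu$, $\mu_k\rightharpoonup\mu$, and satisfying: (boundedness) there is a constant $C$ such that $\mu_k(\mathbb{R}^d)\le C$ for all $k\ge1$; (tightness) for every $\varepsilon>0$ there exists a radius $R_\varepsilon$ such that $\mu_k(\{x\in\mathbb{R}^d:|x|>R_\varepsilon\})<\varepsilon$ for all $k\ge1$. Then, for any positive, integrable function $\eta\in L^1(S^{d-1})$ and every positive Radon measure $\nu$ that is absolutely continuous with respect to Lebesgue measure on $\mathbb{R}^d$, one has $$\mathcal{S}^{\eta}(\mu;\nu)\ \ge\ \limsup_{k\to\infty}\mathcal{S}^{\eta}(\mu_k;\nu).$$
   Context: Weak convergence $\mu_k\rightharpoonup\mu$ means $\int\varphi\,d\mu_k\to\int\varphi\,d\mu$ for every $\varphi\in\mathcal{C}^0_c(\mathbb{R}^d)$. $S^{d-1}$ is the unit sphere of $\mathbb{R}^d$. For a unit vector $\mathbf n\in S^{d-1}$, let $E_{\mathbf n}=\mathbb{R}\mathbf n$, let $E_{\mathbf n}^\perp$ be the $(d-1)$-dimensional subspace orthogonal to $\mathbf n$, and let $\pi_{\mathbf n}:\mathbb{R}^d\to E_{\mathbf n}^\perp$ be the orthogonal projection. For a positive bounded Radon measure $\mu$ on $\mathbb{R}^d$, let $\mu^{\mathbf n}$ be the projected measure on $E_{\mathbf n}^\perp$, $\mu^{\mathbf n}(A)=\mu(\{x:\pi_{\mathbf n}(x)\in A\})$, and let $\Phi^{\mathbf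 n}$ be the density of the absolutely continuous part of $\mu^{\mathbf n}$ with respect to $(d-1)$-dimensional Lebesgue measure on $E_{\mathbf n}^\perp$. Let $(\mu^y)_{y\in E_{\mathbf n}^\perp}$ be the disintegration of $\mu$: each $\mu^y$ is a probability measure on $E_{\mathbf n}\cong\mathbb{R}$ (the coordinate $t$ corresponding to $t\mathbf n$), $y\mapsto\mu^y$ is $\mu^{\mathbf n}$-measurable, and $\int_{\mathbb{R}^d}\phi\,d\mu=\int_{E_{\mathbf n}^\perp}\big(\int_{-\infty}^{+\infty}\phi(y+t\mathbf n)\,d\mu^y(t)\big)d\mu^{\mathbf n}(y)$ for every $\mu$-integrable $\phi$. For a positive measure $\nu$ with density $g$ with respect to Lebesgue measure on $\mathbb{R}^d$, define (with $\exp\{-\infty\}=0$) $$\mathcal{S}^{\mathbf n}_{\mu,\nu}(y)=1-\exp\{-\Phi^{\mathbf n}(y)\}\exp\Big\{-\int_{-\infty}^{+\infty} g(y+s\mathbf n)\,ds\Big\}-\int_{-\infty}^{+\infty} g(y+s\mathbf n)\exp\Big\{-\int_s^{+\infty}g(y+t\mathbf n)\,dt\Big\}\exp\Big\{-\Phi^{\mathbf n}(y)\,\mu^y([s,+\infty[)\Big\}ds,$$ $$\mathcal{S}^{\mathbf n}(\mu;\nu)=\int_{E_{\mathbf n}^\perp}\mathcal{S}^{\mathbf n}_{\mu,\nu}(y)\,dy,\qquad \mathcal{S}^\eta(\mu;\nu)=\int_{S^{d-1}}\mathcal{S}^{\mathbf n}(\mu;\nu)\,\eta(\mathbf n)\,d\mathbf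 n .$$ *)

theory Defs
  imports "HOL-Probability.Probability"
begin

text \<open>The role of $\mathbb{R}^d$ is played by an arbitrary type of class \<open>euclidean_space\<close>,
  with $d$ = \<open>DIM('a)\<close>. The directional quantities take values in \<open>ennreal\<close>, because they may be
  infinite when \<open>\<nu>\<close> has infinite mass.\<close>

text \<open>On Euclidean space a locally finite Borel measure is automatically regular.\<close>

definition radon_measure :: "'a::euclidean_space measure \<Rightarrow> bool" where
  "radon_measure M \<longleftrightarrow> sets M = sets borel \<and> (\<forall>K. compact K \<longrightarrow> emeasure M K < \<infinity>)"

definition weakly_converges :: "(nat \<Rightarrow> 'a::euclidean_space measure) \<Rightarrow> 'a measure \<Rightarrow> bool" where
  "weakly_converges M M' \<longleftrightarrow>
     (\<forall>\<phi>::'a \<Rightarrow> real. continuous_on UNIV \<phi> \<and> compact (closure {x. \<phi> x \<noteq> 0}) \<longrightarrow>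
        (\<lambda>k. \<integral>x. \<phi> x \<partial>M k) \<longlonglongrightarrow> (\<integral>x. \<phi> x \<partial>M'))"


text \<open>The surface measure of a Borel set \<open>A\<close> of the unit sphere is $d$ times the Lebesgue measure of
  the cone \<open>{r *\<^sub>R x | r x. 0 < r \<and> r < 1 \<and> x \<in> A}\<close> (polar coordinates); note that
  \<open>sgn x = x /\<^sub>R norm x\<close>.\<close>

definition sphere_measure :: "'a::euclidean_space measure" where
  "sphere_measure = scale_measure (of_nat DIM('a))
     (distr (restrict_space lborel (ball 0 1 - {0})) (restrict_space borel (sphere 0 1)) sgn)"

text \<open>Lebesgue measure on a linear subspace \<open>V\<close>: the product of one-dimensional Lebesgue measures in
  the coordinates of an orthonormal basis of \<open>V\<close>, as for \<open>lborel\<close> itself. It does not depend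
  on the basis chosen. On the zero subspace it is the unit point mass.\<close>

definition orthonormal_basis_of :: "'a::euclidean_space set \<Rightarrow> 'a set \<Rightarrow> bool" where
  "orthonormal_basis_of V B \<longleftrightarrow>
     B \<subseteq> V \<and> span B = V \<and> pairwise orthogonal B \<and> (\<forall>b\<in>B. norm b = 1)"

definition subspace_lborel :: "'a::euclidean_space set \<Rightarrow> 'a measure" where
  "subspace_lborel V =
     (let B = (SOME B. orthonormal_basis_of V B)
      in distr (\<Pi>\<^sub>M b\<in>B. (lborel :: real measure)) (restrict_space borel V) (\<lambda>f. \<Sum>b\<in>B. f b *\<^sub>R b))"


definition perp :: "'a::euclidean_space \<Rightarrow> 'a set" where
  "perp n = orthogonal_comp (span {n})"

definition proj :: "'a::euclidean_space \<Rightarrow> 'a \<Rightarrow> 'a" where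
  "proj n x = x - (x \<bullet> n) *\<^sub>R n"

definition proj_measure :: "'a::euclidean_space \<Rightarrow> 'a measure \<Rightarrow> 'a measure" where
  "proj_measure n M = distr M (restrict_space borel (perp n)) (proj n)"

text \<open>\<open>\<Phi>\<close> is the density with respect to \<open>L\<close> of the absolutely continuous part in the Lebesgue
  decomposition of \<open>M\<close>; \<open>M\<^sub>s\<close> is the singular part.\<close>

definition ac_part_density :: "'a measure \<Rightarrow> 'a measure \<Rightarrow> ('a \<Rightarrow> real) \<Rightarrow> bool" where
  "ac_part_density L M \<Phi> \<longleftrightarrow>
     \<Phi> \<in> borel_measurable L \<and> (\<forall>y\<in>space L. 0 \<le> \<Phi> y) \<and>
     (\<exists>M\<^sub>s N. sets M\<^sub>s = sets L \<and> N \<in> null_sets L \<and> emeasure M\<^sub>s (space L - N) = 0 \<and>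
        (\<forall>A\<in>sets L. emeasure M A = emeasure (density L (\<lambda>y. ennreal (\<Phi> y))) A + emeasure M\<^sub>s A))"

text \<open>The measurability into \<open>prob_algebra borel\<close> says that every \<open>K y\<close> is a Borel probability
  measure on the line and that \<open>y \<mapsto> K y\<close> is measurable.\<close>

definition is_disintegration ::
    "'a::euclidean_space \<Rightarrow> 'a measure \<Rightarrow> ('a \<Rightarrow> real measure) \<Rightarrow> bool" where
  "is_disintegration n M K \<longleftrightarrow>
     K \<in> proj_measure n M \<rightarrow>\<^sub>M prob_algebra borel \<and>
     (\<forall>\<phi>::'a \<Rightarrow> real. integrable M \<phi> \<longrightarrow>
        (\<integral>x. \<phi> x \<partial>M) = (\<integral>y. (\<integral>t. \<phi> (y + t *\<^sub>R n) \<partial>K y) \<partial>proj_measure n M))"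

text \<open>For a finite Borel measure \<open>M\<close> and a unit vector \<open>n\<close> both objects exist. The density is unique
  up to null sets of \<open>subspace_lborel (perp n)\<close>, the disintegration up to null sets of
  \<open>proj_measure n M\<close>; changing the choice alters \<open>S_point\<close> below only on a null set of
  \<open>subspace_lborel (perp n)\<close>, hence not \<open>S_dir\<close>.\<close>

definition proj_density :: "'a::euclidean_space \<Rightarrow> 'a measure \<Rightarrow> 'a \<Rightarrow> real" where
  "proj_density n M = (SOME \<Phi>. ac_part_density (subspace_lborel (perp n)) (proj_measure n M) \<Phi>)"

definition disintegration :: "'a::euclidean_space \<Rightarrow> 'a measure \<Rightarrow> 'a \<Rightarrow> real measure" where
  "disintegration n M = (SOME K. is_disintegration n M K)"


definition exp_neg :: "ennreal \<Rightarrow> real" where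
  "exp_neg u = (if u = \<infinity> then 0 else exp (- enn2real u))"

text \<open>The last integral is at most 1, so \<open>enn2real\<close> does not meet \<open>\<infinity>\<close>.\<close>

definition S_point :: "'a::euclidean_space \<Rightarrow> 'a measure \<Rightarrow> 'a measure \<Rightarrow> 'a \<Rightarrow> real" where
  "S_point n M \<nu> y =
     (let g = RN_deriv lborel \<nu>; \<Phi> = proj_density n M; K = disintegration n M in
        1 - exp (- \<Phi> y) * exp_neg (\<integral>\<^sup>+s. g (y + s *\<^sub>R n) \<partial>lborel)
          - enn2real (\<integral>\<^sup>+s. g (y + s *\<^sub>R n)
                * ennreal (exp_neg (\<integral>\<^sup>+t\<in>{s..}. g (y + t *\<^sub>R n) \<partial>lborel))
                * ennreal (exp (- \<Phi> y * measure (K y) {s..})) \<partial>lborel))"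

text \<open>\<open>S_point n M \<nu> y\<close> lies between 0 and 1 for \<open>y \<in> perp n\<close>, so that \<open>ennreal\<close> does not truncate.\<close>

definition S_dir :: "'a::euclidean_space \<Rightarrow> 'a measure \<Rightarrow> 'a measure \<Rightarrow> ennreal" where
  "S_dir n M \<nu> = (\<integral>\<^sup>+y. ennreal (S_point n M \<nu> y) \<partial>subspace_lborel (perp n))"

definition S_eta :: "('a::euclidean_space \<Rightarrow> real) \<Rightarrow> 'a measure \<Rightarrow> 'a measure \<Rightarrow> ennreal" where
  "S_eta \<eta> M \<nu> = (\<integral>\<^sup>+n. S_dir n M \<nu> * ennreal (\<eta> n) \<partial>sphere_measure)"

end

theory Submission
  imports Defs
begin

text \<open>Fix a direction \<open>n\<close>. Along each line, \<open>g (y + s n) exp (- \<integral>\<^sub>s\<^sup>\<infinity> g)\<close> together with the atom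
  \<open>exp (- \<integral> g)\<close> at \<open>s = -\<infinity>\<close> is a sub-probability \<open>\<lambda>\<^sub>y\<close> on \<open>[-\<infinity>, \<infinity>)\<close>, and
  \<open>S_point = (1 - |\<lambda>\<^sub>y|) + \<integral> (1 - exp (- m\<^sub>s(y))) d\<lambda>\<^sub>y(s)\<close>, where \<open>m\<^sub>s\<close> is the density of the absolutely
  continuous part of the projection of \<open>M\<close> restricted to the closed half-space \<open>{x. s \<le> x \<bullet> n}\<close>. The
  first summand does not depend on \<open>M\<close>. For fixed \<open>s\<close> the functional \<open>\<integral> a(y) (1 - exp (- m\<^sub>s(y))) dy\<close>
  is an infimum of affine functionals \<open>c + \<integral> \<theta> dM\<close> over the half-space with \<open>\<theta> \<ge> 0\<close> continuous,
  because \<open>m \<mapsto> 1 - exp (- m)\<close> is concave with zero slope at infinity (so that singular parts cost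
  nothing); hence it is upper semicontinuous for narrow convergence. Tightness reduces the integral
  over \<open>y\<close> to a ball, the reverse Fatou lemma gives semicontinuity of the integral over \<open>s\<close>, and the
  bound \<open>\<integral> \<integral> (1 - exp (- m\<^sub>s)) d\<lambda>\<^sub>y dy \<le> C\<close> permits a second application of it over the sphere.
  That second application is made for lower integrals, so the measurability of \<open>S_dir\<close> in \<open>n\<close> is never
  needed.\<close>

section \<open>Lower integrals and the weights on a line\<close>

text \<open>The density and the disintegration inside \<open>S_dir\<close> are picked by choice
  separately for each direction. The sphere integral is therefore treated as a supremum over simple
  minorants, which is not additive. This forces the form of the final limit argument: the part
  independent of the measures stays whole, since it may be neither measurable in \<open>n\<close>
  nor integrable, and only the rest needs a measurable integrable bound. Along a line only total
  weight at most 1 is available: if every tail of \<open>g\<close> has infinite mass, all weights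
  vanish. Hence the defect term, and a proof of the bound that does not differentiate the tail
  integral. A majorant has slope close to \<open>exp (- m)\<close>. Its continuous version must be
  close both for Lebesgue measure on the hyperplane and for the limit marginal, which may be
  singular to it; so approximation is done for two measures at once. For the approximating measures
  one inequality suffices: the density part lies below the marginal. Half-spaces are closed because
  mass may reach their boundary in the limit but cannot leave it.\<close>

lemma nn_integral_measurable_minorant:
  "\<exists>g\<in>borel_measurable M. (\<forall>x. g x \<le> f x) \<and> (\<integral>\<^sup>+x. g x \<partial>M) = (\<integral>\<^sup>+x. f x \<partial>M)"
proof -
  \<comment> \<open>For a non-measurable \<open>f\<close> the integral is still the supremum over
    simple functions below \<open>f\<close>. A sequence of them attains that supremum, and the
    pointwise supremum of a sequence is measurable.\<close>
  let ?S = "{g. simple_function M g \<and> g \<le> f}"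
  have "(\<lambda>x. 0) \<in> ?S" by (auto simp: le_fun_def)
  then have "?S \<noteq> {}" by blast
  from ennreal_SUP_countable_SUP[OF this, of "integral\<^sup>S M"] obtain s :: "nat \<Rightarrow> ennreal"
    where s: "range s \<subseteq> integral\<^sup>S M ` ?S" "(SUP g\<in>?S. integral\<^sup>S M g) = (SUP i. s i)" by blast
  have "\<forall>i. \<exists>g\<in>?S. s i = integral\<^sup>S M g" using s(1) by blast
  then obtain g where g: "\<And>i. g i \<in> ?S" "\<And>i. s i = integral\<^sup>S M (g i)" by metis
  have [measurable]: "g i \<in> borel_measurable M" for i
    using g(1)[of i] by (auto intro: borel_measurable_simple_function)
  have le: "(SUP i. g i x) \<le> f x" for x
    using g(1) by (auto intro!: SUP_least simp: le_fun_def)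
  have "(\<integral>\<^sup>+x. f x \<partial>M) = (SUP i. integral\<^sup>S M (g i))"
    unfolding nn_integral_def s(2) g(2) ..
  also have "\<dots> \<le> (\<integral>\<^sup>+x. (SUP i. g i x) \<partial>M)"
  proof (rule SUP_least)
    fix i
    have "integral\<^sup>S M (g i) = integral\<^sup>N M (g i)"
      using g(1)[of i] by (auto simp: nn_integral_eq_simple_integral)
    also have "\<dots> \<le> (\<integral>\<^sup>+x. (SUP i. g i x) \<partial>M)" by (intro nn_integral_mono SUP_upper) auto
    finally show "integral\<^sup>S M (g i) \<le> (\<integral>\<^sup>+x. (SUP i. g i x) \<partial>M)" .
  qed
  finally have "(\<integral>\<^sup>+x. (SUP i. g i x) \<partial>M) = (\<integral>\<^sup>+x. f x \<partial>M)"
    using le by (intro antisym nn_integral_mono[of _ _ f]) auto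
  then show ?thesis using le by (intro bexI[of _ "\<lambda>x. SUP i. g i x"]) auto
qed

text \<open>Reverse Fatou lemma in which \<open>F\<close>, \<open>G\<close> and \<open>D\<close> may
  fail to be measurable. The dominating function \<open>D + B\<close> need not be integrable:
  \<open>D\<close> lies below \<open>G\<close>, so an infinite integral of \<open>D\<close> makes
  the claim trivial, and only \<open>B\<close> has to be measurable with finite integral.\<close>

lemma limsup_nn_integral_le_lower:
  fixes F :: "nat \<Rightarrow> 'a \<Rightarrow> ennreal"
  assumes lim: "AE x in M. limsup (\<lambda>k. F k x) \<le> G x"
    and D: "AE x in M. D x \<le> G x"
    and dom: "\<And>k. AE x in M. F k x \<le> D x + B x"
    and B[measurable]: "B \<in> borel_measurable M" and finB: "(\<integral>\<^sup>+x. B x \<partial>M) < \<infinity>"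
  shows "limsup (\<lambda>k. \<integral>\<^sup>+x. F k x \<partial>M) \<le> (\<integral>\<^sup>+x. G x \<partial>M)"
proof (cases "(\<integral>\<^sup>+x. G x \<partial>M) = \<infinity>")
  case False
  have "\<forall>k. \<exists>h\<in>borel_measurable M. (\<forall>x. h x \<le> F k x) \<and> (\<integral>\<^sup>+x. h x \<partial>M) = (\<integral>\<^sup>+x. F k x \<partial>M)"
    by (rule allI, rule nn_integral_measurable_minorant)
  then obtain h where h[measurable]: "\<And>k. h k \<in> borel_measurable M"
    and hF: "\<And>k x. h k x \<le> F k x" and hint: "\<And>k. (\<integral>\<^sup>+x. h k x \<partial>M) = (\<integral>\<^sup>+x. F k x \<partial>M)"
    by metis
  define w where "w x = (SUP k. h k x)" for x
  have [measurable]: "w \<in> borel_measurable M" unfolding w_def by measurable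
  have "AE x in M. \<forall>k. F k x \<le> D x + B x" using dom by (simp add: AE_all_countable)
  moreover have "AE x in M. B x \<noteq> \<infinity>"
    using finB by (intro nn_integral_noteq_infinite) auto
  \<comment> \<open>\<open>w\<close> is the supremum of measurable minorants of the
    \<open>F k\<close>. Since \<open>w - B\<close> is measurable and below \<open>G\<close>, its
    integral is bounded by that of \<open>G\<close>, and additivity is only ever applied to the
    measurable functions \<open>w - B\<close> and \<open>B\<close>.\<close>
  ultimately have wD: "AE x in M. w x - B x \<le> D x"
  proof eventually_elim
    case (elim x)
    then have "w x \<le> B x + D x" unfolding w_def
      by (intro SUP_least) (simp add: order_trans[OF hF] add.commute)
    with elim(2) show ?case by (simp add: ennreal_minus_le_iff)
  qed
  have "(\<integral>\<^sup>+x. w x \<partial>M) \<le> (\<integral>\<^sup>+x. (w x - B x) + B x \<partial>M)"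
    using ennreal_minus_le_iff[of "w x" "B x" "w x - B x" for x]
    by (intro nn_integral_mono) (simp add: add.commute)
  also have "\<dots> = (\<integral>\<^sup>+x. (w x - B x) \<partial>M) + (\<integral>\<^sup>+x. B x \<partial>M)" by (rule nn_integral_add) auto
  also have "\<dots> \<le> (\<integral>\<^sup>+x. G x \<partial>M) + (\<integral>\<^sup>+x. B x \<partial>M)"
    proof (intro add_mono order_refl nn_integral_mono_AE)
    show "AE x in M. w x - B x \<le> G x" using wD D by eventually_elim (rule order_trans)
  qed
  also have "\<dots> < \<infinity>" using False finB by (simp add: less_top)
  finally have wfin: "(\<integral>\<^sup>+x. w x \<partial>M) < \<infinity>" .
  have "limsup (\<lambda>k. \<integral>\<^sup>+x. h k x \<partial>M) \<le> (\<integral>\<^sup>+x. limsup (\<lambda>k. h k x) \<partial>M)"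
    by (rule nn_integral_limsup[OF _ _ _ wfin]) (auto simp: w_def intro!: SUP_upper)
  also have "\<dots> \<le> (\<integral>\<^sup>+x. G x \<partial>M)"
    using lim
  proof (intro nn_integral_mono_AE, eventually_elim)
    fix x assume "limsup (\<lambda>k. F k x) \<le> G x"
    moreover have "limsup (\<lambda>k. h k x) \<le> limsup (\<lambda>k. F k x)" by (intro Limsup_mono) (auto simp: hF)
    ultimately show "limsup (\<lambda>k. h k x) \<le> G x" by simp
  qed
  finally show ?thesis by (simp add: hint)
qed auto

lemma limsup_add_ennreal_le:
  fixes x y :: "nat \<Rightarrow> ennreal"
  assumes "limsup x \<le> a" "limsup y \<le> b"
  shows "limsup (\<lambda>k. x k + y k) \<le> a + b"
proof (cases "a + b = \<infinity>")
  case False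
  show ?thesis
  proof (rule ennreal_le_epsilon)
    fix e :: real assume e: "0 < e"
    have fin: "a < \<infinity>" "b < \<infinity>" using False by (auto simp: less_top)
    have "c < c + ennreal (e/2)" if "c < \<infinity>" for c
      using that e by (cases c) (auto simp: ennreal_plus[symmetric] ennreal_less_iff simp del: ennreal_plus)
    then have "limsup x < a + ennreal (e/2)" "limsup y < b + ennreal (e/2)"
      using le_less_trans[OF assms(1)] le_less_trans[OF assms(2)] fin by blast+
    from this[THEN Limsup_lessD]
    have "\<forall>\<^sub>F k in sequentially. x k + y k \<le> a + b + ennreal e"
    proof eventually_elim
      case (elim k)
      have "x k + y k \<le> (a + ennreal (e/2)) + (b + ennreal (e/2))" using elim by (intro add_mono) auto
      also have "\<dots> = a + b + (ennreal (e/2) + ennreal (e/2))" by (simp add: ac_simps)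
      also have "ennreal (e/2) + ennreal (e/2) = ennreal e"
        using e by (subst ennreal_plus[symmetric]) auto
      finally show ?case .
    qed
    then show "limsup (\<lambda>k. x k + y k) \<le> a + b + ennreal e" by (rule Limsup_bounded)
  qed
next
  case True
  then show ?thesis by (simp only: infinity_ennreal_def top_greatest)
qed

lemma limsup_le_epsilon:
  fixes x :: "nat \<Rightarrow> ennreal"
  assumes "\<And>e::real. 0 < e \<Longrightarrow> limsup x \<le> a + ennreal e"
  shows "limsup x \<le> a"
  by (rule ennreal_le_epsilon) (rule assms)

section \<open>The weights on a single line have total mass at most one\<close>

lemma exp_neg_bounds: "0 \<le> exp_neg u" "exp_neg u \<le> 1"
  by (auto simp: exp_neg_def)

lemma borel_measurable_exp_neg[measurable]: "exp_neg \<in> borel_measurable borel"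
  unfolding exp_neg_def[abs_def] by measurable

text \<open>This is the tail of the standard exponential law, with the value 0 at infinity. It turns
  the exponential of a tail mass into an integral, so that Fubini can replace a change of
  variables.\<close>

lemma exp_neg_eq_nn_integral:
  "ennreal (exp_neg x) = (\<integral>\<^sup>+u. ennreal (exponential_density 1 u) * indicator {u. x \<le> ennreal u} u \<partial>lborel)"
proof (cases x)
  case (real r)
  have "((\<lambda>x::real. - exp (- x)) \<longlongrightarrow> - 0) at_top"
    by (intro tendsto_minus filterlim_compose[OF exp_at_bot] filterlim_uminus_at_bot_at_top)
  then have "(\<integral>\<^sup>+u. ennreal (exp (- u)) * indicator {r ..} u \<partial>lborel) = ennreal (0 - (- exp (- r)))"
    by (intro nn_integral_FTC_atLeast) (auto intro!: derivative_eq_intros)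
  moreover have "(\<integral>\<^sup>+u. ennreal (exponential_density 1 u) * indicator {u. x \<le> ennreal u} u \<partial>lborel)
     = (\<integral>\<^sup>+u. ennreal (exp (- u)) * indicator {r ..} u \<partial>lborel)"
    using real by (intro nn_integral_cong) (auto simp: exponential_density_def indicator_def ennreal_le_iff2)
  ultimately show ?thesis using real by (simp add: exp_neg_def)
qed (simp add: exp_neg_def top_unique)

text \<open>An up-closed set of reals with a minimum is a closed ray. Without one it is an
  increasing countable union of closed rays whose end points lie in it, and continuity from below
  applies.\<close>

lemma emeasure_up_closed_le:
  fixes A :: "real set"
  assumes sets: "sets M = sets borel"
    and up: "\<And>s t. s \<in> A \<Longrightarrow> s \<le> t \<Longrightarrow> t \<in> A" and le: "\<And>s. s \<in> A \<Longrightarrow> emeasure M {s..} \<le> u"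
  shows "emeasure M A \<le> u"
proof (cases "A = {} \<or> (\<exists>s\<in>A. \<forall>t\<in>A. s \<le> t)")
  case True
  then show ?thesis
  proof
    assume "\<exists>s\<in>A. \<forall>t\<in>A. s \<le> t"
    then obtain s where s: "s \<in> A" "\<forall>t\<in>A. s \<le> t" by blast
    then have "A = {s..}" using up[OF s(1)] by (auto intro: set_eqI)
    with le[OF s(1)] show ?thesis by simp
  qed simp
next
  case False
  have ex: "\<exists>q\<in>\<rat> \<inter> A. q \<le> s" if "s \<in> A" for s
  proof -
    from False that obtain t where t: "t \<in> A" "t < s" by (meson not_le_imp_less)
    from Rats_dense_in_real[OF t(2)] obtain q where "q \<in> \<rat>" "t < q" "q < s" by blast
    with up[OF t(1), of q] show ?thesis by (intro bexI[of _ q]) auto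
  qed
  define e where "e = from_nat_into (\<rat> \<inter> A)"
  have ne: "\<rat> \<inter> A \<noteq> {}" using False ex by blast
  have re: "range e = \<rat> \<inter> A" unfolding e_def
    using ne by (intro range_from_nat_into) (auto intro: countable_subset[OF _ countable_rat])
  \<comment> \<open>Running minima of an enumeration of the rationals in \<open>A\<close> make the
    rays increase; they exhaust \<open>A\<close> because every point of \<open>A\<close> has such a
    rational below it.\<close>
  define B where "B n = {Min (e ` {..n})..}" for n
  have MinA: "Min (e ` {..n}) \<in> A" for n
    using Min_in[of "e ` {..n}"] re by blast
  have "A = (\<Union>n. B n)"
  proof (intro set_eqI iffI)
    fix s assume "s \<in> A"
    then obtain q where "q \<in> \<rat> \<inter> A" "q \<le> s" using ex by blast
    then obtain n where "e n \<le> s" using re by (metis imageE)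
    moreover have "Min (e ` {..n}) \<le> e n" by (intro Min_le) auto
    ultimately have "Min (e ` {..n}) \<le> s" by (rule order_trans[rotated])
    then show "s \<in> (\<Union>n. B n)" unfolding B_def by auto
  next
    fix s assume "s \<in> (\<Union>n. B n)"
    then obtain n where "Min (e ` {..n}) \<le> s" by (auto simp: B_def)
    with up[OF MinA] show "s \<in> A" .
  qed
  moreover have "incseq B" unfolding B_def incseq_def
    by (auto intro!: Min_antimono)
  moreover have "range B \<subseteq> sets M" by (auto simp: sets B_def)
  ultimately have "emeasure M A = (SUP n. emeasure M (B n))" by (simp add: SUP_emeasure_incseq)
  also have "\<dots> \<le> u" using le MinA by (auto intro!: SUP_least simp: B_def)
  finally show ?thesis .
qed

lemma borel_measurable_tail_integral[measurable]:
  fixes g :: "real \<Rightarrow> ennreal"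
  assumes [measurable]: "g \<in> borel_measurable borel"
  shows "(\<lambda>s. \<integral>\<^sup>+t\<in>{s..}. g t \<partial>lborel) \<in> borel_measurable borel"
proof -
  have "(\<lambda>s. \<integral>\<^sup>+t. g t * indicator {p. fst p \<le> snd p} (s, t) \<partial>lborel) \<in> borel_measurable borel"
    by measurable
  moreover have "indicator {p. fst p \<le> snd p} (s, t) = (indicator {s..} t :: ennreal)" for s t :: real
    by (simp add: indicator_def)
  ultimately show ?thesis by simp
qed

text \<open>Let \<open>U\<close> be standard exponential and \<open>G\<close> the total mass. By
  Fubini the second term is the expected mass of the set where the tail is at most \<open>U\<close>.
  That mass is at most \<open>min U G\<close>, whose expectation is the probability of
  \<open>U < G\<close>, while \<open>exp_neg G\<close> is the probability of
  \<open>G \<le> U\<close>. Infinite tails need no separate treatment.\<close>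

lemma exp_neg_total_mass_le_1:
  fixes g :: "real \<Rightarrow> ennreal"
  assumes g[measurable]: "g \<in> borel_measurable borel"
  shows "ennreal (exp_neg (\<integral>\<^sup>+s. g s \<partial>lborel))
    + (\<integral>\<^sup>+s. g s * ennreal (exp_neg (\<integral>\<^sup>+t\<in>{s..}. g t \<partial>lborel)) \<partial>lborel) \<le> 1"
proof -
  let ?E = "\<lambda>u. ennreal (exponential_density 1 u)"
  define G where "G = (\<integral>\<^sup>+s. g s \<partial>lborel)"
  define H where "H s = (\<integral>\<^sup>+t\<in>{s..}. g t \<partial>lborel)" for s
  have [measurable]: "H \<in> borel_measurable borel" unfolding H_def by measurable
  have Heq: "H s = emeasure (density lborel g) {s..}" for s
    unfolding H_def by (simp add: emeasure_density)
  let ?level = "\<lambda>u. \<integral>\<^sup>+s. g s * indicator {s. H s \<le> ennreal u} s \<partial>lborel"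
  \<comment> \<open>The tail mass \<open>H\<close> decreases in \<open>s\<close>, so its sublevel
    set is up-closed, and every ray starting in it has mass at most \<open>u\<close>.\<close>
  have level: "?level u \<le> min (ennreal u) G" for u
  proof -
    have "?level u = emeasure (density lborel g) {s. H s \<le> ennreal u}"
      by (subst emeasure_density) auto
    also have "\<dots> \<le> ennreal u"
    proof (rule emeasure_up_closed_le)
      fix s t assume "s \<in> {s. H s \<le> ennreal u}" "s \<le> t"
      moreover have "H t \<le> H s" if "s \<le> t" unfolding Heq using that by (intro emeasure_mono) auto
      ultimately show "t \<in> {s. H s \<le> ennreal u}" by (auto intro: order_trans)
    qed (auto simp: Heq)
    finally show ?thesis unfolding G_def
      by (auto intro!: nn_integral_mono simp: indicator_def)
  qed
  have [measurable]: "Measurable.pred (borel \<Otimes>\<^sub>M borel) (\<lambda>p. H (fst p) \<le> ennreal (snd p))"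
    "Measurable.pred (borel \<Otimes>\<^sub>M borel) (\<lambda>p. 0 \<le> snd p \<and> snd p \<le> fst p \<and> ennreal (snd p) < G)"
    by measurable
  define I where "I s u = (if H s \<le> ennreal u then ?E u else 0)" for s u
  \<comment> \<open>For \<open>0 \<le> u\<close> the integral of \<open>J u v\<close> over
    \<open>v\<close> is at least \<open>min u G\<close>: a layer-cake form of the minimum that
    allows a second exchange of integrals.\<close>
  define J where "J u v = (if 0 \<le> v \<and> v \<le> u \<and> ennreal v < G then 1 else 0 :: ennreal)" for u v
  have [measurable]: "case_prod I \<in> borel_measurable (borel \<Otimes>\<^sub>M borel)"
    "case_prod J \<in> borel_measurable (borel \<Otimes>\<^sub>M borel)"
    unfolding I_def J_def case_prod_beta' by measurable
  have "(\<integral>\<^sup>+s. g s * ennreal (exp_neg (H s)) \<partial>lborel) = (\<integral>\<^sup>+s. (\<integral>\<^sup>+u. g s * I s u \<partial>lborel) \<partial>lborel)"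
  proof (intro nn_integral_cong)
    fix s
    have "ennreal (exp_neg (H s)) = (\<integral>\<^sup>+u. I s u \<partial>lborel)"
      unfolding exp_neg_eq_nn_integral I_def by (intro nn_integral_cong) (simp add: indicator_def)
    then show "g s * ennreal (exp_neg (H s)) = (\<integral>\<^sup>+u. g s * I s u \<partial>lborel)"
      by (simp add: nn_integral_cmult)
  qed
  also have "\<dots> = (\<integral>\<^sup>+u. (\<integral>\<^sup>+s. g s * I s u \<partial>lborel) \<partial>lborel)"
    by (rule lborel_pair.Fubini'[symmetric]) measurable
  also have "\<dots> = (\<integral>\<^sup>+u. ?E u * ?level u \<partial>lborel)"
  proof (intro nn_integral_cong)
    fix u :: real
    have "(\<integral>\<^sup>+s. g s * I s u \<partial>lborel) = (\<integral>\<^sup>+s. ?E u * (g s * indicator {s. H s \<le> ennreal u} s) \<partial>lborel)"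
      by (intro nn_integral_cong) (simp add: indicator_def I_def mult.commute)
    also have "\<dots> = ?E u * ?level u"
      by (rule nn_integral_cmult) measurable
    finally show "(\<integral>\<^sup>+s. g s * I s u \<partial>lborel) = ?E u * ?level u" .
  qed
  also have "\<dots> \<le> (\<integral>\<^sup>+u. ?E u * min (ennreal u) G \<partial>lborel)"
    by (intro nn_integral_mono mult_left_mono level) auto
  also have "\<dots> \<le> (\<integral>\<^sup>+u. ?E u * (\<integral>\<^sup>+v. J u v \<partial>lborel) \<partial>lborel)"
  proof (intro nn_integral_mono)
    fix u :: real
    consider "u < 0" | "0 \<le> u" "ennreal u < G" | r where "0 \<le> u" "G = ennreal r" "0 \<le> r" "r \<le> u"
      by (cases G; cases "u < 0") (auto simp: not_less ennreal_less_iff not_le[symmetric] top_unique)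
    then show "?E u * min (ennreal u) G \<le> ?E u * (\<integral>\<^sup>+v. J u v \<partial>lborel)"
    proof cases
      case 2
      have "ennreal v < G" if "v \<le> u" for v
        using ennreal_leI[OF that] 2(2) by (rule le_less_trans)
      then have "(\<integral>\<^sup>+v. indicator {0..u} v \<partial>lborel) \<le> (\<integral>\<^sup>+v. J u v \<partial>lborel)"
        by (intro nn_integral_mono) (auto simp: indicator_def J_def)
      then have "ennreal u \<le> (\<integral>\<^sup>+v. J u v \<partial>lborel)" using 2 by simp
      then show ?thesis by (intro mult_left_mono) (auto simp: min.coboundedI1)
    next
      case 3
      have "(\<integral>\<^sup>+v. indicator {0..<r} v \<partial>lborel) \<le> (\<integral>\<^sup>+v. J u v \<partial>lborel)"
        using 3 by (intro nn_integral_mono) (auto simp: indicator_def J_def ennreal_less_iff)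
      then have "ennreal r \<le> (\<integral>\<^sup>+v. J u v \<partial>lborel)" using 3 by simp
      then show ?thesis using 3 by (intro mult_left_mono) (auto simp: min.coboundedI2)
    qed (simp add: exponential_density_def)
  qed
  also have "\<dots> = (\<integral>\<^sup>+u. (\<integral>\<^sup>+v. ?E u * J u v \<partial>lborel) \<partial>lborel)"
    by (intro nn_integral_cong nn_integral_cmult[symmetric]) simp
  also have "\<dots> = (\<integral>\<^sup>+v. (\<integral>\<^sup>+u. ?E u * J u v \<partial>lborel) \<partial>lborel)"
    by (rule lborel_pair.Fubini'[symmetric]) measurable
  \<comment> \<open>Integrating out \<open>u\<close> gives \<open>exp (- v)\<close>, which is the
    exponential density again. What remains is exactly the complement of the event that represents
    \<open>exp_neg G\<close>.\<close>
  also have "\<dots> = (\<integral>\<^sup>+v. ?E v * indicator {v. ennreal v < G} v \<partial>lborel)"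
  proof (intro nn_integral_cong)
    fix v :: real
    have "(\<integral>\<^sup>+u. ?E u * J u v \<partial>lborel)
      = (\<integral>\<^sup>+u. (if 0 \<le> v \<and> ennreal v < G then ?E u * indicator {u. ennreal v \<le> ennreal u} u else 0) \<partial>lborel)"
      by (intro nn_integral_cong) (auto simp: indicator_def J_def exponential_density_def ennreal_le_iff2)
    also have "\<dots> = (if 0 \<le> v \<and> ennreal v < G then ennreal (exp_neg (ennreal v)) else 0)"
      by (cases "0 \<le> v \<and> ennreal v < G") (simp_all only: exp_neg_eq_nn_integral if_True if_False nn_integral_const mult_zero_left simp_thms)
    also have "\<dots> = ?E v * indicator {v. ennreal v < G} v"
      by (auto simp: exp_neg_def exponential_density_def indicator_def)
    finally show "(\<integral>\<^sup>+u. ?E u * J u v \<partial>lborel) = ?E v * indicator {v. ennreal v < G} v" .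
  qed
  finally have "ennreal (exp_neg G) + (\<integral>\<^sup>+s. g s * ennreal (exp_neg (H s)) \<partial>lborel)
     \<le> (\<integral>\<^sup>+u. ?E u * indicator {u. G \<le> ennreal u} u \<partial>lborel) + (\<integral>\<^sup>+v. ?E v * indicator {v. ennreal v < G} v \<partial>lborel)"
    unfolding exp_neg_eq_nn_integral[of G] by (rule add_left_mono)
  also have "\<dots> = (\<integral>\<^sup>+u. ?E u * indicator {u. G \<le> ennreal u} u + ?E u * indicator {v. ennreal v < G} u \<partial>lborel)"
    by (rule nn_integral_add[symmetric]) measurable
  also have "\<dots> = (\<integral>\<^sup>+u. ?E u \<partial>lborel)"
    by (intro nn_integral_cong) (auto simp: indicator_def not_less dest: leD)
  also have "\<dots> = 1"
    using prob_space.emeasure_space_1[OF prob_space_exponential_density[of 1]] by (simp add: emeasure_density)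
  finally show ?thesis unfolding G_def H_def .
qed

section \<open>Approximation by continuous functions\<close>

lemma regular_sandwich:
  fixes M :: "'a::euclidean_space measure"
  assumes sets: "sets M = sets borel" and fin: "finite_measure M" and A: "A \<in> sets borel" and e: "0 < (e::real)"
  shows "\<exists>K U. compact K \<and> K \<subseteq> A \<and> A \<subseteq> U \<and> open U \<and> emeasure M (U - K) \<le> ennreal e"
proof -
  interpret finite_measure M by fact
  have sp: "emeasure M (space M) \<noteq> \<infinity>" by (simp add: emeasure_eq_measure)
  have e2: "0 < e/2" using e by simp
  have "\<exists>K\<in>{K. K \<subseteq> A \<and> compact K}. emeasure M A < emeasure M K + ennreal (e/2)"
    by (rule SUP_approx_ennreal[OF e2 _ inner_regular[OF sets sp A]])
       (auto simp: emeasure_eq_measure)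
  then obtain K where K: "compact K" "K \<subseteq> A" "emeasure M A < emeasure M K + ennreal (e/2)" by blast
  have "\<exists>U\<in>{U. A \<subseteq> U \<and> open U}. emeasure M U < emeasure M A + ennreal (e/2)"
    by (rule INF_approx_ennreal[OF _ outer_regular[OF sets sp A]]) (use e2 in \<open>auto simp: emeasure_eq_measure\<close>)
  then obtain U where U: "open U" "A \<subseteq> U" "emeasure M U < emeasure M A + ennreal (e/2)" by blast
  have [measurable]: "K \<in> sets M" "U \<in> sets M" "A \<in> sets M"
    using K U A sets by (auto simp: compact_imp_closed)
  have "measure M A < measure M K + e/2" "measure M U < measure M A + e/2"
    using K(3) U(3) e unfolding emeasure_eq_measure
    by (simp_all add: ennreal_plus[symmetric] ennreal_less_iff del: ennreal_plus)
  moreover have "measure M (U - K) = measure M U - measure M K"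
    using K U by (intro finite_measure_Diff) auto
  ultimately have "emeasure M (U - K) \<le> ennreal e"
    unfolding emeasure_eq_measure by (intro ennreal_leI) simp
  with K U show ?thesis by blast
qed

abbreviation L1_dist :: "'a measure \<Rightarrow> ('a \<Rightarrow> real) \<Rightarrow> ('a \<Rightarrow> real) \<Rightarrow> ennreal" where
  "L1_dist M f g \<equiv> \<integral>\<^sup>+x. ennreal \<bar>f x - g x\<bar> \<partial>M"

text \<open>One function has to serve two possibly mutually singular measures. Urysohn's lemma is
  applied to the union of the two inner compact sets and the complement of the intersection of the
  two outer open sets, so the error is confined to \<open>U - K\<close> as well as to
  \<open>U' - K'\<close>.\<close>

lemma continuous_approx_indicator:
  fixes L P :: "'a::euclidean_space measure"
  assumes L: "sets L = sets borel" "finite_measure L" and P: "sets P = sets borel" "finite_measure P"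
    and A: "A \<in> sets borel" and e: "0 < (e::real)"
  shows "\<exists>\<phi>::'a \<Rightarrow> real. continuous_on UNIV \<phi> \<and> (\<forall>x. 0 \<le> \<phi> x \<and> \<phi> x \<le> 1)
    \<and> L1_dist L \<phi> (indicator A) \<le> ennreal e
    \<and> L1_dist P \<phi> (indicator A) \<le> ennreal e"
proof -
  obtain K U where K: "compact K" "K \<subseteq> A" "A \<subseteq> U" "open U" "emeasure L (U - K) \<le> ennreal e"
    using regular_sandwich[OF L A e] by blast
  obtain K' U' where K': "compact K'" "K' \<subseteq> A" "A \<subseteq> U'" "open U'" "emeasure P (U' - K') \<le> ennreal e"
    using regular_sandwich[OF P A e] by blast
  have dis: "(K \<union> K') \<inter> (- (U \<inter> U')) = {}" using K K' by blast
  have "closed (K \<union> K')" "closed (- (U \<inter> U'))" using K K' by (auto intro: compact_imp_closed)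
  from Urysohn[OF this dis, of "1::real" 0] obtain \<phi> :: "'a \<Rightarrow> real" where \<phi>: "continuous_on UNIV \<phi>"
    "\<And>x. \<phi> x \<in> closed_segment 1 0" "\<And>x. x \<in> K \<union> K' \<Longrightarrow> \<phi> x = 1" "\<And>x. x \<in> - (U \<inter> U') \<Longrightarrow> \<phi> x = 0"
    by blast
  have bd: "0 \<le> \<phi> x \<and> \<phi> x \<le> 1" for x using \<phi>(2)[of x] by (simp add: closed_segment_eq_real_ivl split: if_splits)
  have gen: "ennreal \<bar>\<phi> x - indicator A x\<bar> \<le> indicator (V - C) x"
    if "C \<subseteq> A" "A \<subseteq> V" "x \<in> C \<Longrightarrow> \<phi> x = 1" "x \<notin> V \<Longrightarrow> \<phi> x = 0" for C V x
  proof (cases "x \<in> V - C")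
    case True
    have "\<bar>\<phi> x - indicator A x\<bar> \<le> 1" using bd[of x] by (simp add: indicator_def)
    then have "ennreal \<bar>\<phi> x - indicator A x\<bar> \<le> ennreal 1" by (rule ennreal_leI)
    then show ?thesis using True by simp
  next
    case False
    then have "\<phi> x = indicator A x" using that by (cases "x \<in> C") (auto simp: indicator_def)
    then show ?thesis by simp
  qed
  have dev: "ennreal \<bar>\<phi> x - indicator A x\<bar> \<le> indicator (U - K) x"
    "ennreal \<bar>\<phi> x - indicator A x\<bar> \<le> indicator (U' - K') x" for x
    using \<phi>(3)[of x] \<phi>(4)[of x] K K' by (auto intro!: gen)
  have "L1_dist L \<phi> (indicator A) \<le> (\<integral>\<^sup>+x. indicator (U - K) x \<partial>L)"
    by (intro nn_integral_mono dev)
  also have "\<dots> \<le> ennreal e" using K L by (subst nn_integral_indicator) (simp_all add: borel_open borel_closed compact_imp_closed)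
  finally have 1: "L1_dist L \<phi> (indicator A) \<le> ennreal e" .
  have "L1_dist P \<phi> (indicator A) \<le> (\<integral>\<^sup>+x. indicator (U' - K') x \<partial>P)"
    by (intro nn_integral_mono dev)
  also have "\<dots> \<le> ennreal e" using K' P by (subst nn_integral_indicator) (simp_all add: borel_open borel_closed compact_imp_closed)
  finally have 2: "L1_dist P \<phi> (indicator A) \<le> ennreal e" .
  show ?thesis using \<phi>(1) bd 1 2 by blast
qed

text \<open>The sum counts the thresholds \<open>i / n\<close> not exceeding \<open>t\<close>; their
  number is the integer part of \<open>n * t\<close>.\<close>

lemma staircase_approx:
  fixes t :: real
  assumes "0 \<le> t" "t \<le> 1" "0 < n"
  shows "\<bar>(\<Sum>i=1..n. indicator {x. real i / real n \<le> x} t) / real n - t\<bar> \<le> 1 / real n"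
proof -
  have "{i\<in>{1..n}. real i / real n \<le> t} = {1..nat \<lfloor>real n * t\<rfloor>}"
  proof (intro set_eqI iffI)
    fix i assume i: "i \<in> {1..nat \<lfloor>real n * t\<rfloor>}"
    then have "int i \<le> \<lfloor>real n * t\<rfloor>" by auto
    then have "real i \<le> real n * t" by (simp add: le_floor_iff)
    moreover have "real n * t \<le> real n" using assms by (intro mult_left_le) auto
    ultimately have "real i \<le> real n" by linarith
    then have "i \<le> n" by simp
    with \<open>real i \<le> real n * t\<close> show "i \<in> {i\<in>{1..n}. real i / real n \<le> t}"
      using i assms(3) by (simp add: pos_divide_le_eq mult.commute)
  next
    fix i assume "i \<in> {i\<in>{1..n}. real i / real n \<le> t}"
    then show "i \<in> {1..nat \<lfloor>real n * t\<rfloor>}" using assms by (auto simp: le_nat_iff le_floor_iff field_simps)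
  qed
  moreover have "(\<Sum>i=1..n. indicator {x. real i / real n \<le> x} t) = real (card {i\<in>{1..n}. real i / real n \<le> t})"
    by (simp add: indicator_def sum.If_cases Int_def)
  ultimately have eq: "(\<Sum>i=1..n. indicator {x. real i / real n \<le> x} t) = real_of_int \<lfloor>real n * t\<rfloor>"
    using assms by simp
  have "\<bar>real_of_int \<lfloor>real n * t\<rfloor> - real n * t\<bar> \<le> 1" by linarith
  then have "\<bar>real_of_int \<lfloor>real n * t\<rfloor> - real n * t\<bar> / real n \<le> 1 / real n"
    by (intro divide_right_mono) auto
  also have "\<bar>real_of_int \<lfloor>real n * t\<rfloor> - real n * t\<bar> / real n = \<bar>real_of_int \<lfloor>real n * t\<rfloor> / real n - t\<bar>"
  proof -
    have "real_of_int \<lfloor>real n * t\<rfloor> / real n - t = (real_of_int \<lfloor>real n * t\<rfloor> - real n * t) / real n"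
      using assms by (simp add: diff_divide_distrib)
    then show ?thesis by (simp add: abs_divide)
  qed
  finally show ?thesis unfolding eq .
qed

lemma continuous_approx_unit:
  fixes L P :: "'a::euclidean_space measure" and p :: "'a \<Rightarrow> real"
  assumes L: "sets L = sets borel" "finite_measure L" and P: "sets P = sets borel" "finite_measure P"
    and p[measurable]: "p \<in> borel_measurable borel" and p01: "\<And>x. 0 \<le> p x" "\<And>x. p x \<le> 1" and e: "0 < (e::real)"
  shows "\<exists>q::'a \<Rightarrow> real. continuous_on UNIV q \<and> (\<forall>x. 0 \<le> q x \<and> q x \<le> 1)
    \<and> L1_dist L q p \<le> ennreal e \<and> L1_dist P q p \<le> ennreal e"
proof -
  interpret L: finite_measure L by fact
  interpret P: finite_measure P by fact
  \<comment> \<open>The staircase of superlevel sets is off by \<open>1 / n\<close> pointwise, hence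
    by at most \<open>c / n\<close> in either integral. The \<open>n\<close> errors from smoothing
    the levels are averaged, so an error \<open>e / 2\<close> per level remains \<open>e / 2\<close>
    in total.\<close>
  define c where "c = max (measure L (space L)) (measure P (space P))"
  obtain n :: nat where n: "0 < n" "c / real n \<le> e / 2"
  proof -
    obtain n :: nat where "2 * c / e < real n" using reals_Archimedean2 by blast
    then have "c / real (Suc n) \<le> e / 2" using e by (simp add: field_simps)
    then show ?thesis using that[of "Suc n"] by simp
  qed
  define A where "A i = {x. real i / real n \<le> p x}" for i
  have [measurable]: "A i \<in> sets borel" for i unfolding A_def by measurable
  have e2: "0 < e/2" using e by simp
  have "\<forall>i. \<exists>\<phi>::'a \<Rightarrow> real. continuous_on UNIV \<phi> \<and> (\<forall>x. 0 \<le> \<phi> x \<and> \<phi> x \<le> 1)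
    \<and> L1_dist L \<phi> (indicator (A i)) \<le> ennreal (e/2)
    \<and> L1_dist P \<phi> (indicator (A i)) \<le> ennreal (e/2)"
    by (intro allI continuous_approx_indicator L P e2) measurable
  from choice[OF this] obtain \<phi> where \<phi>: "\<And>i. continuous_on UNIV (\<phi> i)" "\<And>i x. 0 \<le> \<phi> i x" "\<And>i x. \<phi> i x \<le> (1::real)"
    and \<phi>L: "\<And>i. L1_dist L (\<phi> i) (indicator (A i)) \<le> ennreal (e/2)"
    and \<phi>P: "\<And>i. L1_dist P (\<phi> i) (indicator (A i)) \<le> ennreal (e/2)"
    by blast
  define q where "q x = (\<Sum>i=1..n. \<phi> i x) / real n" for x
  have [measurable]: "\<phi> i \<in> borel_measurable borel" for i
    using \<phi>(1) by (rule borel_measurable_continuous_onI)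
  have qcont: "continuous_on UNIV q" unfolding q_def using n by (intro continuous_intros \<phi>) auto
  have q0: "0 \<le> q x" for x unfolding q_def by (intro divide_nonneg_nonneg sum_nonneg \<phi>) simp
  have q1: "q x \<le> 1" for x
    using sum_bounded_above[of "{1..n}" "\<lambda>i. \<phi> i x" 1] \<phi>(3) n unfolding q_def by (simp add: divide_le_eq)
  have dev: "\<bar>q x - p x\<bar> \<le> (\<Sum>i=1..n. \<bar>\<phi> i x - indicator (A i) x\<bar>) / real n + 1 / real n" for x
  proof -
    have "\<bar>(\<Sum>i=1..n. indicator (A i) x) / real n - p x\<bar> \<le> 1 / real n"
      using staircase_approx[OF p01(1)[of x] p01(2)[of x] n(1)] unfolding A_def indicator_def by simp
    moreover have "\<bar>q x - (\<Sum>i=1..n. indicator (A i) x) / real n\<bar> \<le> (\<Sum>i=1..n. \<bar>\<phi> i x - indicator (A i) x\<bar>) / real n"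
      unfolding q_def diff_divide_distrib[symmetric] sum_subtractf[symmetric]
      by (simp add: abs_divide divide_right_mono sum_abs)
    ultimately show ?thesis by linarith
  qed
  have int: "L1_dist M q p \<le> ennreal e"
    if M: "sets M = sets borel" "finite_measure M" "measure M (space M) \<le> c"
      "\<And>i. L1_dist M (\<phi> i) (indicator (A i)) \<le> ennreal (e/2)" for M :: "'a measure"
  proof -
    interpret M: finite_measure M by fact
    have [measurable_cong]: "sets M = sets borel" by fact
    have "L1_dist M q p
      \<le> (\<integral>\<^sup>+x. (\<Sum>i=1..n. ennreal \<bar>\<phi> i x - indicator (A i) x\<bar> ) * ennreal (1 / real n) + ennreal (1 / real n) \<partial>M)"
    proof (intro nn_integral_mono)
      fix x
      have "ennreal \<bar>q x - p x\<bar> \<le> ennreal ((\<Sum>i=1..n. \<bar>\<phi> i x - indicator (A i) x\<bar>) * (1 / real n) + 1 / real n)"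
        using dev[of x] by (intro ennreal_leI) simp
      also have "\<dots> = (\<Sum>i=1..n. ennreal \<bar>\<phi> i x - indicator (A i) x\<bar> ) * ennreal (1 / real n) + ennreal (1 / real n)"
        by (subst ennreal_plus, simp add: sum_nonneg, simp, subst ennreal_mult, simp add: sum_nonneg, simp, subst sum_ennreal[symmetric], simp, simp)
      finally show "ennreal \<bar>q x - p x\<bar> \<le> \<dots>" .
    qed
    also have "\<dots> = (\<Sum>i=1..n. L1_dist M (\<phi> i) (indicator (A i))) * ennreal (1 / real n) + ennreal (1 / real n) * emeasure M (space M)"
      by (simp add: nn_integral_add nn_integral_multc nn_integral_sum del: sum_ennreal)
    also have "\<dots> \<le> (\<Sum>i=1..n. ennreal (e/2)) * ennreal (1 / real n) + ennreal (1 / real n) * ennreal c"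
      using M by (intro add_mono mult_mono sum_mono) (auto simp: M.emeasure_eq_measure intro: ennreal_leI)
    also have "\<dots> = ennreal (e/2 + c / real n)"
    proof -
      have "(\<Sum>i=1..n. ennreal (e/2)) = ennreal (real n * (e/2))"
        using e by (simp add: ennreal_of_nat_eq_real_of_nat ennreal_mult[symmetric])
      moreover have "0 \<le> c" using M(3) measure_nonneg[of M "space M"] by linarith
      ultimately show ?thesis using n e
        by (simp add: ennreal_mult[symmetric] ennreal_plus[symmetric] del: ennreal_plus)
    qed
    also have "\<dots> \<le> ennreal e" using n(2) by (intro ennreal_leI) linarith
    finally show ?thesis .
  qed
  show ?thesis
    using qcont q0 q1 int[OF L _ \<phi>L] int[OF P _ \<phi>P] by (auto simp: c_def)
qed

lemma continuous_approx_bounded: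
  fixes L P :: "'a::euclidean_space measure" and p :: "'a \<Rightarrow> real"
  assumes L: "sets L = sets borel" "finite_measure L" and P: "sets P = sets borel" "finite_measure P"
    and p[measurable]: "p \<in> borel_measurable borel" and p0: "\<And>x. 0 \<le> p x" "\<And>x. p x \<le> b" and e: "0 < (e::real)"
  shows "\<exists>q::'a \<Rightarrow> real. continuous_on UNIV q \<and> (\<forall>x. 0 \<le> q x \<and> q x \<le> b)
    \<and> L1_dist L q p \<le> ennreal e \<and> L1_dist P q p \<le> ennreal e"
proof (cases "b = 0")
  case True
  then have "p = (\<lambda>x. 0)" using p0 by (auto intro: antisym)
  then show ?thesis using True by (intro exI[of _ "\<lambda>x. 0"]) auto
next
  case False
  with p0[of undefined] have b: "0 < b" by linarith
  note [measurable_cong] = L(1) P(1)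
  have "\<exists>q::'a \<Rightarrow> real. continuous_on UNIV q \<and> (\<forall>x. 0 \<le> q x \<and> q x \<le> 1)
    \<and> (\<integral>\<^sup>+x. ennreal \<bar>q x - p x / b\<bar> \<partial>L) \<le> ennreal (e / b) \<and> (\<integral>\<^sup>+x. ennreal \<bar>q x - p x / b\<bar> \<partial>P) \<le> ennreal (e / b)"
    by (rule continuous_approx_unit[OF L P]) (use b p0 e in \<open>auto simp: field_simps\<close>)
  then obtain q :: "'a \<Rightarrow> real" where q: "continuous_on UNIV q" "\<And>x. 0 \<le> q x" "\<And>x. q x \<le> 1"
    "(\<integral>\<^sup>+x. ennreal \<bar>q x - p x / b\<bar> \<partial>L) \<le> ennreal (e / b)" "(\<integral>\<^sup>+x. ennreal \<bar>q x - p x / b\<bar> \<partial>P) \<le> ennreal (e / b)"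
    by blast
  have [measurable]: "q \<in> borel_measurable borel" using q(1) by (rule borel_measurable_continuous_onI)
  have "\<bar>b * q x - p x\<bar> = b * \<bar>q x - p x / b\<bar>" for x
  proof -
    have "b * q x - p x = b * (q x - p x / b)" using b by (simp add: right_diff_distrib)
    then show ?thesis using b by (simp add: abs_mult)
  qed
  then have eq: "ennreal \<bar>b * q x - p x\<bar> = ennreal b * ennreal \<bar>q x - p x / b\<bar>" for x
    using b by (simp add: ennreal_mult)
  have sc: "ennreal b * y \<le> ennreal e" if "y \<le> ennreal (e / b)" for y
  proof -
    have "ennreal b * y \<le> ennreal b * ennreal (e / b)" using that by (rule mult_left_mono) simp
    also have "\<dots> = ennreal e" using b e by (simp add: ennreal_mult[symmetric])
    finally show ?thesis .
  qed
  have "(\<integral>\<^sup>+x. ennreal \<bar>b * q x - p x\<bar> \<partial>L) \<le> ennreal e" "(\<integral>\<^sup>+x. ennreal \<bar>b * q x - p x\<bar> \<partial>P) \<le> ennreal e"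
    unfolding eq by (subst nn_integral_cmult, measurable, rule sc, rule q)+
  then show ?thesis using q b
    by (intro exI[of _ "\<lambda>x. b * q x"]) (auto intro!: continuous_intros mult_left_le)
qed

text \<open>\<open>a\<close> may take the value infinity and subtraction on \<open>ennreal\<close>
  stops at 0, so the distance is recorded as two one-sided differences. Truncation at a large
  integer costs little because the integral is finite; the truncated function is then
  smoothed.\<close>

lemma continuous_approx_integrable:
  fixes L :: "'a::euclidean_space measure" and a :: "'a \<Rightarrow> ennreal"
  assumes L: "sets L = sets borel" "finite_measure L"
    and a[measurable]: "a \<in> borel_measurable borel" and fin: "(\<integral>\<^sup>+x. a x \<partial>L) < \<infinity>" and e: "0 < (e::real)"
  shows "\<exists>b (B::real). continuous_on UNIV b \<and> 0 \<le> B \<and> (\<forall>x. 0 \<le> b x \<and> b x \<le> B)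
    \<and> (\<integral>\<^sup>+x. a x - ennreal (b x) \<partial>L) \<le> ennreal e \<and> (\<integral>\<^sup>+x. ennreal (b x) - a x \<partial>L) \<le> ennreal e"
proof -
  note [measurable_cong] = L(1)
  define t where "t n x = min (a x) (of_nat n)" for n x
  have [measurable]: "t n \<in> borel_measurable borel" for n unfolding t_def by measurable
  have sup: "(SUP n. t n x) = a x" for x
  proof (rule antisym)
    have "a x = min (a x) (SUP n. of_nat n)" by (simp add: ennreal_SUP_of_nat_eq_top)
    also have "\<dots> \<le> (SUP n. t n x)"
      unfolding t_def by (metis (no_types, lifting) SUP_cong inf_SUP inf_min order_refl)
    finally show "a x \<le> (SUP n. t n x)" .
  qed (auto simp: t_def intro!: SUP_least)
  have "incseq t" unfolding t_def incseq_def le_fun_def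
    by (auto intro: min.coboundedI2 simp: min_le_iff_disj)
  then have eq: "(\<integral>\<^sup>+x. a x \<partial>L) = (SUP n. \<integral>\<^sup>+x. t n x \<partial>L)"
    by (subst nn_integral_monotone_convergence_SUP[symmetric]) (auto simp: sup)
  have "(\<integral>\<^sup>+x. a x \<partial>L) \<noteq> \<infinity>" using fin by simp
  with eq e have "\<exists>n\<in>UNIV. (\<integral>\<^sup>+x. a x \<partial>L) < (\<integral>\<^sup>+x. t n x \<partial>L) + ennreal (e/2)"
    by (intro SUP_approx_ennreal) simp_all
  then obtain n where n: "(\<integral>\<^sup>+x. a x \<partial>L) < (\<integral>\<^sup>+x. t n x \<partial>L) + ennreal (e/2)" by blast
  have "(\<integral>\<^sup>+x. t n x \<partial>L) \<le> (\<integral>\<^sup>+x. a x \<partial>L)" by (intro nn_integral_mono) (simp add: t_def)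
  with fin have tfin: "(\<integral>\<^sup>+x. t n x \<partial>L) \<noteq> \<infinity>" by (auto simp: top_unique)
  have "(\<integral>\<^sup>+x. a x - t n x \<partial>L) = (\<integral>\<^sup>+x. a x \<partial>L) - (\<integral>\<^sup>+x. t n x \<partial>L)"
    using tfin by (intro nn_integral_diff) (auto simp: t_def)
  also have "\<dots> \<le> ennreal (e/2)"
    using n[THEN less_imp_le] tfin by (simp add: ennreal_minus_le_iff)
  finally have at: "(\<integral>\<^sup>+x. a x - t n x \<partial>L) \<le> ennreal (e/2)" .
  define p where "p x = enn2real (t n x)" for x
  have tn: "t n x \<le> ennreal (real n)" for x by (simp add: t_def ennreal_of_nat_eq_real_of_nat)
  have pt: "ennreal (p x) = t n x" for x
    unfolding p_def using le_less_trans[OF tn[of x] ennreal_less_top] by (simp add: less_top)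
  have p: "0 \<le> p x" "p x \<le> real n" for x
    using tn[of x] unfolding pt[symmetric] by (simp_all add: p_def[of x])
  have e2: "0 < e/2" using e by simp
  have [measurable]: "p \<in> borel_measurable borel" unfolding p_def by measurable
  from continuous_approx_bounded[where p = p, OF L L _ p e2] obtain b where b: "continuous_on UNIV b"
     "\<And>x. 0 \<le> b x" "\<And>x. b x \<le> real n" "L1_dist L b p \<le> ennreal (e/2)"
    by auto
  have [measurable]: "b \<in> borel_measurable borel" using b(1) by (rule borel_measurable_continuous_onI)
  have d: "ennreal u \<le> ennreal v + ennreal \<bar>v - u\<bar>" if "0 \<le> v" for u v :: real
  proof -
    have "ennreal u \<le> ennreal (v + \<bar>v - u\<bar>)" by (rule ennreal_leI) linarith
    then show ?thesis using that by simp
  qed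
  have "(\<integral>\<^sup>+x. a x - ennreal (b x) \<partial>L) \<le> (\<integral>\<^sup>+x. (a x - t n x) + ennreal \<bar>b x - p x\<bar> \<partial>L)"
  proof (intro nn_integral_mono)
    fix x
    have "a x \<le> t n x + (a x - t n x)"
      using ennreal_minus_le_iff[of "a x" "t n x" "a x - t n x"] by simp
    also have "\<dots> \<le> (ennreal (b x) + ennreal \<bar>b x - p x\<bar>) + (a x - t n x)"
      using d[of "b x" "p x"] b by (intro add_right_mono) (simp add: pt)
    finally show "a x - ennreal (b x) \<le> (a x - t n x) + ennreal \<bar>b x - p x\<bar>"
      by (simp add: ennreal_minus_le_iff ac_simps)
  qed
  also have "\<dots> = (\<integral>\<^sup>+x. (a x - t n x) \<partial>L) + L1_dist L b p"
    by (rule nn_integral_add) measurable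
  also have "\<dots> \<le> ennreal (e/2) + ennreal (e/2)" by (intro add_mono at b)
  also have "\<dots> = ennreal e" using e by (subst ennreal_plus[symmetric]) auto
  finally have 1: "(\<integral>\<^sup>+x. a x - ennreal (b x) \<partial>L) \<le> ennreal e" .
  have "(\<integral>\<^sup>+x. ennreal (b x) - a x \<partial>L) \<le> L1_dist L b p"
  proof (intro nn_integral_mono)
    fix x
    have "ennreal (b x) \<le> t n x + ennreal \<bar>b x - p x\<bar>"
      using d[of "p x" "b x"] p by (simp add: pt abs_minus_commute)
    also have "\<dots> \<le> a x + ennreal \<bar>b x - p x\<bar>" by (intro add_right_mono) (simp add: t_def)
    finally show "ennreal (b x) - a x \<le> ennreal \<bar>b x - p x\<bar>" by (simp add: ennreal_minus_le_iff)
  qed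
  also have "\<dots> \<le> ennreal (e/2)" by (rule b)
  also have "\<dots> \<le> ennreal e" using e by (intro ennreal_leI) simp
  finally show ?thesis using 1 b by (intro exI[of _ b] exI[of _ "real n"]) auto
qed

text \<open>\<open>1 - exp (- p) * (1 + p) + exp (- p) * m\<close> is the tangent at \<open>p\<close> of the concave function
  \<open>m \<mapsto> 1 - exp (- m)\<close>.\<close>

lemma exp_tangent: "1 - exp (- m) \<le> 1 - exp (- p) * (1 + p) + exp (- p) * (m::real)"
proof -
  have "exp (- p) * (1 + (p - m)) \<le> exp (- p) * exp (p - m)"
    by (intro mult_left_mono exp_ge_add_one_self) simp
  also have "\<dots> = exp (- m)" by (simp add: exp_add[symmetric])
  finally show ?thesis by (simp add: algebra_simps)
qed

text \<open>Up to the cap \<open>b\<close> the tangent touches the curve at \<open>m\<close>. Beyond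
  it the slope is frozen at \<open>exp (- b)\<close>, and the excess is at most that slope times
  \<open>m\<close>, hence small after integration against a finite mass.\<close>

lemma exp_tangent_truncated:
  fixes m :: real
  assumes "0 \<le> m" "0 \<le> b"
  defines "p \<equiv> min m b"
  shows "1 - exp (- p) * (1 + p) + exp (- p) * m \<le> 1 - exp (- m) + exp (- b) * m"
proof (cases "m \<le> b")
  case True
  then show ?thesis using assms by (simp add: p_def algebra_simps)
next
  case False
  then have "exp (- m) \<le> exp (- b)" "0 \<le> exp (- b) * b" "p = b" using assms by auto
  moreover have "exp (- b) * (1 + b) = exp (- b) + exp (- b) * b" by (simp add: algebra_simps)
  ultimately show ?thesis unfolding \<open>p = b\<close> by linarith
qed

lemma exp_tangent_const_nonneg: "0 \<le> p \<Longrightarrow> 0 \<le> 1 - exp (- p) * (1 + p::real)"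
  using exp_tangent[of 0 p] by simp

text \<open>The derivative \<open>p * exp (- p)\<close> of the tangent's constant term lies between
  0 and 1 for nonnegative \<open>p\<close>. The first case is monotonicity and the second the unit
  Lipschitz bound; both come from \<open>1 + x \<le> exp x\<close>.\<close>

lemma exp_tangent_const_lipschitz:
  fixes p q :: real
  assumes "0 \<le> p" "0 \<le> q"
  shows "1 - exp (- p) * (1 + p) \<le> 1 - exp (- q) * (1 + q) + \<bar>p - q\<bar>"
proof (cases "p \<le> q")
  case True
  have "1 + q \<le> (1 + p) * (1 + (q - p))" using True assms by (simp add: algebra_simps) (smt (verit) mult_left_mono)
  also have "\<dots> \<le> (1 + p) * exp (q - p)" using assms by (intro mult_left_mono exp_ge_add_one_self) simp
  finally have "exp (- q) * (1 + q) \<le> exp (- q) * ((1 + p) * exp (q - p))" by (intro mult_left_mono) auto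
  also have "\<dots> = exp (- p) * (1 + p)" by (simp add: exp_diff exp_minus field_simps)
  finally show ?thesis by simp
next
  case False
  have 1: "exp (- q) * (1 + q) \<le> 1" using exp_tangent_const_nonneg[OF assms(2)] by simp
  have "1 - (p - q) \<le> exp (q - p)" using exp_ge_add_one_self[of "q - p"] by linarith
  then have "exp (- q) * (1 + q) * (1 - (p - q)) \<le> exp (- q) * (1 + q) * exp (q - p)"
    using assms by (intro mult_left_mono) auto
  also have "\<dots> = exp (- p) * (1 + q)" by (simp add: exp_diff exp_minus field_simps)
  also have "\<dots> \<le> exp (- p) * (1 + p)" using False by simp
  finally have "exp (- q) * (1 + q) \<le> exp (- p) * (1 + p) + exp (- q) * (1 + q) * (p - q)"
    by (simp add: algebra_simps)
  moreover have "exp (- q) * (1 + q) * (p - q) \<le> p - q"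
    using mult_right_mono[OF 1, of "p - q"] False by simp
  ultimately show ?thesis by simp
qed

lemma exp_neg_lipschitz:
  fixes p q :: real
  assumes "0 \<le> p"
  shows "exp (- p) \<le> exp (- q) + \<bar>p - q\<bar>"
proof (cases "p \<le> q")
  case True
  have "exp (- p) * (q - p) \<le> 1 * (q - p)" using True assms by (intro mult_right_mono) auto
  then show ?thesis using exp_tangent[of q p] True by (simp add: algebra_simps)
next
  case False
  then have "exp (- p) \<le> exp (- q)" by simp
  then show ?thesis by linarith
qed

text \<open>Tangents at a continuous \<open>p\<close> bound the \<open>k\<close>-th integral by a
  term free of \<open>k\<close> plus the integral of a continuous function against
  \<open>Pk k\<close>, to which \<open>usc\<close> applies. A \<open>p\<close> close to
  \<open>m\<close> then makes the bound almost sharp for the limit. The roles are asymmetric: for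
  \<open>P\<close> the density must be exact off \<open>N\<close>, for \<open>Pk k\<close> it only
  has to stay below the measure.\<close>

lemma limsup_integral_one_minus_exp_le:
  fixes L P :: "'a::euclidean_space measure" and Pk :: "nat \<Rightarrow> 'a measure" and m :: "'a \<Rightarrow> real"
    and mk :: "nat \<Rightarrow> 'a \<Rightarrow> real" and a :: "'a \<Rightarrow> ennreal"
  assumes L: "sets L = sets borel" "finite_measure L" and P: "sets P = sets borel" "finite_measure P"
    and Pk: "\<And>k. sets (Pk k) = sets borel"
    and m[measurable]: "m \<in> borel_measurable borel" and m0: "\<And>x. 0 \<le> m x"
    and mk[measurable]: "\<And>k. mk k \<in> borel_measurable borel" and mk0: "\<And>k x. 0 \<le> mk k x"
    and N: "N \<in> null_sets L"
    and ac: "\<And>A. A \<in> sets borel \<Longrightarrow> A \<inter> N = {} \<Longrightarrow> emeasure P A = (\<integral>\<^sup>+x\<in>A. ennreal (m x) \<partial>L)"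
    and ack: "\<And>k A. A \<in> sets borel \<Longrightarrow> (\<integral>\<^sup>+x\<in>A. ennreal (mk k x) \<partial>L) \<le> emeasure (Pk k) A"
    and usc: "\<And>\<theta>::'a \<Rightarrow> real. continuous_on UNIV \<theta> \<Longrightarrow> (\<And>x. 0 \<le> \<theta> x) \<Longrightarrow> bounded (range \<theta>)
      \<Longrightarrow> limsup (\<lambda>k. \<integral>\<^sup>+x. ennreal (\<theta> x) \<partial>Pk k) \<le> (\<integral>\<^sup>+x. ennreal (\<theta> x) \<partial>P)"
    and a[measurable]: "a \<in> borel_measurable borel" and afin: "(\<integral>\<^sup>+x. a x \<partial>L) < \<infinity>"
  shows "limsup (\<lambda>k. \<integral>\<^sup>+x. a x * ennreal (1 - exp (- mk k x)) \<partial>L)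
    \<le> (\<integral>\<^sup>+x. a x * ennreal (1 - exp (- m x)) \<partial>L)"
proof (rule limsup_le_epsilon)
  fix e :: real assume e: "0 < e"
  interpret L: finite_measure L by fact
  interpret P: finite_measure P by fact
  note [measurable_cong] = L(1) P(1) Pk
  have spP: "space P = UNIV" "space L = UNIV" using P(1) L(1) by (auto dest: sets_eq_imp_space_eq)
  have N'[measurable]: "N \<in> sets borel" using N L(1) by auto
  \<comment> \<open>Six errors are paid: passing from \<open>a\<close> to \<open>b\<close>, from
    \<open>p\<close> to \<open>ps\<close> in two integrals, the part of \<open>P\<close> on
    \<open>N\<close>, the way back from \<open>b\<close> to \<open>a\<close>, and the overshoot of
    the capped tangent.\<close>
  define d where "d = e / 6"
  have d: "0 < d" using e by (simp add: d_def)
  obtain b B where b: "continuous_on UNIV b" "0 \<le> B" "\<And>x. 0 \<le> b x" "\<And>x. b x \<le> (B::real)"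
    and ab: "(\<integral>\<^sup>+x. a x - ennreal (b x) \<partial>L) \<le> ennreal d" and ba: "(\<integral>\<^sup>+x. ennreal (b x) - a x \<partial>L) \<le> ennreal d"
    using continuous_approx_integrable[OF L a afin d] by blast
  have [measurable]: "b \<in> borel_measurable borel" using b(1) by (rule borel_measurable_continuous_onI)
  define c where "c = measure P UNIV"
  \<comment> \<open>\<open>T\<close> caps the tangency point. The slope \<open>exp (- T)\<close> has
    to be negligible against the whole mass \<open>c\<close> of \<open>P\<close>, because it is
    charged both on \<open>N\<close> and where \<open>m\<close> exceeds \<open>T\<close>.\<close>
  obtain T where T: "0 \<le> T" "B * exp (- T) * c \<le> d"
  proof -
    have "((\<lambda>t. B * exp (- t) * c) \<longlongrightarrow> B * 0 * c) at_top"
      by (intro tendsto_intros filterlim_compose[OF exp_at_bot] filterlim_uminus_at_bot_at_top)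
    then have "eventually (\<lambda>t. B * exp (- t) * c < d) at_top" using d by (auto dest: order_tendstoD)
    then have "eventually (\<lambda>t. B * exp (- t) * c < d \<and> 0 \<le> t) at_top"
      using eventually_ge_at_top by (rule eventually_conj)
    then obtain t where "B * exp (- t) * c < d \<and> 0 \<le> t" by (rule eventually_happens'[OF trivial_limit_at_top_linorder, elim_format]) blast
    then show ?thesis using that by auto
  qed
  \<comment> \<open>On \<open>N\<close> the value is free as far as \<open>L\<close> is concerned;
    taking the cap \<open>T\<close> there gives the singular part of \<open>P\<close> the smallest
    slope.\<close>
  define ps where "ps x = (if x \<in> N then T else min (m x) T)" for x
  have ps: "0 \<le> ps x" "ps x \<le> T" for x using T m0[of x] by (auto simp: ps_def)
  have [measurable]: "ps \<in> borel_measurable borel" unfolding ps_def by measurable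
  \<comment> \<open>The denominator \<open>B + 1\<close> keeps the quotient meaningful when
    \<open>B\<close> is 0; errors multiplied by \<open>b \<le> B\<close> stay below
    \<open>d\<close>.\<close>
  define \<delta> where "\<delta> = d / (B + 1)"
  have \<delta>: "0 < \<delta>" "B * \<delta> \<le> d" using d b(2) by (auto simp: \<delta>_def field_simps)
  obtain p where p: "continuous_on UNIV p" "\<And>x. 0 \<le> p x" "\<And>x. p x \<le> T"
    and pL: "L1_dist L p ps \<le> ennreal \<delta>" and pP: "L1_dist P p ps \<le> ennreal \<delta>"
    using continuous_approx_bounded[where p = ps, OF L P _ ps \<delta>(1)] by auto
  have [measurable]: "p \<in> borel_measurable borel" using p(1) by (rule borel_measurable_continuous_onI)
  define h where "h t = 1 - exp (- t) * (1 + t)" for t :: real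
  have [measurable]: "h \<in> borel_measurable borel" unfolding h_def by measurable
  have h0: "0 \<le> h t" if "0 \<le> t" for t using exp_tangent_const_nonneg[OF that] by (simp add: h_def)
  let ?G = "\<lambda>k. \<integral>\<^sup>+x. a x * ennreal (1 - exp (- mk k x)) \<partial>L" and ?Hp = "\<integral>\<^sup>+x. ennreal (b x * h (p x)) \<partial>L"
  let ?Ep = "\<integral>\<^sup>+x. ennreal (b x * exp (- p x)) \<partial>P" and ?Epk = "\<lambda>k. \<integral>\<^sup>+x. ennreal (b x * exp (- p x)) \<partial>Pk k"
  have Bd: "ennreal B * y \<le> ennreal d" if "y \<le> ennreal \<delta>" for y
  proof -
    have "ennreal B * y \<le> ennreal B * ennreal \<delta>" using that by (rule mult_left_mono) simp
    also have "\<dots> \<le> ennreal d" using \<delta> b by (simp add: ennreal_mult[symmetric] ennreal_leI)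
    finally show ?thesis .
  qed
  let ?H = "\<integral>\<^sup>+x. ennreal (b x * h (ps x)) \<partial>L" and ?E = "\<integral>\<^sup>+x. ennreal (b x * exp (- ps x)) \<partial>P"
  let ?Em = "\<integral>\<^sup>+x. ennreal (b x * exp (- ps x)) * ennreal (m x) \<partial>L"
  let ?F = "\<integral>\<^sup>+x. a x * ennreal (1 - exp (- m x)) \<partial>L"
  \<comment> \<open>On \<open>N\<close> the integrand is at most \<open>B * exp (- T)\<close>; off
    \<open>N\<close> the measure \<open>P\<close> is \<open>m\<close> times \<open>L\<close>, so the
    integral can be moved to \<open>L\<close>.\<close>
  have E: "?E \<le> ?Em + ennreal d"
  proof -
    have "(\<integral>\<^sup>+x. ennreal (b x * exp (- ps x)) \<partial>P)
      \<le> (\<integral>\<^sup>+x. indicator (- N) x * ennreal (b x * exp (- ps x)) + ennreal (B * exp (- T)) \<partial>P)"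
      using b by (intro nn_integral_mono) (auto simp: ps_def indicator_def intro!: ennreal_leI mult_right_mono)
    also have "\<dots> = (\<integral>\<^sup>+x. ennreal (b x * exp (- ps x)) \<partial>density P (indicator (- N))) + ennreal (B * exp (- T)) * emeasure P UNIV"
      by (simp add: nn_integral_add nn_integral_density spP)
    also have "density P (indicator (- N)) = density L (\<lambda>x. ennreal (m x))"
    proof (rule measure_eqI)
      fix A assume "A \<in> sets (density P (indicator (- N)))"
      then have [measurable]: "A \<in> sets borel" by (simp add: P)
      have "emeasure (density P (indicator (- N))) A = emeasure P (A - N)"
        by (subst emeasure_density) (auto simp: nn_integral_indicator[symmetric] indicator_def intro!: nn_integral_cong simp del: nn_integral_indicator)
      also have "\<dots> = (\<integral>\<^sup>+x\<in>A - N. ennreal (m x) \<partial>L)" by (rule ac) auto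
      also have "\<dots> = (\<integral>\<^sup>+x\<in>A. ennreal (m x) \<partial>L)"
        using AE_not_in[OF N] by (intro nn_integral_cong_AE) (auto simp: indicator_def elim!: eventually_mono)
      also have "\<dots> = emeasure (density L (\<lambda>x. ennreal (m x))) A" by (simp add: emeasure_density)
      finally show "emeasure (density P (indicator (- N))) A = emeasure (density L (\<lambda>x. ennreal (m x))) A" .
    qed (simp add: L P)
    also have "(\<integral>\<^sup>+x. ennreal (b x * exp (- ps x)) \<partial>density L (\<lambda>x. ennreal (m x))) = (\<integral>\<^sup>+x. ennreal (b x * exp (- ps x)) * ennreal (m x) \<partial>L)"
      by (simp add: nn_integral_density mult.commute)
    also have "ennreal (B * exp (- T)) * emeasure P UNIV \<le> ennreal d"
      using T(2) b by (simp add: P.emeasure_eq_measure c_def ennreal_mult[symmetric] ennreal_leI)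
    finally show ?thesis by (simp add: add_left_mono)
  qed
  have "?H + ?Em = (\<integral>\<^sup>+x. ennreal (b x * h (ps x)) + ennreal (b x * exp (- ps x)) * ennreal (m x) \<partial>L)"
    by (simp add: nn_integral_add)
  \<comment> \<open>Constant and linear term recombine, almost everywhere, into the tangent at
    \<open>ps\<close>, which equals \<open>1 - exp (- m)\<close> up to the capped excess. Exchanging
    \<open>b\<close> for \<open>a\<close> costs only \<open>b - a\<close>, as the factor is at most
    1.\<close>
  also have "\<dots> \<le> (\<integral>\<^sup>+x. a x * ennreal (1 - exp (- m x)) + (ennreal (b x) - a x) + ennreal (B * exp (- T)) * (indicator (- N) x * ennreal (m x)) \<partial>L)"
    using AE_not_in[OF N]
  proof (intro nn_integral_mono_AE, eventually_elim)
    fix x assume x: "x \<notin> N"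
    let ?f = "1 - exp (- m x)"
    have f: "0 \<le> ?f" "?f \<le> 1" using m0[of x] by auto
    have "b x * h (ps x) + b x * exp (- ps x) * m x = b x * (h (ps x) + exp (- ps x) * m x)"
      by (simp add: algebra_simps)
    also have "\<dots> \<le> b x * (?f + exp (- T) * m x)"
      using exp_tangent_truncated[OF m0 T(1), of x] x b by (intro mult_left_mono) (auto simp: h_def ps_def)
    also have "\<dots> \<le> b x * ?f + B * exp (- T) * m x"
      using b m0[of x] by (simp add: distrib_left mult.assoc mult_right_mono)
    finally have "ennreal (b x * h (ps x)) + ennreal (b x * exp (- ps x)) * ennreal (m x) \<le> ennreal (b x * ?f) + ennreal (B * exp (- T)) * ennreal (m x)"
      using b h0 ps m0 f by (simp add: ennreal_mult[symmetric] ennreal_plus[symmetric] ennreal_leI mult.assoc del: ennreal_plus)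
    also have "ennreal (b x * ?f) \<le> a x * ennreal ?f + (ennreal (b x) - a x)"
    proof -
      have "ennreal (b x) \<le> a x + (ennreal (b x) - a x)"
        using ennreal_minus_le_iff[of "ennreal (b x)" "a x" "ennreal (b x) - a x"] by simp
      then have "ennreal (b x) * ennreal ?f \<le> (a x + (ennreal (b x) - a x)) * ennreal ?f"
        by (rule mult_right_mono) simp
      also have "\<dots> = a x * ennreal ?f + (ennreal (b x) - a x) * ennreal ?f" by (rule distrib_right)
      also have "\<dots> \<le> a x * ennreal ?f + (ennreal (b x) - a x) * 1"
        using f by (intro add_left_mono mult_left_mono) auto
      finally show ?thesis using b f by (simp add: ennreal_mult)
    qed
    finally show "ennreal (b x * h (ps x)) + ennreal (b x * exp (- ps x)) * ennreal (m x)
      \<le> a x * ennreal ?f + (ennreal (b x) - a x) + ennreal (B * exp (- T)) * (indicator (- N) x * ennreal (m x))"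
      using x by (simp add: add_right_mono)
  qed
  also have "\<dots> = (\<integral>\<^sup>+x. a x * ennreal (1 - exp (- m x)) \<partial>L) + (\<integral>\<^sup>+x. ennreal (b x) - a x \<partial>L)
     + ennreal (B * exp (- T)) * emeasure P (- N)"
    using ac[of "- N"] by (simp add: nn_integral_add nn_integral_cmult mult.commute)
  also have "\<dots> \<le> ?F + ennreal d + ennreal d"
  proof (intro add_mono order_refl ba)
    have "ennreal (B * exp (- T)) * emeasure P (- N) \<le> ennreal (B * exp (- T)) * emeasure P UNIV"
      by (intro mult_left_mono emeasure_mono) (auto simp: P)
    also have "\<dots> \<le> ennreal d"
      using T(2) b by (simp add: P.emeasure_eq_measure c_def ennreal_mult[symmetric] ennreal_leI)
    finally show "ennreal (B * exp (- T)) * emeasure P (- N) \<le> ennreal d" .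
  qed
  finally have HE: "?H + ?Em \<le> ?F + ennreal d + ennreal d" .
  \<comment> \<open>The tangent at \<open>p\<close> dominates the curve at every value, so one
    \<open>p\<close> serves all \<open>k\<close>. Replacing the density of \<open>mk k\<close> by
    the larger measure \<open>Pk k\<close> only increases the bound, since the slope is
    nonnegative.\<close>
  have "?G k \<le> ennreal d + ?Hp + ?Epk k" for k
  proof -
    have "?G k \<le> (\<integral>\<^sup>+x. (a x - ennreal (b x)) + ennreal (b x * h (p x)) + ennreal (mk k x) * ennreal (b x * exp (- p x)) \<partial>L)"
    proof (intro nn_integral_mono)
      fix x
      let ?f = "1 - exp (- mk k x)"
      have f: "0 \<le> ?f" "?f \<le> 1" using mk0 by auto
      have "a x \<le> (a x - ennreal (b x)) + ennreal (b x)"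
        using ennreal_minus_le_iff[of "a x" "ennreal (b x)" "a x - ennreal (b x)"] by (simp add: add.commute)
      then have "a x * ennreal ?f \<le> ((a x - ennreal (b x)) + ennreal (b x)) * ennreal ?f"
        by (rule mult_right_mono) simp
      also have "\<dots> = (a x - ennreal (b x)) * ennreal ?f + ennreal (b x * ?f)"
        using f b by (simp add: distrib_right ennreal_mult)
      also have "\<dots> \<le> (a x - ennreal (b x)) * 1 + ennreal (b x * h (p x) + mk k x * (b x * exp (- p x)))"
      proof (intro add_mono mult_left_mono ennreal_leI)
        have "b x * ?f \<le> b x * (h (p x) + exp (- p x) * mk k x)"
          using exp_tangent[of "mk k x" "p x"] b by (intro mult_left_mono) (auto simp: h_def)
        then show "b x * ?f \<le> b x * h (p x) + mk k x * (b x * exp (- p x))" by (simp add: algebra_simps)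
      qed (use f in auto)
      also have "\<dots> = (a x - ennreal (b x)) + ennreal (b x * h (p x)) + ennreal (mk k x) * ennreal (b x * exp (- p x))"
        using b h0 p mk0 by (simp add: ennreal_mult add.assoc)
      finally show "a x * ennreal ?f \<le> \<dots>" .
    qed
    also have "\<dots> = (\<integral>\<^sup>+x. a x - ennreal (b x) \<partial>L) + ?Hp
        + (\<integral>\<^sup>+x. ennreal (b x * exp (- p x)) \<partial>density L (\<lambda>x. ennreal (mk k x)))"
      by (simp add: nn_integral_add nn_integral_density)
    also have "(\<integral>\<^sup>+x. ennreal (b x * exp (- p x)) \<partial>density L (\<lambda>x. ennreal (mk k x))) \<le> ?Epk k"
    proof (rule nn_integral_mono_measure)
      show "sets (density L (\<lambda>x. ennreal (mk k x))) = sets (Pk k)" using L Pk by simp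
      have "emeasure (density L (\<lambda>x. ennreal (mk k x))) A \<le> emeasure (Pk k) A" if "A \<in> sets (density L (\<lambda>x. ennreal (mk k x)))" for A
      proof -
        from that have A: "A \<in> sets borel" by (simp add: L)
        show ?thesis using ack[OF A, of k] A by (subst emeasure_density) (simp_all add: L)
      qed
      then show "density L (\<lambda>x. ennreal (mk k x)) \<le> Pk k"
        by (intro le_measure[THEN iffD2] ballI) (simp_all only: L Pk sets_density)
    qed
    finally have "?G k \<le> (\<integral>\<^sup>+x. a x - ennreal (b x) \<partial>L) + ?Hp + ?Epk k"
      by (simp add: add_left_mono)
    also have "\<dots> \<le> ennreal d + ?Hp + ?Epk k"
      by (intro add_right_mono ab)
    finally show ?thesis .
  qed
  then have "limsup (\<lambda>k. ?G k) \<le> limsup (\<lambda>k. ennreal d + ?Hp + ?Epk k)"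
    by (intro Limsup_mono) auto
  also have "\<dots> = ennreal d + ?Hp + limsup (\<lambda>k. ?Epk k)"
    by (rule Limsup_const_add) simp
  also have "\<dots> \<le> ennreal d + ?Hp + ?Ep"
  proof (intro add_left_mono usc)
    show "continuous_on UNIV (\<lambda>x. b x * exp (- p x))" by (intro continuous_intros b p)
    have "\<bar>b x * exp (- p x)\<bar> \<le> B * 1" for x unfolding abs_mult
      using b p by (intro mult_mono) auto
    then show "bounded (range (\<lambda>x. b x * exp (- p x)))" by (auto simp: bounded_iff)
  qed (use b in auto)
  \<comment> \<open>Here closeness in both measures is used: the constant term is compared under
    \<open>L\<close>, the slope under \<open>P\<close>.\<close>
  also have "\<dots> \<le> ennreal d + ((\<integral>\<^sup>+x. ennreal (b x * h (ps x)) \<partial>L) + ennreal d) + ((\<integral>\<^sup>+x. ennreal (b x * exp (- ps x)) \<partial>P) + ennreal d)"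
  proof (intro add_mono order_refl)
    have "?Hp \<le> (\<integral>\<^sup>+x. ennreal (b x * h (ps x)) + ennreal B * ennreal \<bar>p x - ps x\<bar> \<partial>L)"
    proof (intro nn_integral_mono)
      fix x
      have "b x * h (p x) \<le> b x * (h (ps x) + \<bar>p x - ps x\<bar>)"
        using exp_tangent_const_lipschitz[OF p(2) ps(1)] b by (intro mult_left_mono) (auto simp: h_def)
      also have "\<dots> \<le> b x * h (ps x) + B * \<bar>p x - ps x\<bar>" using b by (simp add: distrib_left mult_right_mono)
      finally have "ennreal (b x * h (p x)) \<le> ennreal (b x * h (ps x) + B * \<bar>p x - ps x\<bar>)" by (rule ennreal_leI)
      then show "ennreal (b x * h (p x)) \<le> ennreal (b x * h (ps x)) + ennreal B * ennreal \<bar>p x - ps x\<bar>"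
        using b h0 ps by (simp add: ennreal_mult)
    qed
    also have "\<dots> = (\<integral>\<^sup>+x. ennreal (b x * h (ps x)) \<partial>L) + ennreal B * L1_dist L p ps"
      by (simp add: nn_integral_add nn_integral_cmult)
    finally show "?Hp \<le> (\<integral>\<^sup>+x. ennreal (b x * h (ps x)) \<partial>L) + ennreal d"
      using add_left_mono[OF Bd[OF pL]] by (rule order_trans)
    have "?Ep \<le> (\<integral>\<^sup>+x. ennreal (b x * exp (- ps x)) + ennreal B * ennreal \<bar>p x - ps x\<bar> \<partial>P)"
    proof (intro nn_integral_mono)
      fix x
      have "b x * exp (- p x) \<le> b x * (exp (- ps x) + \<bar>p x - ps x\<bar>)"
        using exp_neg_lipschitz[OF p(2)] b by (intro mult_left_mono) auto
      also have "\<dots> \<le> b x * exp (- ps x) + B * \<bar>p x - ps x\<bar>" using b by (simp add: distrib_left mult_right_mono)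
      finally have "ennreal (b x * exp (- p x)) \<le> ennreal (b x * exp (- ps x) + B * \<bar>p x - ps x\<bar>)" by (rule ennreal_leI)
      then show "ennreal (b x * exp (- p x)) \<le> ennreal (b x * exp (- ps x)) + ennreal B * ennreal \<bar>p x - ps x\<bar>"
        using b by (simp add: ennreal_mult)
    qed
    also have "\<dots> = (\<integral>\<^sup>+x. ennreal (b x * exp (- ps x)) \<partial>P) + ennreal B * L1_dist P p ps"
      by (simp add: nn_integral_add nn_integral_cmult)
    finally show "?Ep \<le> (\<integral>\<^sup>+x. ennreal (b x * exp (- ps x)) \<partial>P) + ennreal d"
      using add_left_mono[OF Bd[OF pP]] by (rule order_trans)
  qed
  also have "\<dots> \<le> ennreal d + (?H + ennreal d) + ((?Em + ennreal d) + ennreal d)"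
    by (intro add_left_mono add_right_mono E)
  also have "\<dots> = (?H + ?Em) + ennreal (4 * d)"
    using d by (simp add: ac_simps ennreal_plus[symmetric] del: ennreal_plus)
  also have "\<dots> \<le> (?F + ennreal d + ennreal d) + ennreal (4 * d)" by (rule add_right_mono[OF HE])
  also have "\<dots> = ?F + ennreal e"
    using d by (simp add: add.assoc ennreal_plus[symmetric] d_def del: ennreal_plus)
  finally show "limsup (\<lambda>k. ?G k) \<le> ?F + ennreal e" .
qed

section \<open>Regular conditional distributions\<close>

text \<open>A distribution function prescribed on the rationals need not be right continuous; taking
  the infimum over strictly larger rationals repairs this. The third claim recovers the repaired
  value as a limit of prescribed ones, so that integral identities known at rationals carry over to
  every real \<open>t\<close>.\<close>

lemma real_distribution_of_rat_cdf:
  fixes f :: "rat \<Rightarrow> real"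
  assumes mono: "\<And>q r. q \<le> r \<Longrightarrow> f q \<le> f r" and bd: "\<And>q. 0 \<le> f q" "\<And>q. f q \<le> 1"
    and top: "\<And>e. 0 < e \<Longrightarrow> \<exists>q. 1 - e < f q" and bot: "\<And>e. 0 < e \<Longrightarrow> \<exists>q. f q < e"
  defines "H \<equiv> \<lambda>t. INF q\<in>{q. t < of_rat q}. f q"
  shows "real_distribution (interval_measure H)"
    and "measure (interval_measure H) {..t} = H t"
    and "\<And>q. (\<And>n. t < of_rat (q n)) \<Longrightarrow> (\<lambda>n. of_rat (q n)) \<longlonglongrightarrow> t \<Longrightarrow> (\<lambda>n. f (q n)) \<longlonglongrightarrow> H t"
proof -
  have ne: "{q. t < of_rat q} \<noteq> {}" for t :: real
    using of_rat_dense[of t "t + 1"] by auto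
  have bb: "bdd_below (f ` {q. t < of_rat q})" for t :: real
    by (rule bdd_belowI2[of _ 0]) (rule bd)
  have Hle: "H t \<le> f q" if "t < of_rat q" for t q
    unfolding H_def using that by (intro cINF_lower bb) simp
  have leH: "c \<le> H t" if "\<And>q. t < of_rat q \<Longrightarrow> c \<le> f q" for t c
    unfolding H_def using that by (intro cINF_greatest ne) simp
  have Happ: "\<exists>q. t < of_rat q \<and> f q < H t + e" if "0 < e" for t e
  proof (rule ccontr)
    assume "\<not> ?thesis"
    then have le: "t < of_rat q \<Longrightarrow> H t + e \<le> f q" for q by (force simp: not_less)
    have "H t + e \<le> H t" by (rule leH) (rule le)
    then show False using that by simp
  qed
  have Hmono: "H s \<le> H t" if "s \<le> t" for s t
    using that by (intro leH Hle) simp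
  have H0: "0 \<le> H t" for t by (rule leH) (rule bd)
  have H1: "H t \<le> 1" for t
  proof -
    obtain q where "t < of_rat q" using ne[of t] by blast
    then show ?thesis using order_trans[OF Hle bd(2)] by blast
  qed
  have rc: "continuous (at_right a) H" for a
  proof (subst continuous_at_right_real_increasing, erule Hmono, intro allI impI)
    fix e :: real assume "0 < e"
    from Happ[OF this, of a] obtain q where q: "a < of_rat q" "f q < H a + e" by blast
    have "H (a + (of_rat q - a) / 2) \<le> f q" using q by (intro Hle) (simp add: field_simps)
    then show "\<exists>d>0. H (a + d) - H a < e" using q by (intro exI[of _ "(of_rat q - a) / 2"]) auto
  qed
  have lbot: "(H \<longlongrightarrow> 0) at_bot"
  proof (rule tendstoI)
    fix e :: real assume "0 < e"
    from bot[OF this] obtain q where q: "f q < e" by blast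
    show "\<forall>\<^sub>F t in at_bot. dist (H t) 0 < e"
      using eventually_gt_at_bot[of "of_rat q"]
    proof eventually_elim
      case (elim t)
      then show ?case using Hle[OF elim] H0[of t] q by (simp add: dist_real_def)
    qed
  qed
  have ltop: "(H \<longlongrightarrow> 1) at_top"
  proof (rule tendstoI)
    fix e :: real assume "0 < e"
    from top[OF this] obtain q where q: "1 - e < f q" by blast
    show "\<forall>\<^sub>F t in at_top. dist (H t) 1 < e"
      using eventually_ge_at_top[of "of_rat q"]
    proof eventually_elim
      case (elim t)
      have "f q \<le> H t"
      proof (rule leH)
        fix r assume "t < of_rat r"
        with elim have "(of_rat q :: real) \<le> of_rat r" by linarith
        then show "f q \<le> f r" by (intro mono) (simp add: of_rat_less_eq)
      qed
      then show ?case using q H1[of t] by (simp add: dist_real_def)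
    qed
  qed
  show "real_distribution (interval_measure H)"
    by (rule real_distribution_interval_measure[OF Hmono rc lbot ltop])
  show "measure (interval_measure H) {..t} = H t"
    using cdf_interval_measure[OF Hmono rc lbot] by (simp add: cdf_def fun_eq_iff)
  show "(\<lambda>n. f (q n)) \<longlonglongrightarrow> H t" if q: "\<And>n. t < of_rat (q n)" "(\<lambda>n. of_rat (q n)) \<longlonglongrightarrow> t" for q
  proof (rule tendstoI)
    fix e :: real assume "0 < e"
    from Happ[OF this, of t] obtain r where r: "t < of_rat r" "f r < H t + e" by blast
    from order_tendstoD(2)[OF q(2) r(1)] show "\<forall>\<^sub>F n in sequentially. dist (f (q n)) (H t) < e"
    proof eventually_elim
      case (elim n)
      then have "f (q n) \<le> f r" by (intro mono) (simp add: of_rat_less)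
      then show ?case using Hle[OF q(1), of n] r(2) by (simp add: dist_real_def)
    qed
  qed
qed

lemma measurable_prob_algebra_cdf:
  fixes K :: "'a \<Rightarrow> real measure"
  assumes prob: "\<And>y. prob_space (K y)" and setsK: "\<And>y. sets (K y) = sets borel"
    and cdf: "\<And>t. (\<lambda>y. emeasure (K y) {..t}) \<in> borel_measurable N"
  shows "K \<in> N \<rightarrow>\<^sub>M prob_algebra borel"
proof (rule measurable_prob_algebra_generated[where G = "range (\<lambda>a::real. {..a})" and \<Omega> = UNIV])
  show "sets borel = sigma_sets UNIV (range (\<lambda>a::real. {..a}))"
    by (subst borel_eq_atMost) simp
  show "Int_stable (range (\<lambda>a::real. {..a}))"
  proof (rule Int_stableI)
    fix A B :: "real set" assume "A \<in> range (\<lambda>a. {..a})" "B \<in> range (\<lambda>a. {..a})"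
    then obtain a b where "A = {..a}" "B = {..b}" by blast
    then have "A \<inter> B = {..min a b}" by auto
    then show "A \<inter> B \<in> range (\<lambda>a. {..a})" by blast
  qed
  fix A assume "A \<in> range (\<lambda>a::real. {..a})"
  then obtain t where "A = {..t}" by blast
  then show "(\<lambda>y. emeasure (K y) A) \<in> borel_measurable N" using cdf by simp
qed (simp_all add: prob setsK)

text \<open>The set where \<open>g < f\<close> is itself a test set. Finiteness of the integral of
  \<open>f\<close> permits subtraction there, and a nonnegative function with integral 0 vanishes
  almost everywhere.\<close>

lemma AE_le_if_set_integral_le:
  assumes [measurable]: "f \<in> borel_measurable M" "g \<in> borel_measurable M"
    and fin: "(\<integral>\<^sup>+x. f x \<partial>M) < \<infinity>"
    and le: "\<And>A. A \<in> sets M \<Longrightarrow> (\<integral>\<^sup>+x\<in>A. f x \<partial>M) \<le> (\<integral>\<^sup>+x\<in>A. g x \<partial>M)"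
  shows "AE x in M. f x \<le> g x"
proof -
  define A where "A = {x\<in>space M. g x < f x}"
  have [measurable]: "A \<in> sets M" unfolding A_def by measurable
  have ffin: "(\<integral>\<^sup>+x\<in>A. f x \<partial>M) < \<infinity>"
    by (rule le_less_trans[OF _ fin]) (intro nn_integral_mono, simp add: indicator_def)
  have gle: "(\<integral>\<^sup>+x\<in>A. g x \<partial>M) \<le> (\<integral>\<^sup>+x\<in>A. f x \<partial>M)"
    by (intro nn_integral_mono) (auto simp: A_def indicator_def)
  have "(\<integral>\<^sup>+x. f x * indicator A x - g x * indicator A x \<partial>M) = (\<integral>\<^sup>+x\<in>A. f x \<partial>M) - (\<integral>\<^sup>+x\<in>A. g x \<partial>M)"
    using le_less_trans[OF gle ffin] by (intro nn_integral_diff) (auto simp: A_def indicator_def)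
  also have "\<dots> = 0" using le[of A] ffin by (simp add: diff_eq_0_iff_ennreal)
  finally have "AE x in M. f x * indicator A x - g x * indicator A x = 0"
    by (subst (asm) nn_integral_0_iff_AE) auto
  moreover have "AE x in M. f x \<noteq> \<infinity>" using fin by (intro nn_integral_noteq_infinite) auto
  ultimately show ?thesis using AE_space
  proof eventually_elim
    case (elim x)
    show ?case
    proof (rule ccontr)
      assume "\<not> f x \<le> g x"
      with elim show False by (auto simp: A_def not_le diff_eq_0_iff_ennreal)
    qed
  qed
qed

text \<open>For each rational \<open>q\<close> the conditional probability of
  \<open>T x \<le> q\<close> given \<open>X\<close> is a Radon-Nikodym derivative. Countably many
  almost sure conditions make these derivatives a distribution function, which defines
  \<open>K\<close>. The integral formula then spreads from half-lines to rectangles, and from there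
  to all product-measurable functions.\<close>

lemma exists_regular_conditional_distribution:
  assumes M: "finite_measure M" and X[measurable]: "X \<in> M \<rightarrow>\<^sub>M N" and T[measurable]: "T \<in> borel_measurable M"
  shows "\<exists>K\<in>N \<rightarrow>\<^sub>M prob_algebra (borel :: real measure). \<forall>f\<in>borel_measurable (N \<Otimes>\<^sub>M borel).
     (\<integral>\<^sup>+x. f (X x, T x) \<partial>M) = (\<integral>\<^sup>+y. (\<integral>\<^sup>+t. f (y, t) \<partial>K y) \<partial>distr M N X)"
\<comment> \<open>The joint law below is formed with \<open>bind\<close>, whose rules require a
  nonempty space; the empty case is trivial.\<close>
proof (cases "space N = {}")
  case True
  then have "space M = {}" using measurable_space[OF X] by blast
  then have "(\<integral>\<^sup>+x. f (X x, T x) \<partial>M) = (\<integral>\<^sup>+y. (\<integral>\<^sup>+t. f (y, t) \<partial>return borel 0) \<partial>distr M N X)" for f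
    using True by (simp add: nn_integral_empty)
  moreover have "(\<lambda>_. return borel 0) \<in> N \<rightarrow>\<^sub>M prob_algebra (borel :: real measure)"
    by (intro measurable_const) (simp add: space_prob_algebra prob_space_return)
  ultimately show ?thesis by (intro bexI[of _ "\<lambda>_. return borel 0"]) auto
next
  case False
  interpret M: finite_measure M by fact
  define P where "P = distr M N X"
  interpret P: finite_measure P unfolding P_def by (rule M.finite_measure_distr) fact
  have setsP[measurable_cong]: "sets P = sets N" by (simp add: P_def)
  have spP: "space P = space N" by (simp add: P_def)
  define S where "S A t = {x\<in>space M. X x \<in> A \<and> T x \<le> t}" for A t
  have [measurable]: "S A t \<in> sets M" if [measurable]: "A \<in> sets N" for A t unfolding S_def by measurable
  \<comment> \<open>The derivative is at most 1 only almost everywhere. Clamping with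
    \<open>min 1\<close> makes \<open>F\<close> bounded everywhere, which is needed for infima over
    rationals to behave at every point.\<close>
  define F where "F q y = enn2real (min 1 (RN_deriv P (distr (density M (indicator {x\<in>space M. T x \<le> of_rat q})) N X) y))" for q y
  have [measurable]: "F q \<in> borel_measurable N" for q
    unfolding F_def using borel_measurable_RN_deriv[of P] by (simp cong: measurable_cong_sets add: setsP)
  have F01: "0 \<le> F q y" "F q y \<le> 1" for q y
    unfolding F_def by (auto intro!: enn2real_leI)
  have intF: "(\<integral>\<^sup>+y\<in>A. ennreal (F q y) \<partial>P) = emeasure M (S A (of_rat q))" if A[measurable]: "A \<in> sets N" for A q
  proof -
    let ?N = "distr (density M (indicator {x\<in>space M. T x \<le> of_rat q})) N X"
    have N: "emeasure ?N A = emeasure M (S A (of_rat q))" if [measurable]: "A \<in> sets N" for A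
    proof -
      have "emeasure ?N A = (\<integral>\<^sup>+x. indicator {x\<in>space M. T x \<le> of_rat q} x * indicator (X -` A \<inter> space M) x \<partial>M)"
        by (subst emeasure_distr) (auto simp: emeasure_density)
      also have "\<dots> = (\<integral>\<^sup>+x. indicator (S A (of_rat q)) x \<partial>M)"
        by (intro nn_integral_cong) (auto simp: S_def indicator_def)
      finally show ?thesis by simp
    qed
    have NP: "emeasure ?N A \<le> emeasure P A" if [measurable]: "A \<in> sets N" for A
      unfolding N[OF that] P_def by (subst emeasure_distr) (auto simp: S_def intro!: emeasure_mono)
    have "absolutely_continuous P ?N"
      unfolding absolutely_continuous_def
    proof
      fix A assume "A \<in> null_sets P"
      then have "A \<in> sets N" "emeasure P A = 0" using setsP by auto
      then show "A \<in> null_sets ?N" using NP[of A] by auto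
    qed
    then have dens: "density P (RN_deriv P ?N) = ?N"
      by (intro P.density_RN_deriv) (simp_all add: P_def)
    have RN[measurable]: "RN_deriv P ?N \<in> borel_measurable P" by simp
    have "AE y in P. RN_deriv P ?N y \<le> 1"
    proof (rule AE_le_if_set_integral_le)
      fix A assume A: "A \<in> sets P"
      have "(\<integral>\<^sup>+y\<in>A. RN_deriv P ?N y \<partial>P) = emeasure ?N A"
        using A by (subst (2) dens[symmetric]) (simp add: emeasure_density)
      then show "(\<integral>\<^sup>+y\<in>A. RN_deriv P ?N y \<partial>P) \<le> (\<integral>\<^sup>+y\<in>A. 1 \<partial>P)"
        using NP[of A] A by (simp add: P_def)
    next
      have "(\<integral>\<^sup>+y. RN_deriv P ?N y \<partial>P) = emeasure ?N (space P)"
        by (subst (2) dens[symmetric]) (simp add: emeasure_density cong: nn_integral_cong)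
      also have "\<dots> \<le> emeasure P (space P)" using NP[of "space N"] by (simp add: spP)
      also have "\<dots> < \<infinity>" by (simp add: P.emeasure_eq_measure)
      finally show "(\<integral>\<^sup>+y. RN_deriv P ?N y \<partial>P) < \<infinity>" .
    qed simp_all
    then have "(\<integral>\<^sup>+y\<in>A. ennreal (F q y) \<partial>P) = (\<integral>\<^sup>+y\<in>A. RN_deriv P ?N y \<partial>P)"
      unfolding F_def by (intro nn_integral_cong_AE) (auto elim!: eventually_mono simp: min_absorb2 ennreal_enn2real_if top_unique)
    also have "\<dots> = emeasure ?N A"
      by (subst (2) dens[symmetric]) (simp add: emeasure_density)
    finally show ?thesis using N by simp
  qed
  have Ffin: "(\<integral>\<^sup>+y. ennreal (F q y) \<partial>P) < \<infinity>" for q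
  proof -
    have "(\<integral>\<^sup>+y. ennreal (F q y) \<partial>P) = (\<integral>\<^sup>+y\<in>space N. ennreal (F q y) \<partial>P)"
      by (intro nn_integral_cong) (simp add: spP)
    also have "\<dots> < \<infinity>" by (subst intF) (simp_all add: M.emeasure_eq_measure)
    finally show ?thesis .
  qed
  have "AE y in P. ennreal (F q y) \<le> ennreal (F r y)" if "q \<le> r" for q r
  proof (rule AE_le_if_set_integral_le)
    fix A assume "A \<in> sets P"
    then have "A \<in> sets N" by (simp add: P_def)
    then show "(\<integral>\<^sup>+y\<in>A. ennreal (F q y) \<partial>P) \<le> (\<integral>\<^sup>+y\<in>A. ennreal (F r y) \<partial>P)"
      using that by (simp add: intF) (auto simp: S_def of_rat_less_eq intro!: emeasure_mono elim: order_trans)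
  qed (use Ffin in auto)
  then have mono: "AE y in P. \<forall>q r. q \<le> r \<longrightarrow> F q y \<le> F r y"
    using F01 by (simp add: AE_all_countable)
  have "AE y in P. 1 \<le> (SUP n::nat. ennreal (F (of_nat n) y))"
  proof (rule AE_le_if_set_integral_le)
    fix A assume "A \<in> sets P"
    then have A[measurable]: "A \<in> sets N" by (simp add: P_def)
    have "(\<integral>\<^sup>+y\<in>A. 1 \<partial>P) = emeasure M (X -` A \<inter> space M)" by (simp add: P_def emeasure_distr)
    also have "X -` A \<inter> space M = (\<Union>n. S A (real n))"
      unfolding S_def using real_arch_simple by auto
    also have "emeasure M (\<Union>n. S A (real n)) = (SUP n. emeasure M (S A (real n)))"
      by (intro SUP_emeasure_incseq[symmetric]) (auto simp: incseq_def S_def)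
    also have "\<dots> = (SUP n. (\<integral>\<^sup>+y\<in>A. ennreal (F (of_nat n) y) \<partial>P))" by (simp add: intF)
    also have "\<dots> \<le> (\<integral>\<^sup>+y\<in>A. (SUP n. ennreal (F (of_nat n) y)) \<partial>P)"
      by (intro SUP_least nn_integral_mono mult_right_mono SUP_upper) auto
    finally show "(\<integral>\<^sup>+y\<in>A. 1 \<partial>P) \<le> (\<integral>\<^sup>+y\<in>A. (SUP n. ennreal (F (of_nat n) y)) \<partial>P)" .
  qed (simp_all add: P.emeasure_eq_measure)
  then have top: "AE y in P. \<forall>e>0. \<exists>q. 1 - e < F q y"
  proof eventually_elim
    case (elim y)
    show ?case
    proof (intro allI impI)
      fix e :: real assume "0 < e"
      then have "ennreal (1 - e) < 1" by (simp add: ennreal_less_one_iff)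
      with elim have "ennreal (1 - e) < (SUP n::nat. ennreal (F (of_nat n) y))" by (rule less_le_trans[rotated])
      then obtain n :: nat where "ennreal (1 - e) < ennreal (F (of_nat n) y)" by (auto simp: less_SUP_iff)
      then have "1 - e < F (of_nat n) y" by (metis F01(1) ennreal_less_iff ennreal_leI not_le)
      then show "\<exists>q. 1 - e < F q y" ..
    qed
  qed
  have "(\<integral>\<^sup>+y. (INF n::nat. ennreal (F (- of_nat n) y)) \<partial>P) \<le> (INF n. emeasure M (S (space N) (- real n)))"
  proof (rule INF_greatest)
    fix n
    have "(\<integral>\<^sup>+y. (INF n::nat. ennreal (F (- of_nat n) y)) \<partial>P) \<le> (\<integral>\<^sup>+y\<in>space N. ennreal (F (- of_nat n) y) \<partial>P)"
      by (intro nn_integral_mono) (auto simp: spP intro: INF_lower)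
    also have "\<dots> = emeasure M (S (space N) (- real n))" by (subst intF) (simp_all add: of_rat_minus)
    finally show "(\<integral>\<^sup>+y. (INF n::nat. ennreal (F (- of_nat n) y)) \<partial>P) \<le> emeasure M (S (space N) (- real n))" .
  qed
  also have "(INF n. emeasure M (S (space N) (- real n))) = emeasure M (\<Inter>n. S (space N) (- real n))"
    by (intro INF_emeasure_decseq) (auto simp: decseq_def S_def M.emeasure_eq_measure)
  also have "(\<Inter>n. S (space N) (- real n)) = {}"
  proof -
    have "\<exists>n. \<not> T x \<le> - real n" for x
    proof -
      obtain n where "- T x < real n" using reals_Archimedean2 by blast
      then have "\<not> T x \<le> - real n" by linarith
      then show ?thesis ..
    qed
    then show ?thesis by (auto simp: S_def)
  qed
  finally have "AE y in P. (INF n::nat. ennreal (F (- of_nat n) y)) = 0"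
    by (subst nn_integral_0_iff_AE[symmetric]) auto
  then have bot: "AE y in P. \<forall>e>0. \<exists>q. F q y < e"
  proof eventually_elim
    case (elim y)
    show ?case
    proof (intro allI impI)
      fix e :: real assume e: "0 < e"
      then have "(INF n::nat. ennreal (F (- of_nat n) y)) < ennreal e" using elim by simp
      then obtain n :: nat where "ennreal (F (- of_nat n) y) < ennreal e" by (auto simp: INF_less_iff)
      then have "F (- of_nat n) y < e" using F01 e by (simp add: ennreal_less_iff)
      then show "\<exists>q. F q y < e" ..
    qed
  qed
  \<comment> \<open>The limits at both ends are expressed with \<open>1 / Suc m\<close> instead of
    arbitrary positive reals, so that \<open>G\<close> is a countable combination of measurable
    sets.\<close>
  define G where "G = {y\<in>space N. (\<forall>q r. q \<le> r \<longrightarrow> F q y \<le> F r y) \<and> (\<forall>m::nat. \<exists>q. 1 - 1 / Suc m < F q y) \<and> (\<forall>m::nat. \<exists>q. F q y < 1 / Suc m)}"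
  have [measurable]: "G \<in> sets N" unfolding G_def by measurable
  have AEG: "AE y in P. y \<in> G"
    using mono top bot AE_space by eventually_elim (auto simp: G_def spP)
  have Gtop: "\<exists>q. 1 - e < F q y" and Gbot: "\<exists>q. F q y < e" if "y \<in> G" "0 < e" for y e
  proof -
    from reals_Archimedean[OF that(2)] obtain m where m: "1 / Suc m < e" by (auto simp: inverse_eq_divide)
    with that(1) obtain q r where "1 - 1 / Suc m < F q y" "F r y < 1 / Suc m" unfolding G_def by blast
    with m show "\<exists>q. 1 - e < F q y" "\<exists>q. F q y < e" by (meson diff_left_mono less_imp_le order.strict_trans le_less_trans)+
  qed
  define H where "H y t = (INF q\<in>{q. t < of_rat q}. F q y)" for y and t :: real
  have Hm[measurable]: "(\<lambda>y. H y t) \<in> borel_measurable N" for t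
    unfolding H_def using F01 by (intro borel_measurable_cINF) (auto intro!: bdd_belowI2[of _ 0])
  \<comment> \<open>Outside \<open>G\<close>, a null set for the law of \<open>X\<close>, any fixed
    probability serves; a point mass keeps \<open>K y\<close> a probability for every
    \<open>y\<close>.\<close>
  define K where "K y = (if y \<in> G then interval_measure (H y) else return borel 0)" for y
  have KG: "real_distribution (K y)" "measure (K y) {..t} = H y t"
    "\<And>q. (\<And>n. t < of_rat (q n)) \<Longrightarrow> (\<lambda>n. of_rat (q n)) \<longlonglongrightarrow> t \<Longrightarrow> (\<lambda>n. F (q n) y) \<longlonglongrightarrow> H y t" if "y \<in> G" for y t
  proof -
    have m: "q \<le> r \<Longrightarrow> F q y \<le> F r y" for q r using that by (simp add: G_def)
    have Hy: "(\<lambda>t. INF q\<in>{q. t < of_rat q}. F q y) = H y" by (simp add: H_def fun_eq_iff)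
    note * = real_distribution_of_rat_cdf[of "\<lambda>q. F q y", OF m F01 Gtop[OF that] Gbot[OF that], unfolded Hy]
    have Ky: "K y = interval_measure (H y)" using that by (simp add: K_def)
    show "real_distribution (K y)" unfolding Ky by (rule *(1)) assumption+
    show "measure (K y) {..t} = H y t" unfolding Ky H_def[of y t] by (rule *(2)) assumption+
    show "(\<lambda>n. F (q n) y) \<longlonglongrightarrow> H y t" if "\<And>n. t < of_rat (q n)" "(\<lambda>n. of_rat (q n)) \<longlonglongrightarrow> t" for q
      unfolding H_def by (rule *(3)) (assumption | rule that)+
  qed
  have prob: "prob_space (K y)" and setsK: "sets (K y) = sets borel" for y
  proof -
    have "prob_space (K y) \<and> sets (K y) = sets borel"
    proof (cases "y \<in> G")
      case True
      interpret real_distribution "K y" by (rule KG(1)[OF True])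
      show ?thesis using prob_space_axioms events_eq_borel by simp
    qed (simp add: K_def prob_space_return)
    then show "prob_space (K y)" "sets (K y) = sets borel" by auto
  qed
  have KH: "emeasure (K y) {..t} = ennreal (H y t)" if "y \<in> G" for y t
    using KG(2)[OF that, of t] finite_measure.emeasure_eq_measure[OF prob_space.finite_measure[OF prob[of y]], of "{..t}"] by simp
  have Keq: "emeasure (K y) {..t} = (if y \<in> G then ennreal (H y t) else indicator {..t} 0)" for y t
    using KH[of y t] by (simp add: K_def[of y])
  have K[measurable]: "K \<in> N \<rightarrow>\<^sub>M prob_algebra borel"
  proof (rule measurable_prob_algebra_cdf[OF prob setsK])
    show "(\<lambda>y. emeasure (K y) {..t}) \<in> borel_measurable N" for t
      unfolding Keq by measurable
  qed
  have cdf: "(\<integral>\<^sup>+y\<in>A. emeasure (K y) {..t} \<partial>P) = emeasure M (S A t)" if A[measurable]: "A \<in> sets N" for A t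
  proof -
    \<comment> \<open>Rationals strictly above \<open>t\<close> that converge to \<open>t\<close>:
      the identity at each of them passes to the limit by dominated convergence on both
      sides.\<close>
    have "\<exists>q. t < of_rat q \<and> of_rat q < t + 1 / Suc n" for n by (rule of_rat_dense) simp
    then obtain q where q: "\<And>n. t < of_rat (q n)" "\<And>n. of_rat (q n) < t + 1 / Suc n" by metis
    have qlim: "(\<lambda>n. of_rat (q n)) \<longlonglongrightarrow> t"
    proof (rule tendsto_sandwich[OF _ _ tendsto_const])
      show "(\<lambda>n. t + 1 / Suc n) \<longlonglongrightarrow> t"
        using tendsto_add[OF tendsto_const LIMSEQ_inverse_real_of_nat, of t] by (simp add: inverse_eq_divide)
    qed (rule always_eventually, rule allI, rule less_imp_le, rule q)+
    have "(\<lambda>n. (\<integral>\<^sup>+y\<in>A. ennreal (F (q n) y) \<partial>P)) \<longlonglongrightarrow> (\<integral>\<^sup>+y\<in>A. emeasure (K y) {..t} \<partial>P)"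
    proof (rule nn_integral_dominated_convergence[where w = "\<lambda>_. 1"])
      show "AE y in P. (\<lambda>n. ennreal (F (q n) y) * indicator A y) \<longlonglongrightarrow> emeasure (K y) {..t} * indicator A y"
        using AEG
      proof eventually_elim
        case (elim y)
        show ?case using KG(3)[OF elim q(1) qlim] by (simp add: KH[OF elim] indicator_def)
      qed
      show "AE y in P. ennreal (F (q j) y) * indicator A y \<le> 1" for j
        using F01 by (intro AE_I2) (simp add: indicator_def)
      have "(\<lambda>y. emeasure (K y) {..t}) \<in> borel_measurable N"
        using measurable_emeasure_kernel[OF measurable_prob_algebraD[OF K]] by simp
      then show "(\<lambda>y. emeasure (K y) {..t} * indicator A y) \<in> borel_measurable P" by simp
    qed (simp_all add: P.emeasure_eq_measure)
    moreover have "(\<lambda>n. (\<integral>\<^sup>+x. indicator (S A (of_rat (q n))) x \<partial>M)) \<longlonglongrightarrow> (\<integral>\<^sup>+x. indicator (S A t) x \<partial>M)"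
    proof (rule nn_integral_dominated_convergence[where w = "\<lambda>_. 1"])
      show "AE x in M. (\<lambda>n. indicator (S A (of_rat (q n))) x) \<longlonglongrightarrow> (indicator (S A t) x :: ennreal)"
      proof (intro AE_I2 tendsto_eventually)
        fix x
        show "\<forall>\<^sub>F n in sequentially. indicator (S A (of_rat (q n))) x = (indicator (S A t) x :: ennreal)"
        proof (cases "T x \<le> t")
          case True
          then have "T x \<le> of_rat (q n)" for n using q(1)[of n] by linarith
          with True show ?thesis by (simp add: S_def indicator_def)
        next
          case False
          then have "\<forall>\<^sub>F n in sequentially. of_rat (q n) < T x" using order_tendstoD(2)[OF qlim] by simp
          then show ?thesis
            by (rule eventually_mono) (use False in \<open>simp add: S_def indicator_def\<close>)
        qed
      qed
    qed (auto simp: M.emeasure_eq_measure indicator_def)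
    ultimately show ?thesis
      by (simp add: intF) (rule LIMSEQ_unique)
  qed
  note Ksub = measurable_prob_algebraD[OF K]
  \<comment> \<open>\<open>R\<close> is the joint law generated by the law of \<open>X\<close> and
    the kernel. The lemma amounts to its being the law of the pair \<open>(X, T)\<close>.\<close>
  define R where "R = P \<bind> (\<lambda>y. distr (K y) (N \<Otimes>\<^sub>M borel) (Pair y))"
  have kap[measurable]: "(\<lambda>y. distr (K y) (N \<Otimes>\<^sub>M borel) (Pair y)) \<in> P \<rightarrow>\<^sub>M subprob_algebra (N \<Otimes>\<^sub>M borel)"
    using measurable_distr2[of Pair N borel "N \<Otimes>\<^sub>M borel" K] Ksub by (simp add: P_def)
  have setsR: "sets R = sets (N \<Otimes>\<^sub>M borel)"
    unfolding R_def using False by (intro sets_bind[where N = "N \<Otimes>\<^sub>M borel"]) (auto simp: spP)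
  have rect: "emeasure R (A \<times> B) = (\<integral>\<^sup>+y\<in>A. emeasure (K y) B \<partial>P)" if [measurable]: "A \<in> sets N" "B \<in> sets borel" for A and B :: "real set"
  proof -
    have "emeasure R (A \<times> B) = (\<integral>\<^sup>+y. emeasure (distr (K y) (N \<Otimes>\<^sub>M borel) (Pair y)) (A \<times> B) \<partial>P)"
      unfolding R_def using False by (intro emeasure_bind[OF _ kap]) (auto simp: spP)
    also have "\<dots> = (\<integral>\<^sup>+y\<in>A. emeasure (K y) B \<partial>P)"
    proof (intro nn_integral_cong)
      fix y assume y: "y \<in> space P"
      have [measurable_cong]: "sets (K y) = sets borel" by (rule setsK)
      have "Pair y \<in> K y \<rightarrow>\<^sub>M N \<Otimes>\<^sub>M borel" using y spP by simp
      then show "emeasure (distr (K y) (N \<Otimes>\<^sub>M borel) (Pair y)) (A \<times> B) = emeasure (K y) B * indicator A y"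
        using sets_eq_imp_space_eq[OF setsK[of y]] by (subst emeasure_distr) (auto simp: indicator_def vimage_def)
    qed
    finally show ?thesis .
  qed
  \<comment> \<open>For fixed \<open>A\<close> both sides are finite measures in \<open>B\<close>.
    They agree on rays \<open>{t<..}\<close>, the complements of the half-lines in
    \<open>cdf\<close>, and hence on all Borel sets.\<close>
  have eqB: "(\<integral>\<^sup>+y\<in>A. emeasure (K y) B \<partial>P) = emeasure M {x\<in>space M. X x \<in> A \<and> T x \<in> B}"
    if A[measurable]: "A \<in> sets N" and B[measurable]: "B \<in> sets borel" for A B
  proof -
    let ?M1 = "distr (density M (indicator {x\<in>space M. X x \<in> A})) borel T"
    let ?M2 = "distr (density R (indicator (A \<times> UNIV))) borel snd"
    note [measurable_cong] = setsR
    have spR: "space R = space N \<times> UNIV" using sets_eq_imp_space_eq[OF setsR] by (simp add: space_pair_measure)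
    have 1: "emeasure ?M1 B = emeasure M {x\<in>space M. X x \<in> A \<and> T x \<in> B}" if [measurable]: "B \<in> sets borel" for B
    proof -
      have "emeasure ?M1 B = (\<integral>\<^sup>+x. indicator {x\<in>space M. X x \<in> A} x * indicator (T -` B \<inter> space M) x \<partial>M)"
        by (subst emeasure_distr) (auto simp: emeasure_density)
      also have "\<dots> = (\<integral>\<^sup>+x. indicator {x\<in>space M. X x \<in> A \<and> T x \<in> B} x \<partial>M)"
        by (intro nn_integral_cong) (auto simp: indicator_def)
      finally show ?thesis by simp
    qed
    have 2: "emeasure ?M2 B = (\<integral>\<^sup>+y\<in>A. emeasure (K y) B \<partial>P)" if [measurable]: "B \<in> sets borel" for B
    proof -
      have "emeasure ?M2 B = (\<integral>\<^sup>+x. indicator (A \<times> UNIV) x * indicator (snd -` B \<inter> space R) x \<partial>R)"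
        by (subst emeasure_distr) (auto simp: emeasure_density)
      also have "\<dots> = (\<integral>\<^sup>+x. indicator (A \<times> B) x \<partial>R)"
        by (intro nn_integral_cong) (auto simp: indicator_def spR)
      also have "\<dots> = emeasure R (A \<times> B)" by (simp add: setsR)
      finally show ?thesis using rect by simp
    qed
    have "?M1 = ?M2"
    proof (rule measure_eqI_lessThan)
      fix t :: real
      show "emeasure ?M1 {t<..} < \<infinity>" by (subst 1) (auto simp: M.emeasure_eq_measure)
      have "emeasure (K y) {t<..} = 1 - emeasure (K y) {..t}" for y
      proof -
        interpret K: prob_space "K y" by (rule prob)
        have "space (K y) - {..t} = {t<..}" using sets_eq_imp_space_eq[OF setsK[of y]] by auto
        then show ?thesis using K.emeasure_space_1 emeasure_compl[of "{..t}" "K y"] setsK[of y] by (simp add: K.emeasure_eq_measure)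
      qed
      then have "emeasure ?M2 {t<..} = (\<integral>\<^sup>+y. indicator A y - emeasure (K y) {..t} * indicator A y \<partial>P)"
        by (subst 2) (auto intro!: nn_integral_cong simp: indicator_def)
      also have "\<dots> = (\<integral>\<^sup>+y. indicator A y \<partial>P) - (\<integral>\<^sup>+y\<in>A. emeasure (K y) {..t} \<partial>P)"
      proof (intro nn_integral_diff AE_I2)
        have "(\<lambda>y. emeasure (K y) {..t}) \<in> borel_measurable N"
          using measurable_emeasure_kernel[OF Ksub] by simp
        then show "(\<lambda>y. emeasure (K y) {..t} * indicator A y) \<in> borel_measurable P" by simp
        show "emeasure (K y) {..t} * indicator A y \<le> indicator A y" for y
          using prob_space.emeasure_le_1[OF prob[of y]] by (simp add: indicator_def)
        show "(\<integral>\<^sup>+y\<in>A. emeasure (K y) {..t} \<partial>P) \<noteq> \<infinity>" by (simp add: cdf M.emeasure_eq_measure)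
      qed simp
      also have "\<dots> = emeasure M {x\<in>space M. X x \<in> A} - emeasure M (S A t)"
        unfolding cdf[OF A] by (simp add: P_def emeasure_distr vimage_def Int_def conj_commute)
      also have "\<dots> = emeasure M ({x\<in>space M. X x \<in> A} - S A t)"
        by (intro emeasure_Diff[symmetric]) (auto simp: S_def M.emeasure_eq_measure)
      also have "{x\<in>space M. X x \<in> A} - S A t = {x\<in>space M. X x \<in> A \<and> T x \<in> {t<..}}" by (auto simp: S_def)
      finally show "emeasure ?M1 {t<..} = emeasure ?M2 {t<..}" by (subst 1) auto
    qed simp_all
    then show ?thesis using 1[OF B] 2[OF B] by simp
  qed
  let ?E = "{A \<times> B |A B. A \<in> sets N \<and> B \<in> sets (borel :: real measure)}"
  let ?D = "distr M (N \<Otimes>\<^sub>M borel) (\<lambda>x. (X x, T x))"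
  have Req: "?D = R"
  proof (rule measure_eqI_generator_eq[where E = "?E" and \<Omega> = "space N \<times> space borel" and A = "\<lambda>_. space N \<times> UNIV"])
    show "Int_stable ?E"
      by (rule Int_stable_pair_measure_generator)
    show "?E \<subseteq> Pow (space N \<times> space borel)"
      by (rule pair_measure_closed)
    fix Z assume "Z \<in> ?E"
    then obtain A B where Z: "Z = A \<times> B" and [measurable]: "A \<in> sets N" "B \<in> sets borel" by blast
    have "(\<lambda>x. (X x, T x)) -` (A \<times> B) \<inter> space M = {x\<in>space M. X x \<in> A \<and> T x \<in> B}" by blast
    then have "emeasure (?D) Z = emeasure M {x\<in>space M. X x \<in> A \<and> T x \<in> B}"
      unfolding Z by (subst emeasure_distr) simp_all
    then show "emeasure (?D) Z = emeasure R Z"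
      by (simp add: Z rect eqB)
  next
    show "sets (?D) = sigma_sets (space N \<times> space borel) ?E"
      "sets R = sigma_sets (space N \<times> space borel) ?E"
      by (simp_all add: sets_pair_measure setsR)
    show "range (\<lambda>_. space N \<times> UNIV) \<subseteq> ?E"
      by (rule image_subsetI, rule CollectI, rule exI[of _ "space N"], rule exI[of _ UNIV]) simp
    show "emeasure (?D) (space N \<times> UNIV) \<noteq> \<infinity>"
      by (subst emeasure_distr) (simp_all add: M.emeasure_eq_measure)
  qed simp
  show ?thesis
  proof (intro bexI[OF _ K] ballI)
    fix f :: "'b \<times> real \<Rightarrow> ennreal" assume f[measurable]: "f \<in> borel_measurable (N \<Otimes>\<^sub>M borel)"
    have "(\<integral>\<^sup>+x. f (X x, T x) \<partial>M) = (\<integral>\<^sup>+z. f z \<partial>R)"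
      unfolding Req[symmetric] by (subst nn_integral_distr) auto
    also have "\<dots> = (\<integral>\<^sup>+y. (\<integral>\<^sup>+z. f z \<partial>distr (K y) (N \<Otimes>\<^sub>M borel) (Pair y)) \<partial>P)"
      unfolding R_def by (rule nn_integral_bind[OF f kap])
    also have "\<dots> = (\<integral>\<^sup>+y. (\<integral>\<^sup>+t. f (y, t) \<partial>K y) \<partial>P)"
    proof (intro nn_integral_cong)
      fix y assume y: "y \<in> space P"
      have [measurable_cong]: "sets (K y) = sets borel" by (rule setsK)
      show "(\<integral>\<^sup>+z. f z \<partial>distr (K y) (N \<Otimes>\<^sub>M borel) (Pair y)) = (\<integral>\<^sup>+t. f (y, t) \<partial>K y)"
        using y spP by (subst nn_integral_distr) auto
    qed
    finally show "(\<integral>\<^sup>+x. f (X x, T x) \<partial>M) = (\<integral>\<^sup>+y. (\<integral>\<^sup>+t. f (y, t) \<partial>K y) \<partial>distr M N X)" unfolding P_def .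
  qed
qed

section \<open>Projection onto a hyperplane\<close>

text \<open>Exhaustion: among the null sets of \<open>L\<close> some \<open>N\<close> carries the
  largest \<open>M\<close>-mass. Off \<open>N\<close> the measure \<open>M\<close> charges no null
  set of \<open>L\<close>, since such a set could be added to \<open>N\<close>. Radon-Nikodym
  applies to that part, and the restriction to \<open>N\<close> is the singular one.\<close>

lemma exists_ac_part_density:
  fixes L M :: "'a measure"
  assumes L: "sigma_finite_measure L" and M: "finite_measure M" and sets: "sets M = sets L"
  shows "\<exists>\<Phi>. ac_part_density L M \<Phi>"
proof -
  interpret L: sigma_finite_measure L by fact
  interpret M: finite_measure M by fact
  note [measurable_cong] = sets
  have "null_sets L \<noteq> {}" by blast
  from ennreal_SUP_countable_SUP[OF this, of "emeasure M"] obtain f :: "nat \<Rightarrow> ennreal"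
    where f: "range f \<subseteq> emeasure M ` null_sets L" "(SUP A\<in>null_sets L. emeasure M A) = (SUP i. f i)" by blast
  have "\<forall>i. \<exists>A\<in>null_sets L. f i = emeasure M A" using f(1) by blast
  then obtain A where A: "\<And>i. A i \<in> null_sets L" "\<And>i. f i = emeasure M (A i)" by metis
  define N where "N = (\<Union>i::nat. A i)"
  have N: "N \<in> null_sets L" unfolding N_def by (rule null_sets_UN) (rule A)
  then have [measurable]: "N \<in> sets L" by auto
  have max: "emeasure M B \<le> emeasure M N" if "B \<in> null_sets L" for B
  proof -
    have "emeasure M B \<le> (SUP i. f i)" unfolding f(2)[symmetric] using that by (rule SUP_upper)
    also have "\<dots> \<le> emeasure M N"
      using A(1) unfolding A(2) N_def by (intro SUP_least emeasure_mono) (auto simp: sets)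
    finally show ?thesis .
  qed
  define D where "D = density M (indicator (space L - N))"
  have D: "emeasure D B = emeasure M (B - N)" if [measurable]: "B \<in> sets L" for B
  proof -
    have eq: "indicator (space L - N) x * indicator B x = (indicator (B - N) x :: ennreal)" for x
      using sets.sets_into_space[OF that] by (auto simp: indicator_def)
    have "emeasure D B = (\<integral>\<^sup>+x. indicator (space L - N) x * indicator B x \<partial>M)"
      unfolding D_def by (rule emeasure_density) (simp_all add: sets)
    then show ?thesis unfolding eq by (simp add: sets)
  qed
  have "absolutely_continuous L D"
    unfolding absolutely_continuous_def
  proof
    fix B assume B: "B \<in> null_sets L"
    then have [measurable]: "B \<in> sets L" by auto
    have "emeasure M N + emeasure M (B - N) = emeasure M (N \<union> (B - N))"
      by (rule plus_emeasure) (auto simp: sets)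
    also have "N \<union> (B - N) = B \<union> N" by blast
    also have "emeasure M (B \<union> N) \<le> emeasure M N + 0" using max[OF null_sets.Un[OF B N]] by simp
    finally have "emeasure M (B - N) = 0"
      by (subst (asm) ennreal_add_left_cancel_le) (auto simp: M.emeasure_eq_measure)
    then have "emeasure D B = 0" by (simp add: D)
    then show "B \<in> null_sets D" by (auto simp: D_def sets)
  qed
  from L.Radon_Nikodym[OF this] obtain h where h[measurable]: "h \<in> borel_measurable L" "density L h = D"
    by (auto simp: D_def sets)
  have "(\<integral>\<^sup>+x. h x \<partial>L) = emeasure D (space L)"
    unfolding h(2)[symmetric] by (simp add: emeasure_density cong: nn_integral_cong)
  also have "\<dots> < \<infinity>" by (simp add: D M.emeasure_eq_measure)
  finally have "AE x in L. h x \<noteq> \<infinity>" by (intro nn_integral_noteq_infinite) auto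
  \<comment> \<open>The density has to be real valued; since \<open>M\<close> is finite,
    \<open>h\<close> is infinite only on a null set, where its value may be changed.\<close>
  then have hD: "density L (\<lambda>y. ennreal (enn2real (h y))) = D"
    unfolding h(2)[symmetric] by (intro density_cong) (auto simp: less_top elim!: eventually_mono)
  show ?thesis unfolding ac_part_density_def
  proof (intro exI conjI ballI)
    show "(\<lambda>y. enn2real (h y)) \<in> borel_measurable L" by measurable
    show "sets (density M (indicator N)) = sets L" by (simp add: sets)
    show "N \<in> null_sets L" by (rule N)
    show "emeasure (density M (indicator N)) (space L - N) = 0"
      by (subst emeasure_density) (auto simp: sets indicator_def nn_integral_0_iff_AE)
    fix B assume B[measurable]: "B \<in> sets L"
    have eq: "indicator N x * indicator B x = (indicator (B \<inter> N) x :: ennreal)" for x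
      by (auto simp: indicator_def)
    have "emeasure (density M (indicator N)) B = (\<integral>\<^sup>+x. indicator N x * indicator B x \<partial>M)"
      by (rule emeasure_density) (simp_all add: sets)
    then have "emeasure (density M (indicator N)) B = emeasure M (B \<inter> N)" unfolding eq by (simp add: sets)
    moreover have "emeasure M B = emeasure M (B - N) + emeasure M (B \<inter> N)"
    proof -
      have "(B - N) \<union> (B \<inter> N) = B" by blast
      then show ?thesis by (subst plus_emeasure) (auto simp: sets)
    qed
    ultimately show "emeasure M B = emeasure (density L (\<lambda>y. ennreal (enn2real (h y)))) B + emeasure (density M (indicator N)) B"
      by (simp add: hD D)
  qed simp
qed

section \<open>Geometry of the projection and Lebesgue measure on the hyperplane\<close>

lemma subspace_perp: "subspace (perp n)"
  unfolding perp_def by (rule subspace_orthogonal_comp)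

lemma mem_perp_iff: "y \<in> perp n \<longleftrightarrow> y \<bullet> n = 0"
proof -
  have "y \<in> perp n \<longleftrightarrow> (\<forall>c. y \<bullet> (c *\<^sub>R n) = 0)"
    by (auto simp: perp_def orthogonal_comp_def span_singleton orthogonal_def inner_commute)
  also have "\<dots> \<longleftrightarrow> y \<bullet> n = 0" by (auto dest: spec[of _ 1])
  finally show ?thesis .
qed

lemma proj_in_perp: "norm n = 1 \<Longrightarrow> proj n x \<in> perp n"
  by (simp add: mem_perp_iff proj_def inner_diff_left dot_square_norm)

lemma proj_id: "y \<in> perp n \<Longrightarrow> proj n y = y"
  by (simp add: mem_perp_iff proj_def)

lemma norm_proj_le: "norm n = 1 \<Longrightarrow> norm (proj n x) \<le> norm x"
proof -
  assume n: "norm n = 1"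
  have "proj n x \<bullet> ((x \<bullet> n) *\<^sub>R n) = 0"
    using proj_in_perp[OF n, of x] by (simp add: mem_perp_iff)
  then have "(norm (proj n x + (x \<bullet> n) *\<^sub>R n))\<^sup>2 = (norm (proj n x))\<^sup>2 + (norm ((x \<bullet> n) *\<^sub>R n))\<^sup>2"
    by (intro norm_add_Pythagorean) (simp add: orthogonal_def)
  then have "(norm (proj n x))\<^sup>2 \<le> (norm x)\<^sup>2" by (simp add: proj_def)
  then show ?thesis by (rule power2_le_imp_le) simp
qed

lemma continuous_on_proj: "continuous_on S (proj n)"
  unfolding proj_def[abs_def] by (intro continuous_intros)

lemma measurable_proj_borel[measurable]: "proj n \<in> borel \<rightarrow>\<^sub>M borel"
  by (intro borel_measurable_continuous_onI continuous_on_proj)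

lemma measurable_proj: "norm n = 1 \<Longrightarrow> proj n \<in> borel \<rightarrow>\<^sub>M restrict_space borel (perp n)"
  by (intro measurable_restrict_space2) (auto simp: proj_in_perp)

lemma exists_orthonormal_basis_of:
  assumes "subspace V"
  shows "orthonormal_basis_of V (SOME B. orthonormal_basis_of V B)"
proof -
  obtain B where "B \<subseteq> V" "pairwise orthogonal B" "\<And>x. x \<in> B \<Longrightarrow> norm x = 1" "independent B"
    "card B = dim V" "span B = V" by (rule orthonormal_basis_subspace[OF assms]) (rule that)
  then have "orthonormal_basis_of V B" by (simp add: orthonormal_basis_of_def)
  then show ?thesis by (rule someI[of "orthonormal_basis_of V"])
qed

lemma sets_subspace_lborel[simp, measurable_cong]: "sets (subspace_lborel V) = sets (restrict_space borel V)"
  by (simp add: subspace_lborel_def Let_def)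

lemma space_subspace_lborel[simp]: "space (subspace_lborel V) = V"
  using sets_eq_imp_space_eq[OF sets_subspace_lborel[of V]] by (simp add: space_restrict_space)

text \<open>By Cauchy-Schwarz each coordinate in an orthonormal basis is bounded by the norm, so the
  ball pulls back into a cube of finite product measure.\<close>

lemma emeasure_subspace_lborel_cball:
  fixes V :: "'a::euclidean_space set"
  assumes V: "subspace V"
  shows "emeasure (subspace_lborel V) (V \<inter> cball 0 r) < \<infinity>"
proof -
  define B where "B = (SOME B. orthonormal_basis_of V B)"
  have B: "B \<subseteq> V" "span B = V" "pairwise orthogonal B" "\<And>b. b \<in> B \<Longrightarrow> norm b = 1"
    using exists_orthonormal_basis_of[OF V] by (auto simp: B_def orthonormal_basis_of_def)
  have "0 \<notin> B" using B(4) by force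
  then have finB: "finite B" using pairwise_orthogonal_independent[OF B(3)] independent_imp_finite by blast
  let ?P = "\<Pi>\<^sub>M b\<in>B. (lborel :: real measure)"
  interpret product_sigma_finite "\<lambda>b::'a. lborel :: real measure" by standard
  let ?s = "\<lambda>f :: 'a \<Rightarrow> real. \<Sum>b\<in>B. f b *\<^sub>R b"
  have sV: "?s f \<in> V" for f using B(1) V by (intro subspace_sum subspace_scale) auto
  have [measurable]: "?s \<in> ?P \<rightarrow>\<^sub>M borel" by measurable
  have s: "?s \<in> ?P \<rightarrow>\<^sub>M restrict_space borel V"
    by (intro measurable_restrict_space2) (auto simp: sV)
  have coord: "?s f \<bullet> b = f b" if "b \<in> B" for f b
  proof -
    have "?s f \<bullet> b = (\<Sum>c\<in>B. f c * (c \<bullet> b))" by (simp add: inner_sum_left)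
    also have "\<dots> = (\<Sum>c\<in>B. if c = b then f c else 0)"
    proof (intro sum.cong refl)
      fix c assume "c \<in> B"
      then show "f c * (c \<bullet> b) = (if c = b then f c else 0)"
        using B(3,4) that by (auto simp: pairwise_def orthogonal_def dot_square_norm)
    qed
    finally show ?thesis using finB that by simp
  qed
  have "emeasure (subspace_lborel V) (V \<inter> cball 0 r) = emeasure ?P (?s -` (V \<inter> cball 0 r) \<inter> space ?P)"
    unfolding subspace_lborel_def Let_def B_def[symmetric]
    by (intro emeasure_distr s) (auto simp: sets_restrict_space)
  also have "\<dots> \<le> emeasure ?P (Pi\<^sub>E B (\<lambda>b. {-r..r}))"
  proof (intro emeasure_mono subsetI)
    fix f assume f: "f \<in> ?s -` (V \<inter> cball 0 r) \<inter> space ?P"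
    have "f b \<in> {-r..r}" if "b \<in> B" for b
    proof -
      have "\<bar>f b\<bar> \<le> norm (?s f) * norm b" using Cauchy_Schwarz_ineq2[of "?s f" b] coord[OF that] by simp
      also have "\<dots> \<le> r" using f B(4)[OF that] by simp
      finally show ?thesis by (auto simp: abs_le_iff)
    qed
    with f show "f \<in> Pi\<^sub>E B (\<lambda>b. {-r..r})" by (auto simp: space_PiM PiE_def)
  qed (intro sets_PiM_I_finite finB, simp)
  also have "\<dots> = (\<Prod>b\<in>B. emeasure lborel {-r..r})" by (rule emeasure_PiM) (auto simp: finB)
  also have "\<dots> < \<infinity>" by (cases "- r \<le> r") (auto simp: ennreal_power[symmetric] power_less_top_ennreal)
  finally show ?thesis .
qed

lemma sigma_finite_subspace_lborel:
  fixes V :: "'a::euclidean_space set"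
  assumes V: "subspace V"
  shows "sigma_finite_measure (subspace_lborel V)"
proof
  let ?A = "range (\<lambda>i::nat. V \<inter> cball 0 (real i))"
  have "?A \<subseteq> sets (subspace_lborel V)"
    by (rule image_subsetI) (simp add: sets_restrict_space)
  moreover have "\<Union>?A = space (subspace_lborel V)"
  proof (rule equalityI)
    show "\<Union>?A \<subseteq> space (subspace_lborel V)" by (rule UN_least) simp
    show "space (subspace_lborel V) \<subseteq> \<Union>?A"
    proof
      fix x assume "x \<in> space (subspace_lborel V)"
      moreover from real_arch_simple[of "norm x"] obtain i :: nat where "norm x \<le> real i" ..
      ultimately have "x \<in> V \<inter> cball 0 (real i)" by simp
      then show "x \<in> \<Union>?A" by (rule UN_I[OF UNIV_I])
    qed
  qed
  moreover have "\<forall>a\<in>?A. emeasure (subspace_lborel V) a \<noteq> \<infinity>"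
  proof
    fix a assume "a \<in> ?A"
    then obtain i :: nat where "a = V \<inter> cball 0 (real i)" by (rule rangeE)
    then show "emeasure (subspace_lborel V) a \<noteq> \<infinity>"
      using emeasure_subspace_lborel_cball[OF V, of "real i"] by simp
  qed
  ultimately show "\<exists>A. countable A \<and> A \<subseteq> sets (subspace_lborel V) \<and> \<Union> A = space (subspace_lborel V)
      \<and> (\<forall>a\<in>A. emeasure (subspace_lborel V) a \<noteq> \<infinity>)"
    by (intro exI[of _ ?A] conjI) (rule countable_image, rule countableI_type, assumption+)
qed

text \<open>The kernel is the conditional law of \<open>x \<bullet> n\<close> given
  \<open>proj n x\<close>, as a point is recovered from these two. Most of the work is the passage
  from nonnegative functions to Bochner integrals of signed ones.\<close>

lemma exists_is_disintegration:
  fixes M :: "'a::euclidean_space measure"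
  assumes M: "finite_measure M" and sets: "sets M = sets borel" and n: "norm n = 1"
  shows "\<exists>K. is_disintegration n M K"
proof -
  let ?N = "restrict_space borel (perp n)"
  note [measurable_cong] = sets
  have X: "proj n \<in> M \<rightarrow>\<^sub>M ?N"
    unfolding measurable_cong_sets[OF sets refl] by (rule measurable_proj[OF n])
  have T: "(\<lambda>x. x \<bullet> n) \<in> borel_measurable M" by measurable
  from exists_regular_conditional_distribution[OF M X T] obtain K where K: "K \<in> ?N \<rightarrow>\<^sub>M prob_algebra borel"
    and int: "\<forall>f\<in>borel_measurable (?N \<Otimes>\<^sub>M borel).
     (\<integral>\<^sup>+x. f (proj n x, x \<bullet> n) \<partial>M) = (\<integral>\<^sup>+y. (\<integral>\<^sup>+t. f (y, t) \<partial>K y) \<partial>distr M ?N (proj n))"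
    by (rule bexE)
  have KP: "K \<in> proj_measure n M \<rightarrow>\<^sub>M prob_algebra borel" using K by (simp add: proj_measure_def)
  have nn: "(\<integral>\<^sup>+x. f x \<partial>M) = (\<integral>\<^sup>+y. (\<integral>\<^sup>+t. f (y + t *\<^sub>R n) \<partial>K y) \<partial>proj_measure n M)"
    if [measurable]: "f \<in> borel_measurable borel" for f :: "'a \<Rightarrow> ennreal"
  proof -
    have [measurable]: "(\<lambda>y. y) \<in> ?N \<rightarrow>\<^sub>M borel" by (rule measurable_restrict_space1) simp
    have "(\<lambda>(y, t). f (y + t *\<^sub>R n)) \<in> borel_measurable (?N \<Otimes>\<^sub>M borel)" by measurable
    from int[rule_format, OF this] show ?thesis by (simp add: proj_measure_def proj_def)
  qed
  have meas: "(\<lambda>y. \<integral>\<^sup>+t. f (y + t *\<^sub>R n) \<partial>K y) \<in> borel_measurable (proj_measure n M)"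
    if [measurable]: "f \<in> borel_measurable borel" for f :: "'a \<Rightarrow> ennreal"
  proof -
    have [measurable]: "(\<lambda>y. y) \<in> proj_measure n M \<rightarrow>\<^sub>M borel"
      unfolding proj_measure_def by (simp add: measurable_restrict_space1)
    show ?thesis
      by (rule nn_integral_measurable_subprob_algebra2[OF _ measurable_prob_algebraD[OF KP]]) measurable
  qed
  show ?thesis
    unfolding is_disintegration_def
  proof (intro exI[of _ K] conjI KP allI impI)
    fix \<phi> :: "'a \<Rightarrow> real" assume \<phi>: "integrable M \<phi>"
    then have [measurable]: "\<phi> \<in> borel_measurable borel" by simp
    let ?P = "proj_measure n M"
    \<comment> \<open>As \<open>ennreal\<close> sends negative reals to 0, \<open>u 1\<close> and
      \<open>u (-1)\<close> are the line integrals of the positive and the negative part of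
      \<open>\<phi>\<close>.\<close>
    define u where "u s y = (\<integral>\<^sup>+t. ennreal (s * \<phi> (y + t *\<^sub>R n)) \<partial>K y)" for s y
    have um[measurable]: "u s \<in> borel_measurable ?P" for s unfolding u_def by (rule meas) measurable
    have uint: "(\<integral>\<^sup>+y. u s y \<partial>?P) = (\<integral>\<^sup>+x. ennreal (s * \<phi> x) \<partial>M)" for s
      unfolding u_def by (subst nn) measurable
    have ufin: "(\<integral>\<^sup>+y. u s y \<partial>?P) < \<infinity>" if "s = 1 \<or> s = -1" for s
      unfolding uint using \<phi> that by (auto simp: real_integrable_def less_top)
    have AEu: "AE y in ?P. u s y \<noteq> \<infinity>" if "s = 1 \<or> s = -1" for s
      using ufin[OF that] by (intro nn_integral_noteq_infinite) auto
    have ii: "integrable ?P (\<lambda>y. enn2real (u s y))" "(\<integral>y. enn2real (u s y) \<partial>?P) = enn2real (\<integral>\<^sup>+x. ennreal (s * \<phi> x) \<partial>M)"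
      if s: "s = 1 \<or> s = -1" for s
    proof -
      have e: "(\<integral>\<^sup>+y. ennreal (enn2real (u s y)) \<partial>?P) = (\<integral>\<^sup>+y. u s y \<partial>?P)"
        using AEu[OF s] by (intro nn_integral_cong_AE) (auto simp: less_top elim!: eventually_mono)
      then show "integrable ?P (\<lambda>y. enn2real (u s y))"
        using ufin[OF s] by (intro integrableI_nonneg) auto
      show "(\<integral>y. enn2real (u s y) \<partial>?P) = enn2real (\<integral>\<^sup>+x. ennreal (s * \<phi> x) \<partial>M)"
        by (subst integral_eq_nn_integral) (auto simp: e uint)
    qed
    have "(\<integral>y. (\<integral>t. \<phi> (y + t *\<^sub>R n) \<partial>K y) \<partial>?P) = (\<integral>y. enn2real (u 1 y) - enn2real (u (-1) y) \<partial>?P)"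
    proof (rule integral_cong_AE)
      have [measurable]: "(\<lambda>y. y) \<in> ?P \<rightarrow>\<^sub>M borel"
        unfolding proj_measure_def by (simp add: measurable_restrict_space1)
      show "(\<lambda>y. \<integral>t. \<phi> (y + t *\<^sub>R n) \<partial>K y) \<in> borel_measurable ?P"
      proof (rule measurable_cong[THEN iffD1])
        \<comment> \<open>Pushing \<open>K y\<close> onto the line through \<open>y\<close> makes
          the integrand independent of \<open>y\<close>, so measurability of the inner integral
          follows from that of the kernel.\<close>
        have D: "(\<lambda>y. distr (K y) borel (\<lambda>t. y + t *\<^sub>R n)) \<in> ?P \<rightarrow>\<^sub>M subprob_algebra borel"
          by (rule measurable_distr2[OF _ measurable_prob_algebraD[OF KP]]) measurable
        show "(\<lambda>y. \<integral>x. \<phi> x \<partial>distr (K y) borel (\<lambda>t. y + t *\<^sub>R n)) \<in> borel_measurable ?P"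
          by (rule measurable_compose[OF D integral_measurable_subprob_algebra]) measurable
        fix y assume "y \<in> space ?P"
        then have [measurable_cong]: "sets (K y) = sets borel"
          using measurable_space[OF KP] by (simp add: space_prob_algebra)
        show "(\<integral>x. \<phi> x \<partial>distr (K y) borel (\<lambda>t. y + t *\<^sub>R n)) = (\<integral>t. \<phi> (y + t *\<^sub>R n) \<partial>K y)"
          by (rule integral_distr) measurable
      qed
      show "AE y in ?P. (\<integral>t. \<phi> (y + t *\<^sub>R n) \<partial>K y) = enn2real (u 1 y) - enn2real (u (-1) y)"
        using AEu[OF disjI1[OF refl]] AEu[OF disjI2[OF refl]] AE_space
      proof eventually_elim
        fix y assume y: "u 1 y \<noteq> \<infinity>" "u (-1) y \<noteq> \<infinity>" "y \<in> space ?P"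
        have [measurable_cong]: "sets (K y) = sets borel"
          using measurable_space[OF KP y(3)] by (simp add: space_prob_algebra)
        have "integrable (K y) (\<lambda>t. \<phi> (y + t *\<^sub>R n))"
          using y by (simp add: real_integrable_def u_def)
        from real_lebesgue_integral_def[OF this]
        show "(\<integral>t. \<phi> (y + t *\<^sub>R n) \<partial>K y) = enn2real (u 1 y) - enn2real (u (-1) y)" by (simp add: u_def)
      qed
    qed measurable
    also have "\<dots> = (\<integral>y. enn2real (u 1 y) \<partial>?P) - (\<integral>y. enn2real (u (-1) y) \<partial>?P)"
      by (rule Bochner_Integration.integral_diff) (simp_all add: ii)
    also have "\<dots> = (\<integral>x. \<phi> x \<partial>M)"
      using real_lebesgue_integral_def[OF \<phi>] by (simp add: ii)
    finally show "(\<integral>x. \<phi> x \<partial>M) = (\<integral>y. (\<integral>t. \<phi> (y + t *\<^sub>R n) \<partial>K y) \<partial>?P)" ..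
  qed
qed

section \<open>Tight weakly convergent sequences\<close>

lemma limsup_mult_ennreal_le:
  fixes x :: "nat \<Rightarrow> ennreal"
  assumes "limsup x \<le> a" "c < \<infinity>"
  shows "limsup (\<lambda>k. x k * c) \<le> a * c"
proof -
  have "limsup (\<lambda>k. x k * c) = limsup x * c"
  proof (rule Limsup_compose_continuous_mono)
    have "continuous_on UNIV (\<lambda>y. c * y)"
      by (rule ennreal_continuous_on_cmult) (use assms(2) in \<open>auto intro: continuous_on_id\<close>)
    then show "continuous_on UNIV (\<lambda>y. y * c)" by (simp add: mult.commute)
  qed (auto intro!: monoI mult_right_mono)
  also have "\<dots> \<le> a * c" using assms(1) by (rule mult_right_mono) simp
  finally show ?thesis .
qed

lemma radon_measure_integrable:
  fixes \<phi> :: "'a::euclidean_space \<Rightarrow> real"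
  assumes M: "radon_measure M" and cont: "continuous_on UNIV \<phi>" and comp: "compact (closure {x. \<phi> x \<noteq> 0})"
  shows "integrable M \<phi>"
proof -
  have sets: "sets M = sets borel" and fin: "\<And>K. compact K \<Longrightarrow> emeasure M K < \<infinity>"
    using M by (auto simp: radon_measure_def)
  let ?K = "closure {x. \<phi> x \<noteq> 0}"
  have "compact (\<phi> ` ?K)"
    by (rule compact_continuous_image[OF continuous_on_subset[OF cont] comp]) simp
  then obtain B where B: "\<forall>y\<in>\<phi> ` ?K. norm y \<le> B" using compact_imp_bounded bounded_iff by metis
  show ?thesis
  proof (rule integrableI_bounded_set[of ?K])
    show "?K \<in> sets M" by (simp add: sets)
    show "\<phi> \<in> borel_measurable M"
      unfolding measurable_cong_sets[OF sets refl] by (rule borel_measurable_continuous_onI[OF cont])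
    show "emeasure M ?K < \<infinity>" by (rule fin[OF comp])
    show "AE x\<in>?K in M. norm (\<phi> x) \<le> B" using B by auto
    show "AE x in M. x \<notin> ?K \<longrightarrow> \<phi> x = 0" using closure_subset[of "{x. \<phi> x \<noteq> 0}"] by (intro AE_I2) blast
  qed
qed

text \<open>It is 1 on the ball of radius \<open>r\<close> and 0 outside the ball of radius
  \<open>r + 1\<close> when \<open>r\<close> is nonnegative; multiplying by it produces the
  compactly supported test functions that weak convergence admits.\<close>

definition cutoff :: "real \<Rightarrow> 'a::real_normed_vector \<Rightarrow> real" where
  "cutoff r x = max 0 (min 1 (r + 1 - norm x))"

lemma cutoff_bounds: "0 \<le> cutoff r x" "cutoff r x \<le> 1"
  by (auto simp: cutoff_def)

lemma cutoff_eq_1: "norm x \<le> r \<Longrightarrow> cutoff r x = 1"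
  by (simp add: cutoff_def)

lemma continuous_on_cutoff: "continuous_on S (cutoff r)"
  unfolding cutoff_def[abs_def] by (intro continuous_intros)

lemma compact_support_mult_cutoff:
  "compact (closure {x::'a::euclidean_space. \<theta> x * cutoff r x \<noteq> (0::real)})"
proof -
  have "{x::'a. \<theta> x * cutoff r x \<noteq> 0} \<subseteq> cball 0 (r + 1)" by (auto simp: cutoff_def)
  then show ?thesis unfolding compact_closure by (rule bounded_subset[OF bounded_cball])
qed

text \<open>A cutoff lies between the indicator of a ball and 1, so the bound passes to every ball
  in the limit and then to the whole space. This is where finiteness of the limit measure comes
  from.\<close>

lemma weak_limit_mass_le:
  fixes M :: "nat \<Rightarrow> 'a::euclidean_space measure"
  assumes radon_k: "\<And>k. radon_measure (M k)" and radon: "radon_measure \<mu>"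
    and weak: "weakly_converges M \<mu>" and bdd: "\<And>k. emeasure (M k) UNIV \<le> ennreal C"
  shows "emeasure \<mu> UNIV \<le> ennreal C"
proof -
  have setsk: "sets (M k) = sets borel" for k using radon_k by (simp add: radon_measure_def)
  have sets: "sets \<mu> = sets borel" using radon by (simp add: radon_measure_def)
  have spk: "space (M k) = UNIV" for k using sets_eq_imp_space_eq[OF setsk] by simp
  \<comment> \<open>The factor 1 gives the integrand the shape that
    \<open>compact_support_mult_cutoff\<close> expects.\<close>
  have int: "integrable N (\<lambda>x. 1 * cutoff r x)" if "radon_measure N" for N :: "'a measure" and r
    by (rule radon_measure_integrable[OF that _ compact_support_mult_cutoff]) (intro continuous_intros continuous_on_cutoff)
  have ball: "emeasure \<mu> (cball 0 (real i)) \<le> ennreal C" for i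
  proof -
    have "(\<lambda>k. \<integral>x. 1 * cutoff (real i) x \<partial>M k) \<longlonglongrightarrow> (\<integral>x. 1 * cutoff (real i) x \<partial>\<mu>)"
      using weak unfolding weakly_converges_def
      by (auto intro: continuous_intros continuous_on_cutoff compact_support_mult_cutoff[of "\<lambda>_. 1", simplified])
    then have lim: "(\<lambda>k. ennreal (\<integral>x. 1 * cutoff (real i) x \<partial>M k)) \<longlonglongrightarrow> ennreal (\<integral>x. 1 * cutoff (real i) x \<partial>\<mu>)"
      by (rule tendsto_ennrealI)
    have le: "ennreal (\<integral>x. 1 * cutoff (real i) x \<partial>M k) \<le> ennreal C" for k
    proof -
      have "ennreal (\<integral>x. 1 * cutoff (real i) x \<partial>M k) = (\<integral>\<^sup>+x. ennreal (1 * cutoff (real i) x) \<partial>M k)"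
        by (rule nn_integral_eq_integral[symmetric, OF int[OF radon_k]]) (simp add: cutoff_bounds)
      also have "\<dots> \<le> (\<integral>\<^sup>+x. 1 \<partial>M k)" by (intro nn_integral_mono) (simp add: cutoff_bounds)
      also have "\<dots> \<le> ennreal C" using bdd[of k] by (simp add: spk)
      finally show ?thesis .
    qed
    have "emeasure \<mu> (cball 0 (real i)) = (\<integral>\<^sup>+x. indicator (cball 0 (real i)) x \<partial>\<mu>)" by (simp add: sets)
    also have "\<dots> \<le> (\<integral>\<^sup>+x. ennreal (1 * cutoff (real i) x) \<partial>\<mu>)"
      by (intro nn_integral_mono) (simp add: indicator_def cutoff_eq_1)
    also have "\<dots> = ennreal (\<integral>x. 1 * cutoff (real i) x \<partial>\<mu>)"
      by (rule nn_integral_eq_integral[OF int[OF radon]]) (simp add: cutoff_bounds)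
    also have "\<dots> \<le> ennreal C" using le by (intro LIMSEQ_le_const2[OF lim]) auto
    finally show ?thesis .
  qed
  have "(\<Union>i::nat. cball 0 (real i)) = (UNIV :: 'a set)"
    using real_arch_simple by (auto simp: set_eq_iff)
  then have "emeasure \<mu> UNIV = emeasure \<mu> (\<Union>i::nat. cball 0 (real i))" by simp
  also have "\<dots> = (SUP i::nat. emeasure \<mu> (cball 0 (real i)))"
    by (intro SUP_emeasure_incseq[symmetric]) (auto simp: incseq_def sets)
  also have "\<dots> \<le> ennreal C" by (rule SUP_least) (rule ball)
  finally show ?thesis .
qed

text \<open>Tightness replaces compact support: the part of \<open>\<theta>\<close> beyond radius
  \<open>R\<close> contributes at most \<open>B\<close> times the uniformly small tail mass.\<close>

lemma limsup_integral_continuous_le: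
  fixes M :: "nat \<Rightarrow> 'a::euclidean_space measure" and \<theta> :: "'a \<Rightarrow> real"
  assumes radon_k: "\<And>k. radon_measure (M k)" and radon: "radon_measure \<mu>"
    and weak: "weakly_converges M \<mu>"
    and tight: "\<And>\<epsilon>::real. \<epsilon> > 0 \<Longrightarrow> \<exists>R::real. \<forall>k. emeasure (M k) {x. norm x > R} < ennreal \<epsilon>"
    and \<theta>: "continuous_on UNIV \<theta>" "\<And>x. 0 \<le> \<theta> x" "\<And>x. \<theta> x \<le> B"
  shows "limsup (\<lambda>k. \<integral>\<^sup>+x. ennreal (\<theta> x) \<partial>M k) \<le> (\<integral>\<^sup>+x. ennreal (\<theta> x) \<partial>\<mu>)"
proof (rule limsup_le_epsilon)
  fix e :: real assume e: "0 < e"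
  have setsk[measurable_cong]: "sets (M k) = sets borel" for k using radon_k by (simp add: radon_measure_def)
  have [measurable]: "\<theta> \<in> borel_measurable borel" "cutoff r \<in> borel_measurable borel" for r
    by (intro borel_measurable_continuous_onI \<theta> continuous_on_cutoff)+
  have B: "0 \<le> B" using \<theta>(2,3) order_trans by blast
  \<comment> \<open>Dividing by \<open>B + 1\<close> covers the case of a zero bound.\<close>
  then have "0 < e / (B + 1)" using e by simp
  from tight[OF this] obtain R where R: "\<And>k. emeasure (M k) {x. norm x > R} < ennreal (e / (B + 1))" by blast
  let ?t = "\<lambda>x. \<theta> x * cutoff R x"
  have cont: "continuous_on UNIV ?t" by (intro continuous_intros \<theta> continuous_on_cutoff)
  have t0: "0 \<le> ?t x" for x by (simp add: \<theta> cutoff_bounds)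
  have nn: "(\<integral>\<^sup>+x. ennreal (?t x) \<partial>N) = ennreal (\<integral>x. ?t x \<partial>N)" if "radon_measure N" for N
    by (rule nn_integral_eq_integral[OF radon_measure_integrable[OF that cont compact_support_mult_cutoff]]) (simp add: t0)
  have lim: "(\<lambda>k. \<integral>\<^sup>+x. ennreal (?t x) \<partial>M k) \<longlonglongrightarrow> (\<integral>\<^sup>+x. ennreal (?t x) \<partial>\<mu>)"
    unfolding nn[OF radon_k] nn[OF radon]
    using weak cont compact_support_mult_cutoff[of \<theta> R] unfolding weakly_converges_def by (intro tendsto_ennrealI) blast
  have "(\<integral>\<^sup>+x. ennreal (\<theta> x) \<partial>M k) \<le> (\<integral>\<^sup>+x. ennreal (?t x) \<partial>M k) + ennreal e" for k
  proof -
    have "(\<integral>\<^sup>+x. ennreal (\<theta> x) \<partial>M k) \<le> (\<integral>\<^sup>+x. ennreal (?t x) + ennreal B * indicator {x. norm x > R} x \<partial>M k)"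
    proof (intro nn_integral_mono)
      fix x
      show "ennreal (\<theta> x) \<le> ennreal (?t x) + ennreal B * indicator {x. norm x > R} x"
      proof (cases "norm x \<le> R")
        case True
        then show ?thesis by (simp add: cutoff_eq_1)
      next
        case False
        have "ennreal (\<theta> x) \<le> ennreal B" by (rule ennreal_leI[OF \<theta>(3)])
        also have "\<dots> \<le> ennreal (?t x) + ennreal B" by simp
        finally show ?thesis using False by simp
      qed
    qed
    also have "\<dots> = (\<integral>\<^sup>+x. ennreal (?t x) \<partial>M k) + ennreal B * emeasure (M k) {x. norm x > R}"
      by (subst nn_integral_add) (simp_all add: nn_integral_cmult setsk)
    also have "\<dots> \<le> (\<integral>\<^sup>+x. ennreal (?t x) \<partial>M k) + ennreal B * ennreal (e / (B + 1))"
      by (intro add_left_mono mult_left_mono less_imp_le[OF R]) simp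
    also have "\<dots> \<le> (\<integral>\<^sup>+x. ennreal (?t x) \<partial>M k) + ennreal e"
      using B e by (intro add_left_mono) (simp add: ennreal_mult[symmetric] ennreal_leI field_simps)
    finally show ?thesis .
  qed
  then have "limsup (\<lambda>k. \<integral>\<^sup>+x. ennreal (\<theta> x) \<partial>M k) \<le> limsup (\<lambda>k. ennreal e + (\<integral>\<^sup>+x. ennreal (?t x) \<partial>M k))"
    by (intro Limsup_mono always_eventually allI) (simp add: add.commute)
  also have "\<dots> = ennreal e + (\<integral>\<^sup>+x. ennreal (?t x) \<partial>\<mu>)"
    by (subst Limsup_const_add) (simp_all add: lim_imp_Limsup[OF _ lim])
  also have "\<dots> \<le> ennreal e + (\<integral>\<^sup>+x. ennreal (\<theta> x) \<partial>\<mu>)"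
    using \<theta>(2) by (intro add_left_mono nn_integral_mono ennreal_leI mult_left_le cutoff_bounds)
  finally show "limsup (\<lambda>k. \<integral>\<^sup>+x. ennreal (\<theta> x) \<partial>M k) \<le> (\<integral>\<^sup>+x. ennreal (\<theta> x) \<partial>\<mu>) + ennreal e"
    by (simp add: add.commute)
qed

text \<open>The closed-set half of the portmanteau theorem, with a weight. Continuous functions of
  the distance to \<open>F\<close> dominate its indicator and converge to it; closedness gives
  positive distance to points outside \<open>F\<close>.\<close>

lemma limsup_integral_closed_le:
  fixes M :: "nat \<Rightarrow> 'a::euclidean_space measure" and \<theta> :: "'a \<Rightarrow> real"
  assumes radon_k: "\<And>k. radon_measure (M k)" and radon: "radon_measure \<mu>" and fin: "finite_measure \<mu>"
    and weak: "weakly_converges M \<mu>"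
    and tight: "\<And>\<epsilon>::real. \<epsilon> > 0 \<Longrightarrow> \<exists>R::real. \<forall>k. emeasure (M k) {x. norm x > R} < ennreal \<epsilon>"
    and \<theta>: "continuous_on UNIV \<theta>" "\<And>x. 0 \<le> \<theta> x" "\<And>x. \<theta> x \<le> B" and F: "closed F"
  shows "limsup (\<lambda>k. \<integral>\<^sup>+x. ennreal (\<theta> x) * indicator F x \<partial>M k) \<le> (\<integral>\<^sup>+x. ennreal (\<theta> x) * indicator F x \<partial>\<mu>)"
\<comment> \<open>The distance to the empty set is 0 by convention, which would make every
  \<open>h j\<close> constantly 1.\<close>
proof (cases "F = {}")
  case True
  then show ?thesis by (simp add: Limsup_const)
next
  case False
  interpret finite_measure \<mu> by fact
  have sets[measurable_cong]: "sets \<mu> = sets borel" using radon by (simp add: radon_measure_def)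
  have [measurable]: "F \<in> sets borel" using F by simp
  have [measurable]: "\<theta> \<in> borel_measurable borel" by (intro borel_measurable_continuous_onI \<theta>)
  define h where "h j x = max 0 (1 - real j * infdist x F)" for j x
  have ccont: "continuous_on UNIV (h j)" for j unfolding h_def by (intro continuous_intros)
  then have [measurable]: "h j \<in> borel_measurable borel" for j by (rule borel_measurable_continuous_onI)
  have c01: "0 \<le> h j x" "h j x \<le> 1" for j x by (auto simp: h_def infdist_nonneg)
  have cF: "h j x = 1" if "x \<in> F" for j x using that by (simp add: h_def)
  have clim: "(\<lambda>j. h j x) \<longlonglongrightarrow> indicator F x" for x
  proof (cases "x \<in> F")
    case True
    then show ?thesis by (simp add: cF)
  next
    case x: False
    then have "0 < infdist x F"
      using in_closed_iff_infdist_zero[OF F False] infdist_nonneg[of x F] by (simp add: less_le)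
    then obtain N :: nat where N: "1 / infdist x F < real N" using reals_Archimedean2 by blast
    have "\<forall>\<^sub>F j in sequentially. h j x = indicator F x"
      using eventually_ge_at_top[of N]
    proof eventually_elim
      case (elim j)
      then have "1 / infdist x F \<le> real j" using N by linarith
      then have "1 \<le> real j * infdist x F" using \<open>0 < infdist x F\<close> by (simp add: pos_divide_le_eq)
      then show ?case using x by (simp add: h_def)
    qed
    then show ?thesis by (rule tendsto_eventually)
  qed
  have le: "limsup (\<lambda>k. \<integral>\<^sup>+x. ennreal (\<theta> x) * indicator F x \<partial>M k) \<le> (\<integral>\<^sup>+x. ennreal (\<theta> x * h j x) \<partial>\<mu>)" for j
  proof -
    have "limsup (\<lambda>k. \<integral>\<^sup>+x. ennreal (\<theta> x) * indicator F x \<partial>M k) \<le> limsup (\<lambda>k. \<integral>\<^sup>+x. ennreal (\<theta> x * h j x) \<partial>M k)"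
      by (intro Limsup_mono always_eventually allI nn_integral_mono) (simp add: indicator_def cF)
    also have "\<dots> \<le> (\<integral>\<^sup>+x. ennreal (\<theta> x * h j x) \<partial>\<mu>)"
    proof (rule limsup_integral_continuous_le[OF radon_k radon weak tight])
      show "continuous_on UNIV (\<lambda>x. \<theta> x * h j x)" by (intro continuous_intros \<theta> ccont)
      show "0 \<le> \<theta> x * h j x" for x using \<theta> c01 by simp
      show "\<theta> x * h j x \<le> B" for x by (rule order_trans[OF mult_left_le[OF c01(2) \<theta>(2)] \<theta>(3)])
    qed
    finally show ?thesis .
  qed
  have "(\<lambda>j. \<integral>\<^sup>+x. ennreal (\<theta> x * h j x) \<partial>\<mu>) \<longlonglongrightarrow> (\<integral>\<^sup>+x. ennreal (\<theta> x * indicator F x) \<partial>\<mu>)"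
  proof (rule nn_integral_dominated_convergence[where w = "\<lambda>_. ennreal B"])
    show "AE x in \<mu>. ennreal (\<theta> x * h j x) \<le> ennreal B" for j
    proof (intro AE_I2 ennreal_leI)
      fix x show "\<theta> x * h j x \<le> B" by (rule order_trans[OF mult_left_le[OF c01(2) \<theta>(2)] \<theta>(3)])
    qed
    show "AE x in \<mu>. (\<lambda>j. ennreal (\<theta> x * h j x)) \<longlonglongrightarrow> ennreal (\<theta> x * indicator F x)"
      by (intro AE_I2 tendsto_ennrealI tendsto_mult tendsto_const clim)
    show "(\<integral>\<^sup>+x. ennreal B \<partial>\<mu>) < \<infinity>"
      by (simp add: emeasure_eq_measure ennreal_mult_less_top)
  qed measurable
  then have "limsup (\<lambda>k. \<integral>\<^sup>+x. ennreal (\<theta> x) * indicator F x \<partial>M k) \<le> (\<integral>\<^sup>+x. ennreal (\<theta> x * indicator F x) \<partial>\<mu>)"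
    by (rule LIMSEQ_le_const) (use le in blast)
  also have "\<dots> = (\<integral>\<^sup>+x. ennreal (\<theta> x) * indicator F x \<partial>\<mu>)"
    by (intro nn_integral_cong) (simp add: indicator_def)
  finally show ?thesis .
qed

section \<open>Slices of a finite measure\<close>

text \<open>Moving the measure to the Borel sets of the ambient space lets the approximation lemmas
  be applied without working in a subspace type.\<close>

definition perp_lborel :: "'a::euclidean_space \<Rightarrow> 'a measure" where
  "perp_lborel n = distr (subspace_lborel (perp n)) borel (\<lambda>y. y)"

text \<open>Composition with \<open>proj n\<close> extends the density from the hyperplane to a
  Borel function on the whole space without changing it on \<open>perp n\<close>.\<close>

definition slice_density :: "'a::euclidean_space \<Rightarrow> 'a measure \<Rightarrow> 'a \<Rightarrow> real" where
  "slice_density n M y = proj_density n M (proj n y)"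

text \<open>The value \<open>s = -\<infinity>\<close> stands for the term of \<open>S_point\<close> in which the whole line is charged.\<close>

definition tail_prob :: "'a::euclidean_space \<Rightarrow> 'a measure \<Rightarrow> ereal \<Rightarrow> 'a \<Rightarrow> real" where
  "tail_prob n M s y = measure (disintegration n M (proj n y)) {t. s \<le> ereal t}"

abbreviation slice_mass :: "'a::euclidean_space \<Rightarrow> 'a measure \<Rightarrow> ereal \<Rightarrow> 'a \<Rightarrow> real" where
  "slice_mass n M s y \<equiv> slice_density n M y * tail_prob n M s y"

definition halfspace_marginal :: "'a::euclidean_space \<Rightarrow> 'a measure \<Rightarrow> ereal \<Rightarrow> 'a measure" where
  "halfspace_marginal n M s = distr (density M (indicator {x. s \<le> ereal (x \<bullet> n)})) borel (proj n)"

definition base_weight :: "'a::euclidean_space \<Rightarrow> 'a measure \<Rightarrow> 'a \<Rightarrow> ennreal" where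
  "base_weight n \<nu> y = ennreal (exp_neg (\<integral>\<^sup>+s. RN_deriv lborel \<nu> (y + s *\<^sub>R n) \<partial>lborel))"

definition line_weight :: "'a::euclidean_space \<Rightarrow> 'a measure \<Rightarrow> 'a \<Rightarrow> real \<Rightarrow> ennreal" where
  "line_weight n \<nu> y s = RN_deriv lborel \<nu> (y + s *\<^sub>R n)
     * ennreal (exp_neg (\<integral>\<^sup>+t\<in>{s..}. RN_deriv lborel \<nu> (y + t *\<^sub>R n) \<partial>lborel))"

lemma measurable_id_restrict_space: "(\<lambda>y. y) \<in> restrict_space borel A \<rightarrow>\<^sub>M borel"
  by (rule measurable_restrict_space1) simp

lemma measurable_id_subspace_lborel: "(\<lambda>y. y) \<in> subspace_lborel V \<rightarrow>\<^sub>M borel"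
  unfolding measurable_cong_sets[OF sets_subspace_lborel refl] by (rule measurable_id_restrict_space)

lemma sets_perp_lborel[simp, measurable_cong]: "sets (perp_lborel n) = sets borel"
  by (simp add: perp_lborel_def)

lemma sets_proj_measure: "sets (proj_measure n M) = sets (restrict_space borel (perp n))"
  by (simp add: proj_measure_def)

lemma space_proj_measure: "space (proj_measure n M) = perp n"
  by (simp add: proj_measure_def space_restrict_space)

lemma measurable_id_proj_measure: "(\<lambda>y. y) \<in> proj_measure n M \<rightarrow>\<^sub>M borel"
  unfolding measurable_cong_sets[OF sets_proj_measure refl] by (rule measurable_id_restrict_space)

lemma nn_integral_perp_lborel:
  "f \<in> borel_measurable borel \<Longrightarrow> (\<integral>\<^sup>+y. f y \<partial>perp_lborel n) = (\<integral>\<^sup>+y. f y \<partial>subspace_lborel (perp n))"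
  unfolding perp_lborel_def by (rule nn_integral_distr[OF measurable_id_subspace_lborel]) simp

lemma emeasure_perp_lborel_cball: "emeasure (perp_lborel n) (cball 0 r) < \<infinity>"
proof -
  have "emeasure (perp_lborel n) (cball 0 r) = emeasure (subspace_lborel (perp n)) ((\<lambda>y. y) -` cball 0 r \<inter> space (subspace_lborel (perp n)))"
    unfolding perp_lborel_def by (rule emeasure_distr[OF measurable_id_subspace_lborel]) simp
  also have "(\<lambda>y. y) -` cball 0 r \<inter> space (subspace_lborel (perp n)) = perp n \<inter> cball 0 r" by auto
  also have "emeasure (subspace_lborel (perp n)) (perp n \<inter> cball 0 r) < \<infinity>"
    by (rule emeasure_subspace_lborel_cball[OF subspace_perp])
  finally show ?thesis .
qed

locale finite_borel_slice =
  fixes n :: "'a::euclidean_space" and M :: "'a measure"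
  assumes n: "norm n = 1" and setsM: "sets M = sets borel" and finM: "finite_measure M"
begin

lemma proj_measurable_M: "proj n \<in> M \<rightarrow>\<^sub>M restrict_space borel (perp n)"
  unfolding measurable_cong_sets[OF setsM refl] by (rule measurable_proj[OF n])

lemma spaceM: "space M = UNIV"
  using sets_eq_imp_space_eq[OF setsM] by simp

lemma finite_proj_measure: "finite_measure (proj_measure n M)"
  unfolding proj_measure_def by (rule finite_measure.finite_measure_distr[OF finM proj_measurable_M])

text \<open>This lemma and \<open>disint\<close> are all that is ever used about the two objects
  introduced by choice; each rests on an existence result.\<close>

lemma ac_part: "ac_part_density (subspace_lborel (perp n)) (proj_measure n M) (proj_density n M)"
proof -
  have "\<exists>\<Phi>. ac_part_density (subspace_lborel (perp n)) (proj_measure n M) \<Phi>"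
    by (rule exists_ac_part_density[OF sigma_finite_subspace_lborel[OF subspace_perp] finite_proj_measure])
       (simp add: sets_proj_measure)
  then show ?thesis unfolding proj_density_def by (rule someI_ex[of "ac_part_density (subspace_lborel (perp n)) (proj_measure n M)"])
qed

lemma disint: "is_disintegration n M (disintegration n M)"
  unfolding disintegration_def
  by (rule someI_ex[of "is_disintegration n M"]) (rule exists_is_disintegration[OF finM setsM n])

lemma proj_density_measurable: "proj_density n M \<in> borel_measurable (restrict_space borel (perp n))"
  using ac_part unfolding ac_part_density_def measurable_cong_sets[OF sets_subspace_lborel refl] by blast

lemma slice_density_measurable[measurable]: "slice_density n M \<in> borel_measurable borel"
  unfolding slice_density_def[abs_def]
  by (rule measurable_compose[OF measurable_proj[OF n] proj_density_measurable])

lemma slice_density_nonneg: "0 \<le> slice_density n M y"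
  using ac_part[unfolded ac_part_density_def, THEN conjunct2, THEN conjunct1, rule_format, of "proj n y"] proj_in_perp[OF n, of y]
  by (simp add: slice_density_def)

lemma kernel_measurable: "(\<lambda>y. disintegration n M (proj n y)) \<in> borel \<rightarrow>\<^sub>M prob_algebra borel"
proof (rule measurable_compose[OF measurable_proj[OF n]])
  show "disintegration n M \<in> restrict_space borel (perp n) \<rightarrow>\<^sub>M prob_algebra borel"
    using disint unfolding is_disintegration_def measurable_cong_sets[OF sets_proj_measure refl] by blast
qed

lemma kernel_prob: "prob_space (disintegration n M (proj n y))"
  and kernel_sets: "sets (disintegration n M (proj n y)) = sets borel"
  using measurable_space[OF kernel_measurable, of y] by (simp_all add: space_prob_algebra)

lemma tail_prob_measurable[measurable]: "tail_prob n M s \<in> borel_measurable borel"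
  unfolding tail_prob_def[abs_def]
  by (rule measurable_compose[OF kernel_measurable measurable_measure_prob_algebra]) measurable

lemma tail_prob_measurable_pair: "(\<lambda>(y, s). tail_prob n M (ereal s) y) \<in> borel_measurable (borel \<Otimes>\<^sub>M borel)"
proof -
  have K: "(\<lambda>p. disintegration n M (proj n (fst p))) \<in> borel \<Otimes>\<^sub>M (borel :: real measure) \<rightarrow>\<^sub>M prob_algebra borel"
    by (rule measurable_compose[OF measurable_fst kernel_measurable])
  have "{q \<in> space ((borel \<Otimes>\<^sub>M (borel :: real measure)) \<Otimes>\<^sub>M (borel :: real measure)). snd (fst q) \<le> snd q} \<in> sets ((borel \<Otimes>\<^sub>M borel) \<Otimes>\<^sub>M borel)"
    by measurable
  also have "{q \<in> space ((borel \<Otimes>\<^sub>M (borel :: real measure)) \<Otimes>\<^sub>M (borel :: real measure)). snd (fst q) \<le> snd q}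
      = Sigma (space (borel \<Otimes>\<^sub>M borel)) (\<lambda>p :: 'a \<times> real. {t. ereal (snd p) \<le> ereal t})"
    by (auto simp: space_pair_measure)
  finally show ?thesis
    unfolding tail_prob_def case_prod_beta' by (rule measure_measurable_prob_algebra2[OF _ K])
qed

lemma tail_prob_bounds: "0 \<le> tail_prob n M s y" "tail_prob n M s y \<le> 1"
  using prob_space.prob_le_1[OF kernel_prob] by (auto simp: tail_prob_def)

lemma tail_prob_minus_infinity: "tail_prob n M (-\<infinity>) y = 1"
  using prob_space.prob_space[OF kernel_prob, of y] sets_eq_imp_space_eq[OF kernel_sets, of y]
  by (simp add: tail_prob_def)

lemma emeasure_halfspace_marginal:
  assumes [measurable]: "A \<in> sets borel"
  shows "emeasure (halfspace_marginal n M s) A = emeasure M {x. proj n x \<in> A \<and> s \<le> ereal (x \<bullet> n)}"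
proof -
  note [measurable_cong] = setsM
  have "emeasure (halfspace_marginal n M s) A
      = emeasure (density M (indicator {x. s \<le> ereal (x \<bullet> n)})) (proj n -` A \<inter> space (density M (indicator {x. s \<le> ereal (x \<bullet> n)})))"
    unfolding halfspace_marginal_def
  proof (rule emeasure_distr[OF _ assms])
    show "proj n \<in> density M (indicator {x. s \<le> ereal (x \<bullet> n)}) \<rightarrow>\<^sub>M borel"
      unfolding measurable_cong_sets[OF trans[OF sets_density setsM] refl] by (rule measurable_proj_borel)
  qed
  also have "\<dots> = (\<integral>\<^sup>+x. indicator {x. s \<le> ereal (x \<bullet> n)} x * indicator (proj n -` A) x \<partial>M)"
  proof (subst emeasure_density)
    have "proj n -` A \<in> sets borel" using measurable_sets[OF measurable_proj_borel assms, of n] by simp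
    then show "proj n -` A \<inter> space (density M (indicator {x. s \<le> ereal (x \<bullet> n)})) \<in> sets M"
      by (simp add: spaceM setsM)
    show "indicator {x. s \<le> ereal (x \<bullet> n)} \<in> borel_measurable M"
      by (rule borel_measurable_indicator) measurable
  qed (simp add: spaceM)
  also have "\<dots> = (\<integral>\<^sup>+x. indicator {x. proj n x \<in> A \<and> s \<le> ereal (x \<bullet> n)} x \<partial>M)"
    by (intro nn_integral_cong) (auto simp: indicator_def)
  also have "\<dots> = emeasure M {x. proj n x \<in> A \<and> s \<le> ereal (x \<bullet> n)}"
    by (rule nn_integral_indicator) measurable
  finally show ?thesis .
qed

text \<open>The disintegration is tested on the indicator of a half-space cut by a cylinder. On the
  line through \<open>y\<close> in \<open>perp n\<close> the projection is constantly
  \<open>y\<close> and the coordinate is \<open>t\<close>, so the inner integral is the indicator of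
  \<open>A\<close> times the tail probability.\<close>

lemma halfspace_marginal_eq_disintegration:
  assumes A[measurable]: "A \<in> sets borel"
  shows "emeasure (halfspace_marginal n M s) A = (\<integral>\<^sup>+y. indicator A y * ennreal (tail_prob n M s y) \<partial>proj_measure n M)"
proof -
  note measurable_id_subspace_lborel[measurable] measurable_id_proj_measure[measurable]
  interpret M: finite_measure M by (rule finM)
  interpret P: finite_measure "proj_measure n M" by (rule finite_proj_measure)
  note [measurable_cong] = setsM
  let ?Z = "{x. proj n x \<in> A \<and> s \<le> ereal (x \<bullet> n)}"
  let ?P = "proj_measure n M"
  have Z[measurable]: "?Z \<in> sets borel" by measurable
  have "integrable M (indicator ?Z :: 'a \<Rightarrow> real)"
    by (rule integrable_real_indicator) (simp_all add: setsM M.emeasure_eq_measure)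
  from disint[unfolded is_disintegration_def, THEN conjunct2, rule_format, OF this]
  have "(\<integral>x. indicat_real ?Z x \<partial>M) = (\<integral>y. (\<integral>t. indicat_real ?Z (y + t *\<^sub>R n) \<partial>disintegration n M y) \<partial>?P)" .
  also have "\<dots> = (\<integral>y. indicator A y * tail_prob n M s y \<partial>?P)"
  proof (intro Bochner_Integration.integral_cong refl)
    fix y assume "y \<in> space ?P"
    then have y: "y \<in> perp n" by (simp add: space_proj_measure)
    have pr: "proj n (y + t *\<^sub>R n) = y" "(y + t *\<^sub>R n) \<bullet> n = t" for t
      using y n by (simp_all add: mem_perp_iff proj_def inner_add_left dot_square_norm)
    have "(\<integral>t. indicat_real ?Z (y + t *\<^sub>R n) \<partial>disintegration n M y) = (\<integral>t. indicat_real A y * indicat_real {t. s \<le> ereal t} t \<partial>disintegration n M y)"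
      by (intro Bochner_Integration.integral_cong refl) (simp add: indicator_def pr)
    also have "\<dots> = indicator A y * tail_prob n M s y"
      using sets_eq_imp_space_eq[OF kernel_sets, of y] by (simp add: tail_prob_def proj_id[OF y])
    finally show "(\<integral>t. indicat_real ?Z (y + t *\<^sub>R n) \<partial>disintegration n M y) = indicator A y * tail_prob n M s y" .
  qed
  finally have eq: "measure M ?Z = (\<integral>y. indicator A y * tail_prob n M s y \<partial>?P)" by (simp add: spaceM)
  have b: "norm (indicator A y * tail_prob n M s y) \<le> 1" for y
    using tail_prob_bounds[of s y] by (simp add: indicator_def)
  have "integrable ?P (\<lambda>y. indicator A y * tail_prob n M s y)"
    by (rule P.integrable_const_bound[where B = 1]) (use b in auto)
  then have "ennreal (\<integral>y. indicator A y * tail_prob n M s y \<partial>?P) = (\<integral>\<^sup>+y. ennreal (indicator A y * tail_prob n M s y) \<partial>?P)"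
    by (rule nn_integral_eq_integral[symmetric]) (simp add: tail_prob_bounds)
  also have "\<dots> = (\<integral>\<^sup>+y. indicator A y * ennreal (tail_prob n M s y) \<partial>?P)"
    by (intro nn_integral_cong) (simp add: indicator_def)
  finally show ?thesis
    unfolding emeasure_halfspace_marginal[OF A] M.emeasure_eq_measure eq .
qed

lemma nn_integral_slice_density:
  assumes [measurable]: "f \<in> borel_measurable borel"
  shows "(\<integral>\<^sup>+y. ennreal (slice_density n M y) * f y \<partial>perp_lborel n)
    = (\<integral>\<^sup>+y. f y \<partial>density (subspace_lborel (perp n)) (\<lambda>y. ennreal (proj_density n M y)))"
proof -
  note measurable_id_subspace_lborel[measurable] measurable_id_proj_measure[measurable]
  have [measurable]: "proj_density n M \<in> borel_measurable (subspace_lborel (perp n))"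
    unfolding measurable_cong_sets[OF sets_subspace_lborel refl] by (rule proj_density_measurable)
  have "(\<integral>\<^sup>+y. ennreal (slice_density n M y) * f y \<partial>perp_lborel n) = (\<integral>\<^sup>+y. ennreal (slice_density n M y) * f y \<partial>subspace_lborel (perp n))"
    by (rule nn_integral_perp_lborel) measurable
  also have "\<dots> = (\<integral>\<^sup>+y. ennreal (proj_density n M y) * f y \<partial>subspace_lborel (perp n))"
    by (intro nn_integral_cong) (simp add: slice_density_def proj_id)
  also have "\<dots> = (\<integral>\<^sup>+y. f y \<partial>density (subspace_lborel (perp n)) (\<lambda>y. ennreal (proj_density n M y)))"
    by (rule nn_integral_density[symmetric]) measurable
  finally show ?thesis .
qed

lemma set_integral_slice:
  assumes [measurable]: "A \<in> sets borel"
  shows "(\<integral>\<^sup>+y\<in>A. ennreal (slice_mass n M s y) \<partial>perp_lborel n)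
    = (\<integral>\<^sup>+y. indicator A y * ennreal (tail_prob n M s y) \<partial>density (subspace_lborel (perp n)) (\<lambda>y. ennreal (proj_density n M y)))"
proof -
  have "(\<integral>\<^sup>+y\<in>A. ennreal (slice_mass n M s y) \<partial>perp_lborel n)
    = (\<integral>\<^sup>+y. ennreal (slice_density n M y) * (indicator A y * ennreal (tail_prob n M s y)) \<partial>perp_lborel n)"
    by (intro nn_integral_cong) (simp add: ennreal_mult slice_density_nonneg tail_prob_bounds mult_ac)
  also have "\<dots> = (\<integral>\<^sup>+y. indicator A y * ennreal (tail_prob n M s y) \<partial>density (subspace_lborel (perp n)) (\<lambda>y. ennreal (proj_density n M y)))"
    by (rule nn_integral_slice_density) measurable
  finally show ?thesis .
qed

text \<open>The absolutely continuous part of the projected measure lies below the measure;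
  integrating the same tail probability against both preserves the order.\<close>

lemma set_integral_slice_le:
  assumes A: "A \<in> sets borel"
  shows "(\<integral>\<^sup>+y\<in>A. ennreal (slice_mass n M s y) \<partial>perp_lborel n) \<le> emeasure (halfspace_marginal n M s) A"
  unfolding set_integral_slice[OF A] halfspace_marginal_eq_disintegration[OF A]
proof (rule nn_integral_mono_measure)
  let ?L = "subspace_lborel (perp n)"
  have se: "sets (density ?L (\<lambda>y. ennreal (proj_density n M y))) = sets (proj_measure n M)"
    by (simp add: sets_proj_measure)
  then show "sets (density ?L (\<lambda>y. ennreal (proj_density n M y))) = sets (proj_measure n M)" .
  from ac_part obtain Ms where "\<forall>A\<in>sets ?L. emeasure (proj_measure n M) A = emeasure (density ?L (\<lambda>y. ennreal (proj_density n M y))) A + emeasure Ms A"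
    unfolding ac_part_density_def by blast
  then show "density ?L (\<lambda>y. ennreal (proj_density n M y)) \<le> proj_measure n M"
    unfolding le_measure[OF se] by simp
qed

text \<open>One null set works for all \<open>s\<close>: it carries the singular part of the full
  projection, and every half-space marginal has a density at most 1 with respect to that
  projection.\<close>

lemma set_integral_slice_eq:
  "\<exists>N\<in>null_sets (perp_lborel n). \<forall>s. \<forall>A\<in>sets borel. A \<inter> N = {} \<longrightarrow>
    emeasure (halfspace_marginal n M s) A = (\<integral>\<^sup>+y\<in>A. ennreal (slice_mass n M s y) \<partial>perp_lborel n)"
proof -
  note measurable_id_subspace_lborel[measurable] measurable_id_proj_measure[measurable]
  let ?L = "subspace_lborel (perp n)" and ?P = "proj_measure n M"
  let ?D = "density ?L (\<lambda>y. ennreal (proj_density n M y))"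
  from ac_part obtain Ms N where Ms: "sets Ms = sets ?L" and N: "N \<in> null_sets ?L" and Ms0: "emeasure Ms (space ?L - N) = 0"
    and dec: "\<forall>A\<in>sets ?L. emeasure ?P A = emeasure ?D A + emeasure Ms A"
    unfolding ac_part_density_def by blast
  have [measurable]: "N \<in> sets ?L" "N \<in> sets ?P" using N by (auto simp: sets_proj_measure)
  have pm[measurable]: "proj_density n M \<in> borel_measurable ?L"
    unfolding measurable_cong_sets[OF sets_subspace_lborel refl] by (rule proj_density_measurable)
  have cm: "space ?L - N \<in> sets ?P" "space ?L - N \<in> sets Ms"
    using sets.compl_sets[OF \<open>N \<in> sets ?L\<close>] by (simp_all only: Ms sets_proj_measure sets_subspace_lborel)
  have Nb: "N \<in> null_sets (perp_lborel n)"
  proof -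
    have "perp n \<in> sets borel" using closed_subspace[OF subspace_perp[of n]] by simp
    moreover have NR: "N \<in> sets (restrict_space borel (perp n))"
      using \<open>N \<in> sets ?L\<close> by (simp only: sets_subspace_lborel)
    ultimately have b: "N \<in> sets borel" by (auto simp: sets_restrict_space)
    have "N \<subseteq> perp n" using sets.sets_into_space[OF \<open>N \<in> sets ?L\<close>] by simp
    then have "(\<lambda>y. y) -` N \<inter> space ?L = N" by auto
    moreover have "emeasure (perp_lborel n) N = emeasure ?L ((\<lambda>y. y) -` N \<inter> space ?L)"
      unfolding perp_lborel_def by (rule emeasure_distr[OF measurable_id_subspace_lborel b])
    ultimately show ?thesis using N b by (simp add: null_sets_def)
  qed
  \<comment> \<open>Removing \<open>N\<close> from the projected measure leaves exactly its
    absolutely continuous part: the singular part has no mass off \<open>N\<close>, and the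
    absolutely continuous one has none on it.\<close>
  have D: "density ?P (indicator (space ?L - N)) = ?D"
  proof (rule measure_eqI)
    show "sets (density ?P (indicator (space ?L - N))) = sets ?D" by (simp add: sets_proj_measure)
    fix B assume "B \<in> sets (density ?P (indicator (space ?L - N)))"
    then have B[measurable]: "B \<in> sets ?P" "B \<in> sets ?L" by (simp_all add: sets_proj_measure)
    have sub: "B \<subseteq> space ?L" using sets.sets_into_space[OF B(2)] .
    have "emeasure (density ?P (indicator (space ?L - N))) B = (\<integral>\<^sup>+y. indicator (space ?L - N) y * indicator B y \<partial>?P)"
      by (rule emeasure_density[OF borel_measurable_indicator[OF cm(1)] B(1)])
    also have "\<dots> = (\<integral>\<^sup>+y. indicator (B - N) y \<partial>?P)"
      using sub by (intro nn_integral_cong) (auto simp: indicator_def)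
    also have "\<dots> = emeasure ?P (B - N)" by (rule nn_integral_indicator) measurable
    also have "\<dots> = emeasure ?D (B - N) + emeasure Ms (B - N)"
      by (rule dec[rule_format]) (rule sets.Diff[OF B(2) \<open>N \<in> sets ?L\<close>])
    also have "emeasure Ms (B - N) = 0"
    proof -
      have "emeasure Ms (B - N) \<le> emeasure Ms (space ?L - N)"
        by (intro emeasure_mono cm Diff_mono sub order_refl)
      then show ?thesis using Ms0 by simp
    qed
    also have "emeasure ?D (B - N) = emeasure ?D B"
    proof -
      have "(\<lambda>y. ennreal (proj_density n M y)) \<in> borel_measurable ?L" by measurable
      from subsetD[OF absolutely_continuousI_density[OF this, unfolded absolutely_continuous_def] N]
      show ?thesis using B(2) by (intro emeasure_Diff_null_set) simp_all
    qed
    finally show "emeasure (density ?P (indicator (space ?L - N))) B = emeasure ?D B" by simp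
  qed
  show ?thesis
  proof (intro bexI[OF _ Nb] allI ballI impI)
    fix s and A :: "'a set" assume A[measurable]: "A \<in> sets borel" and AN: "A \<inter> N = {}"
    have "emeasure (halfspace_marginal n M s) A = (\<integral>\<^sup>+y. indicator A y * ennreal (tail_prob n M s y) \<partial>?P)"
      by (rule halfspace_marginal_eq_disintegration[OF A])
    also have "\<dots> = (\<integral>\<^sup>+y. indicator (space ?L - N) y * (indicator A y * ennreal (tail_prob n M s y)) \<partial>?P)"
      using AN by (intro nn_integral_cong) (auto simp: indicator_def space_proj_measure)
    also have "\<dots> = (\<integral>\<^sup>+y. indicator A y * ennreal (tail_prob n M s y) \<partial>density ?P (indicator (space ?L - N)))"
    proof (rule nn_integral_density[symmetric])
      show "indicator (space ?L - N) \<in> borel_measurable ?P"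
        by (rule borel_measurable_indicator[OF cm(1)])
      show "(\<lambda>y. indicator A y * ennreal (tail_prob n M s y)) \<in> borel_measurable ?P" by measurable
    qed
    finally show "emeasure (halfspace_marginal n M s) A = (\<integral>\<^sup>+y\<in>A. ennreal (slice_mass n M s y) \<partial>perp_lborel n)"
      unfolding D set_integral_slice[OF A] .
  qed
qed

end

section \<open>Upper semicontinuity\<close>

definition charged_part :: "'a::euclidean_space \<Rightarrow> 'a measure \<Rightarrow> 'a measure \<Rightarrow> 'a \<Rightarrow> ennreal" where
  "charged_part n M \<nu> y = base_weight n \<nu> y * ennreal (1 - exp (- (slice_mass n M (-\<infinity>) y)))
     + (\<integral>\<^sup>+s. line_weight n \<nu> y s * ennreal (1 - exp (- (slice_mass n M (ereal s) y))) \<partial>lborel)"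

text \<open>The truncated subtraction loses nothing, by \<open>total_weight_le_1\<close>. No measure
  \<open>M\<close> enters, so this summand is common to all terms of the sequence and to the
  limit.\<close>

definition weight_defect :: "'a::euclidean_space \<Rightarrow> 'a measure \<Rightarrow> 'a \<Rightarrow> ennreal" where
  "weight_defect n \<nu> y = 1 - (base_weight n \<nu> y + (\<integral>\<^sup>+s. line_weight n \<nu> y s \<partial>lborel))"

lemma RN_deriv_line_measurable[measurable]:
  "(\<lambda>p. RN_deriv lborel \<nu> (fst p + snd p *\<^sub>R n)) \<in> borel_measurable (borel \<Otimes>\<^sub>M (borel :: real measure))"
proof -
  have [measurable]: "RN_deriv lborel \<nu> \<in> borel_measurable borel"
    using borel_measurable_RN_deriv[of lborel \<nu>] by simp
  show ?thesis by measurable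
qed

lemma RN_deriv_line_measurable1[measurable]:
  "(\<lambda>s. RN_deriv lborel \<nu> (y + s *\<^sub>R n)) \<in> borel_measurable borel"
proof -
  have [measurable]: "RN_deriv lborel \<nu> \<in> borel_measurable borel"
    using borel_measurable_RN_deriv[of lborel \<nu>] by simp
  show ?thesis by measurable
qed

lemma base_weight_measurable[measurable]: "base_weight n \<nu> \<in> borel_measurable borel"
proof -
  have "(\<lambda>y. \<integral>\<^sup>+s. RN_deriv lborel \<nu> (y + s *\<^sub>R n) \<partial>lborel) \<in> borel_measurable borel"
    by (rule lborel.borel_measurable_nn_integral) (use RN_deriv_line_measurable[of \<nu> n] in \<open>simp add: case_prod_beta'\<close>)
  then show ?thesis unfolding base_weight_def[abs_def] by measurable
qed

lemma line_weight_measurable[measurable]: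
  "(\<lambda>p. line_weight n \<nu> (fst p) (snd p)) \<in> borel_measurable (borel \<Otimes>\<^sub>M borel)"
proof -
  have [measurable]: "RN_deriv lborel \<nu> \<in> borel_measurable borel"
    using borel_measurable_RN_deriv[of lborel \<nu>] by simp
  have "(\<lambda>q. RN_deriv lborel \<nu> (fst (fst q) + snd q *\<^sub>R n) * indicator {q. snd (fst q) \<le> snd q} q)
      \<in> borel_measurable ((borel \<Otimes>\<^sub>M (borel :: real measure)) \<Otimes>\<^sub>M lborel)"
    by measurable
  then have "(\<lambda>p. \<integral>\<^sup>+t. RN_deriv lborel \<nu> (fst p + t *\<^sub>R n) * indicator {q. snd (fst q) \<le> snd q} (p, t) \<partial>lborel)
      \<in> borel_measurable (borel \<Otimes>\<^sub>M (borel :: real measure))"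
    by (intro lborel.borel_measurable_nn_integral) (simp add: case_prod_beta')
  moreover have "indicator {q. snd (fst q) \<le> snd q} (p, t) = (indicator {snd p..} t :: ennreal)" for p :: "'a \<times> real" and t
    by (simp add: indicator_def)
  ultimately have "(\<lambda>p. \<integral>\<^sup>+t\<in>{snd p..}. RN_deriv lborel \<nu> (fst p + t *\<^sub>R n) \<partial>lborel) \<in> borel_measurable (borel \<Otimes>\<^sub>M (borel :: real measure))"
    by simp
  then show ?thesis unfolding line_weight_def by measurable
qed

lemma line_weight_measurable1[measurable]: "line_weight n \<nu> y \<in> borel_measurable borel"
  using measurable_compose[OF measurable_Pair1' line_weight_measurable[of n \<nu>], of y] by simp

lemma line_weight_measurable2[measurable]: "(\<lambda>y. line_weight n \<nu> y s) \<in> borel_measurable borel"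
  using measurable_compose[OF measurable_Pair2' line_weight_measurable[of n \<nu>], of s] by simp

lemma line_weight_integral_measurable[measurable]:
  "(\<lambda>y. \<integral>\<^sup>+s. line_weight n \<nu> y s \<partial>lborel) \<in> borel_measurable borel"
  by (rule lborel.borel_measurable_nn_integral) (use line_weight_measurable[of n \<nu>] in \<open>simp add: case_prod_beta'\<close>)

lemma weight_defect_measurable[measurable]: "weight_defect n \<nu> \<in> borel_measurable borel"
  unfolding weight_defect_def[abs_def] by measurable

lemma total_weight_le_1: "base_weight n \<nu> y + (\<integral>\<^sup>+s. line_weight n \<nu> y s \<partial>lborel) \<le> 1"
  unfolding base_weight_def line_weight_def by (rule exp_neg_total_mass_le_1) measurable

section \<open>Splitting \<open>S_point\<close> into weight defect and charged part\<close>

context finite_borel_slice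
begin

lemma charged_integrand_measurable[measurable]:
  "(\<lambda>p. line_weight n \<nu> (fst p) (snd p) * ennreal (1 - exp (- (slice_density n M (fst p) * tail_prob n M (ereal (snd p)) (fst p)))))
    \<in> borel_measurable (borel \<Otimes>\<^sub>M borel)"
proof -
  have [measurable]: "(\<lambda>p. tail_prob n M (ereal (snd p)) (fst p)) \<in> borel_measurable (borel \<Otimes>\<^sub>M borel)"
    using tail_prob_measurable_pair by (simp add: case_prod_beta')
  show ?thesis by measurable
qed

lemma tail_prob_measurable1: "(\<lambda>s. tail_prob n M (ereal s) y) \<in> borel_measurable borel"
  using measurable_compose[OF measurable_Pair1' tail_prob_measurable_pair, of y] by simp

lemma charged_part_measurable[measurable]: "charged_part n M \<nu> \<in> borel_measurable borel"
proof -
  have "(\<lambda>y. \<integral>\<^sup>+s. line_weight n \<nu> y s * ennreal (1 - exp (- (slice_mass n M (ereal s) y))) \<partial>lborel) \<in> borel_measurable borel"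
    by (rule lborel.borel_measurable_nn_integral) (use charged_integrand_measurable[of \<nu>] in \<open>simp add: case_prod_beta'\<close>)
  then show ?thesis unfolding charged_part_def[abs_def] by measurable
qed

lemma one_minus_exp_le_density: "1 - exp (- (slice_mass n M s y)) \<le> slice_density n M y"
proof -
  have "1 - exp (- (slice_mass n M s y)) \<le> slice_mass n M s y"
    using exp_ge_add_one_self[of "- (slice_mass n M s y)"] by linarith
  also have "\<dots> \<le> slice_density n M y" by (intro mult_left_le tail_prob_bounds slice_density_nonneg)
  finally show ?thesis .
qed

text \<open>From \<open>1 - exp (- m) \<le> m\<close> and total weight at most 1. It controls the
  charged part outside a ball by the mass of the measure there, and over the hyperplane by the full
  mass.\<close>

lemma charged_part_le: "charged_part n M \<nu> y \<le> ennreal (slice_density n M y)"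
proof -
  let ?d = "ennreal (slice_density n M y)"
  have "charged_part n M \<nu> y \<le> base_weight n \<nu> y * ?d + (\<integral>\<^sup>+s. line_weight n \<nu> y s * ?d \<partial>lborel)"
    unfolding charged_part_def
    by (intro add_mono nn_integral_mono mult_left_mono ennreal_leI one_minus_exp_le_density) simp_all
  also have "\<dots> = (base_weight n \<nu> y + (\<integral>\<^sup>+s. line_weight n \<nu> y s \<partial>lborel)) * ?d"
    by (subst nn_integral_multc) (simp_all add: distrib_right)
  also have "\<dots> \<le> 1 * ?d" by (intro mult_right_mono total_weight_le_1) simp
  finally show ?thesis by simp
qed

text \<open>With \<open>b\<close> the atom, \<open>W\<close> the line mass and \<open>I\<close> the
  subtracted integral, this is the identity \<open>1 - exp (- \<Phi>) * b - I = (1 - b - W) + b * (1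
  - exp (- \<Phi>)) + (W - I)\<close>. All terms are finite since \<open>b + W \<le> 1\<close>, so
  it may be computed in the reals.\<close>

lemma ennreal_S_point:
  assumes y: "y \<in> perp n"
  shows "ennreal (S_point n M \<nu> y) = weight_defect n \<nu> y + charged_part n M \<nu> y"
proof -
  define \<Phi> where "\<Phi> = slice_density n M y"
  define \<kappa> where "\<kappa> s = tail_prob n M (ereal s) y" for s
  have [measurable]: "\<kappa> \<in> borel_measurable borel" unfolding \<kappa>_def by (rule tail_prob_measurable1)
  have \<Phi>0: "0 \<le> \<Phi>" unfolding \<Phi>_def by (rule slice_density_nonneg)
  have \<kappa>0: "0 \<le> \<kappa> s" for s unfolding \<kappa>_def by (rule tail_prob_bounds)
  let ?w = "line_weight n \<nu> y"
  define b where "b = exp_neg (\<integral>\<^sup>+s. RN_deriv lborel \<nu> (y + s *\<^sub>R n) \<partial>lborel)"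
  have b: "base_weight n \<nu> y = ennreal b" "0 \<le> b" by (simp_all add: b_def base_weight_def exp_neg_bounds)
  define I where "I = (\<integral>\<^sup>+s. ?w s * ennreal (exp (- (\<Phi> * \<kappa> s))) \<partial>lborel)"
  define J where "J = (\<integral>\<^sup>+s. ?w s * ennreal (1 - exp (- (\<Phi> * \<kappa> s))) \<partial>lborel)"
  define W where "W = (\<integral>\<^sup>+s. ?w s \<partial>lborel)"
  have "I + J = (\<integral>\<^sup>+s. ?w s * ennreal (exp (- (\<Phi> * \<kappa> s))) + ?w s * ennreal (1 - exp (- (\<Phi> * \<kappa> s))) \<partial>lborel)"
    unfolding I_def J_def by (rule nn_integral_add[symmetric]) measurable
  also have "\<dots> = W"
    unfolding W_def
  proof (intro nn_integral_cong)
    fix s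
    have "0 \<le> \<Phi> * \<kappa> s" using \<Phi>0 \<kappa>0 by simp
    then have "ennreal (exp (- (\<Phi> * \<kappa> s))) + ennreal (1 - exp (- (\<Phi> * \<kappa> s))) = 1"
      by (subst ennreal_plus[symmetric]) simp_all
    then show "?w s * ennreal (exp (- (\<Phi> * \<kappa> s))) + ?w s * ennreal (1 - exp (- (\<Phi> * \<kappa> s))) = ?w s"
      by (simp add: distrib_left[symmetric])
  qed
  finally have IJ: "I + J = W" .
  have tot: "ennreal b + W \<le> 1" using total_weight_le_1[of n \<nu> y] unfolding b W_def .
  have "W \<le> ennreal b + W" by simp
  then have "W \<le> 1" using tot by (rule order_trans)
  then have Wfin: "W < \<infinity>" by (rule le_less_trans) simp
  have "I \<le> W" "J \<le> W" unfolding IJ[symmetric] by simp_all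
  then have fin: "I < \<infinity>" "J < \<infinity>" using Wfin by (blast intro: le_less_trans)+
  define i j where "i = enn2real I" and "j = enn2real J"
  have ij: "I = ennreal i" "J = ennreal j" "0 \<le> i" "0 \<le> j" using fin by (simp_all add: i_def j_def)
  have W: "W = ennreal (i + j)" using IJ ij by simp
  have tot': "b + (i + j) \<le> 1"
    using tot ij b by (simp add: W ennreal_plus[symmetric] del: ennreal_plus)
  have Seq: "S_point n M \<nu> y = 1 - exp (- \<Phi>) * b - i"
  proof -
    have "\<kappa> s = measure (disintegration n M y) {s..}" for s
    proof -
      have "{t. ereal s \<le> ereal t} = {s..}" by auto
      then show ?thesis by (simp add: \<kappa>_def tail_prob_def proj_id[OF y])
    qed
    moreover have "\<Phi> = proj_density n M y" by (simp add: \<Phi>_def slice_density_def proj_id[OF y])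
    ultimately show ?thesis
      unfolding S_point_def Let_def i_def I_def b_def line_weight_def by (simp add: minus_mult_left[symmetric])
  qed
  have "weight_defect n \<nu> y = ennreal 1 - ennreal (b + (i + j))"
    using ij b by (simp add: weight_defect_def b(1) W_def[symmetric] W)
  also have "\<dots> = ennreal (1 - (b + (i + j)))" using ij b by (intro ennreal_minus) simp
  finally have D: "weight_defect n \<nu> y = ennreal (1 - (b + (i + j)))" .
  have "charged_part n M \<nu> y = ennreal b * ennreal (1 - exp (- \<Phi>)) + ennreal j"
    unfolding charged_part_def tail_prob_minus_infinity
    by (simp add: b \<Phi>_def[symmetric] \<kappa>_def[symmetric] J_def[symmetric] ij)
  also have "\<dots> = ennreal (b * (1 - exp (- \<Phi>)) + j)"
    using b ij \<Phi>0 by (simp add: ennreal_mult)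
  finally have "weight_defect n \<nu> y + charged_part n M \<nu> y = ennreal (1 - (b + (i + j))) + ennreal (b * (1 - exp (- \<Phi>)) + j)"
    by (simp add: D)
  also have "\<dots> = ennreal (1 - (b + (i + j)) + (b * (1 - exp (- \<Phi>)) + j))"
    using tot' b ij \<Phi>0 by (intro ennreal_plus[symmetric]) auto
  also have "1 - (b + (i + j)) + (b * (1 - exp (- \<Phi>)) + j) = S_point n M \<nu> y"
    unfolding Seq by (simp add: algebra_simps)
  finally show ?thesis ..
qed

lemma S_dir_eq:
  "S_dir n M \<nu> = (\<integral>\<^sup>+y. weight_defect n \<nu> y \<partial>perp_lborel n) + (\<integral>\<^sup>+y. charged_part n M \<nu> y \<partial>perp_lborel n)"
proof -
  have "S_dir n M \<nu> = (\<integral>\<^sup>+y. weight_defect n \<nu> y + charged_part n M \<nu> y \<partial>subspace_lborel (perp n))"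
    unfolding S_dir_def by (intro nn_integral_cong) (simp add: ennreal_S_point)
  also have "\<dots> = (\<integral>\<^sup>+y. weight_defect n \<nu> y + charged_part n M \<nu> y \<partial>perp_lborel n)"
    by (rule nn_integral_perp_lborel[symmetric]) measurable
  also have "\<dots> = (\<integral>\<^sup>+y. weight_defect n \<nu> y \<partial>perp_lborel n) + (\<integral>\<^sup>+y. charged_part n M \<nu> y \<partial>perp_lborel n)"
    by (rule nn_integral_add) measurable
  finally show ?thesis .
qed

lemma set_integral_slice_density_le:
  assumes "A \<in> sets borel"
  shows "(\<integral>\<^sup>+y\<in>A. ennreal (slice_density n M y) \<partial>perp_lborel n) \<le> emeasure M {x. proj n x \<in> A}"
  using set_integral_slice_le[OF assms, of "-\<infinity>"] emeasure_halfspace_marginal[OF assms, of "-\<infinity>"]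
  by (simp add: tail_prob_minus_infinity)

lemma integral_charged_part_le: "(\<integral>\<^sup>+y. charged_part n M \<nu> y \<partial>perp_lborel n) \<le> emeasure M UNIV"
proof -
  have "(\<integral>\<^sup>+y. charged_part n M \<nu> y \<partial>perp_lborel n) \<le> (\<integral>\<^sup>+y\<in>UNIV. ennreal (slice_density n M y) \<partial>perp_lborel n)"
    by (intro nn_integral_mono) (simp add: charged_part_le)
  also have "\<dots> \<le> emeasure M UNIV" using set_integral_slice_density_le[of UNIV] by simp
  finally show ?thesis .
qed

end

text \<open>For fixed \<open>s\<close> the earlier estimate applies to the half-space marginals;
  Fubini and reverse Fatou then integrate over \<open>s\<close>. The hyperplane has to be cut to a
  ball first, because the weights need not be integrable over all of it.\<close>

lemma limsup_integral_charged_part_le: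
  fixes M :: "nat \<Rightarrow> 'a::euclidean_space measure" and n :: 'a
  assumes n: "norm n = 1"
    and radon_k: "\<And>k. radon_measure (M k)" and fin_k: "\<And>k. finite_measure (M k)"
    and radon: "radon_measure \<mu>" and fin: "finite_measure \<mu>"
    and weak: "weakly_converges M \<mu>"
    and tight: "\<And>\<epsilon>::real. \<epsilon> > 0 \<Longrightarrow> \<exists>R::real. \<forall>k. emeasure (M k) {x. norm x > R} < ennreal \<epsilon>"
  shows "limsup (\<lambda>k. \<integral>\<^sup>+y. charged_part n (M k) \<nu> y \<partial>perp_lborel n) \<le> (\<integral>\<^sup>+y. charged_part n \<mu> \<nu> y \<partial>perp_lborel n)"
proof (rule limsup_le_epsilon)
  fix e :: real assume "0 < e"
  from tight[OF this] obtain R where R: "\<And>k. emeasure (M k) {x. norm x > R} < ennreal e" by blast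
  have sk: "finite_borel_slice n (M k)" for k
    using n radon_k[of k] fin_k by (intro finite_borel_slice.intro) (simp_all add: radon_measure_def)
  interpret m: finite_borel_slice n \<mu>
    using n radon fin by (intro finite_borel_slice.intro) (simp_all add: radon_measure_def)
  note [measurable] = finite_borel_slice.slice_density_measurable[OF sk] finite_borel_slice.tail_prob_measurable[OF sk]
    finite_borel_slice.charged_part_measurable[OF sk] finite_borel_slice.charged_integrand_measurable[OF sk]
  have [measurable]: "cball 0 R \<in> sets (borel :: 'a measure)" by simp
  \<comment> \<open>The radius comes from tightness, so that the discarded region carries mass below
    \<open>e\<close> for every \<open>k\<close>; on the ball the hyperplane measure is
    finite.\<close>
  define L where "L = density (perp_lborel n) (indicator (cball 0 R))"
  have setsL[simp, measurable_cong]: "sets L = sets borel" by (simp add: L_def)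
  have spL: "space L = UNIV" using sets_eq_imp_space_eq[OF setsL] by simp
  have intL: "(\<integral>\<^sup>+y. f y \<partial>L) = (\<integral>\<^sup>+y\<in>cball 0 R. f y \<partial>perp_lborel n)" if [measurable]: "f \<in> borel_measurable borel" for f
  proof -
    have "(\<integral>\<^sup>+y. f y \<partial>L) = (\<integral>\<^sup>+y. indicator (cball 0 R) y * f y \<partial>perp_lborel n)"
      unfolding L_def by (rule nn_integral_density) measurable
    then show ?thesis by (simp add: mult.commute)
  qed
  have massL: "emeasure L UNIV < \<infinity>"
    using emeasure_perp_lborel_cball[of n R] intL[of "\<lambda>_. 1"] by (simp add: spL)
  then have finL: "finite_measure L" by (intro finite_measureI) (simp add: spL)
  interpret L: finite_measure L by (rule finL)
  interpret pair_sigma_finite L lborel by (intro pair_sigma_finite.intro L.sigma_finite_measure_axioms lborel.sigma_finite_measure_axioms)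
  let ?f = "\<lambda>M s y. ennreal (1 - exp (- (slice_mass n M s y)))"
  let ?U = "\<lambda>k. \<integral>\<^sup>+y. charged_part n (M k) \<nu> y \<partial>perp_lborel n" and ?V = "\<lambda>k. \<integral>\<^sup>+y. charged_part n (M k) \<nu> y \<partial>L"
  let ?W = "\<lambda>M' s. \<integral>\<^sup>+y. line_weight n \<nu> y s * ?f M' (ereal s) y \<partial>L"
  let ?base = "\<lambda>s. \<integral>\<^sup>+y. line_weight n \<nu> y s \<partial>L"
  \<comment> \<open>\<open>s\<close> is an extended real: \<open>-\<infinity>\<close> covers the
    atom, with the whole space as half-space, and finite values cover the line weights.\<close>
  have key: "limsup (\<lambda>k. \<integral>\<^sup>+y. a y * ?f (M k) s y \<partial>L) \<le> (\<integral>\<^sup>+y. a y * ?f \<mu> s y \<partial>L)"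
    if a: "a \<in> borel_measurable borel" "(\<integral>\<^sup>+y. a y \<partial>L) < \<infinity>" for a :: "'a \<Rightarrow> ennreal" and s
  proof -
    from m.set_integral_slice_eq obtain N where N: "N \<in> null_sets (perp_lborel n)"
      and ac: "\<And>s A. A \<in> sets borel \<Longrightarrow> A \<inter> N = {} \<Longrightarrow>
        emeasure (halfspace_marginal n \<mu> s) A = (\<integral>\<^sup>+y\<in>A. ennreal (slice_mass n \<mu> s y) \<partial>perp_lborel n)"
      by blast
    have setsH: "sets (halfspace_marginal n M' s) = sets borel" for M' by (simp add: halfspace_marginal_def)
    have Nb[measurable]: "N \<in> sets borel" using null_setsD2[OF N] by simp
    have closedH: "closed {x. s \<le> ereal (x \<bullet> n)}"
      by (cases s) (auto intro!: closed_Collect_le continuous_intros simp: closed_UNIV)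
    have nnH: "(\<integral>\<^sup>+y. ennreal (\<theta> y) \<partial>halfspace_marginal n M' s)
        = (\<integral>\<^sup>+x. ennreal (\<theta> (proj n x)) * indicator {x. s \<le> ereal (x \<bullet> n)} x \<partial>M')"
      if [measurable_cong]: "sets M' = sets borel" and [measurable]: "\<theta> \<in> borel_measurable borel" for M' :: "'a measure" and \<theta> :: "'a \<Rightarrow> real"
    proof -
      have pm: "proj n \<in> density M' (indicator {x. s \<le> ereal (x \<bullet> n)}) \<rightarrow>\<^sub>M borel"
        unfolding measurable_cong_sets[OF trans[OF sets_density that(1)] refl] by (rule measurable_proj_borel)
      have im: "indicator {x. s \<le> ereal (x \<bullet> n)} \<in> borel_measurable M'"
        by (rule borel_measurable_indicator) (simp add: that(1) closedH)
      have "(\<integral>\<^sup>+y. ennreal (\<theta> y) \<partial>halfspace_marginal n M' s) = (\<integral>\<^sup>+x. ennreal (\<theta> (proj n x)) \<partial>density M' (indicator {x. s \<le> ereal (x \<bullet> n)}))"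
        unfolding halfspace_marginal_def by (rule nn_integral_distr[OF pm]) measurable
      also have "\<dots> = (\<integral>\<^sup>+x. indicator {x. s \<le> ereal (x \<bullet> n)} x * ennreal (\<theta> (proj n x)) \<partial>M')"
        by (rule nn_integral_density[OF im]) measurable
      finally show ?thesis by (simp add: mult.commute)
    qed
    have setsk: "sets (M k) = sets borel" for k using radon_k by (simp add: radon_measure_def)
    show ?thesis
    \<comment> \<open>The marginals are not cut to the ball although \<open>L\<close> is. The
      outside of the ball is null for \<open>L\<close>, so it is added to the exceptional set, as if
      the mass there were singular.\<close>
    proof (rule limsup_integral_one_minus_exp_le[where P = "halfspace_marginal n \<mu> s" and Pk = "\<lambda>k. halfspace_marginal n (M k) s" and N = "N \<union> - cball 0 R"])
      show "finite_measure (halfspace_marginal n \<mu> s)"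
      proof (rule finite_measureI)
        have "space (halfspace_marginal n \<mu> s) = UNIV" using sets_eq_imp_space_eq[OF setsH] by simp
        moreover have "emeasure (halfspace_marginal n \<mu> s) UNIV \<le> emeasure \<mu> UNIV"
          by (subst m.emeasure_halfspace_marginal) (auto intro: emeasure_mono simp: m.setsM)
        moreover have "emeasure \<mu> UNIV \<noteq> \<infinity>" using finite_measure.emeasure_finite[OF fin] by simp
        ultimately show "emeasure (halfspace_marginal n \<mu> s) (space (halfspace_marginal n \<mu> s)) \<noteq> \<infinity>"
          by (auto simp: top_unique)
      qed
      show "N \<union> - cball 0 R \<in> null_sets L"
      proof (rule null_setsI)
        have "AE y in perp_lborel n. indicator (cball 0 R) y * indicator (N \<union> - cball 0 R) y = (0::ennreal)"
          using AE_not_in[OF N] by (rule eventually_mono) (simp add: indicator_def)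
        then have "(\<integral>\<^sup>+y. indicator (cball 0 R) y * indicator (N \<union> - cball 0 R) y \<partial>perp_lborel n) = 0"
          by (subst nn_integral_0_iff_AE) simp_all
        then show "emeasure L (N \<union> - cball 0 R) = 0"
          unfolding L_def by (subst emeasure_density) simp_all
      qed simp
      fix A :: "'a set" assume A[measurable]: "A \<in> sets borel"
      have int: "(\<integral>\<^sup>+y\<in>A. ennreal (slice_mass n M' s y) \<partial>L)
          = (\<integral>\<^sup>+y\<in>A \<inter> cball 0 R. ennreal (slice_mass n M' s y) \<partial>perp_lborel n)"
        if "finite_borel_slice n M'" for M'
      proof -
        interpret s: finite_borel_slice n M' by (rule that)
        have "(\<integral>\<^sup>+y\<in>A. ennreal (slice_mass n M' s y) \<partial>L)
          = (\<integral>\<^sup>+y\<in>cball 0 R. ennreal (slice_mass n M' s y) * indicator A y \<partial>perp_lborel n)"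
          by (rule intL) measurable
        also have "\<dots> = (\<integral>\<^sup>+y\<in>A \<inter> cball 0 R. ennreal (slice_mass n M' s y) \<partial>perp_lborel n)"
          by (intro nn_integral_cong) (simp add: indicator_def)
        finally show ?thesis .
      qed
      show "(\<integral>\<^sup>+y\<in>A. ennreal (slice_mass n (M k) s y) \<partial>L) \<le> emeasure (halfspace_marginal n (M k) s) A" for k
      proof -
        have "(\<integral>\<^sup>+y\<in>A. ennreal (slice_mass n (M k) s y) \<partial>L)
          \<le> (\<integral>\<^sup>+y\<in>A. ennreal (slice_mass n (M k) s y) \<partial>perp_lborel n)"
          unfolding int[OF sk] by (intro nn_integral_mono) (simp add: indicator_def)
        also have "\<dots> \<le> emeasure (halfspace_marginal n (M k) s) A"
          by (rule finite_borel_slice.set_integral_slice_le[OF sk A])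
        finally show ?thesis .
      qed
      show "emeasure (halfspace_marginal n \<mu> s) A = (\<integral>\<^sup>+y\<in>A. ennreal (slice_mass n \<mu> s y) \<partial>L)"
        if dis: "A \<inter> (N \<union> - cball 0 R) = {}"
      proof -
        have "A \<inter> cball 0 R = A" "A \<inter> N = {}" using dis by blast+
        then show ?thesis unfolding int[OF m.finite_borel_slice_axioms] by (simp add: ac[OF A])
      qed
    next
      fix \<theta> :: "'a \<Rightarrow> real" assume \<theta>: "continuous_on UNIV \<theta>" "\<And>x. 0 \<le> \<theta> x" "bounded (range \<theta>)"
      have tm: "\<theta> \<in> borel_measurable borel" by (rule borel_measurable_continuous_onI[OF \<theta>(1)])
      from \<theta>(3) obtain B where B: "\<And>x. norm (\<theta> x) \<le> B" unfolding bounded_iff by blast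
      show "limsup (\<lambda>k. \<integral>\<^sup>+x. ennreal (\<theta> x) \<partial>halfspace_marginal n (M k) s) \<le> (\<integral>\<^sup>+x. ennreal (\<theta> x) \<partial>halfspace_marginal n \<mu> s)"
        unfolding nnH[OF setsk tm] nnH[OF m.setsM tm]
      proof (rule limsup_integral_closed_le[OF radon_k radon fin weak tight])
        show "continuous_on UNIV (\<lambda>x. \<theta> (proj n x))"
          by (rule continuous_on_compose2[OF \<theta>(1) continuous_on_proj]) simp
        show "\<theta> (proj n x) \<le> B" for x using B[of "proj n x"] by simp
      qed (use \<theta> closedH in auto)
    next
      show "(\<lambda>y. slice_mass n (M k) s y) \<in> borel_measurable borel" for k by measurable
      show "(\<lambda>y. slice_mass n \<mu> s y) \<in> borel_measurable borel" by measurable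
      show "0 \<le> slice_mass n \<mu> s y" for y
        by (intro mult_nonneg_nonneg m.slice_density_nonneg m.tail_prob_bounds)
      show "0 \<le> slice_mass n (M k) s y" for k y
        by (intro mult_nonneg_nonneg finite_borel_slice.slice_density_nonneg[OF sk] finite_borel_slice.tail_prob_bounds[OF sk])
    qed (use a in \<open>simp_all add: finL setsH\<close>)
  qed
  have w1: "(\<integral>\<^sup>+y. base_weight n \<nu> y \<partial>L) < \<infinity>"
  proof -
    have "(\<integral>\<^sup>+y. base_weight n \<nu> y \<partial>L) \<le> (\<integral>\<^sup>+y. 1 \<partial>L)"
    proof (rule nn_integral_mono)
      fix y show "base_weight n \<nu> y \<le> 1" by (rule order_trans[OF _ total_weight_le_1[of n \<nu> y]]) simp
    qed
    then show ?thesis using massL by (simp add: spL le_less_trans)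
  qed
  \<comment> \<open>After exchanging the integrals each line contributes at most 1, so the total is
    at most the finite mass of \<open>L\<close>. Hence the weight at level \<open>s\<close> is
    integrable for almost every \<open>s\<close>.\<close>
  have w2: "(\<integral>\<^sup>+s. ?base s \<partial>lborel) < \<infinity>"
  proof -
    have "(\<integral>\<^sup>+s. ?base s \<partial>lborel) = (\<integral>\<^sup>+y. (\<integral>\<^sup>+s. line_weight n \<nu> y s \<partial>lborel) \<partial>L)"
      by (rule Fubini') (use line_weight_measurable[of n \<nu>] in \<open>simp add: case_prod_beta' cong: measurable_cong_sets\<close>)
    also have "\<dots> \<le> (\<integral>\<^sup>+y. 1 \<partial>L)"
    proof (rule nn_integral_mono)
      fix y show "(\<integral>\<^sup>+s. line_weight n \<nu> y s \<partial>lborel) \<le> 1"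
        by (rule order_trans[OF _ total_weight_le_1[of n \<nu> y]]) simp
    qed
    finally show ?thesis using massL by (simp add: spL le_less_trans)
  qed
  have split: "(\<integral>\<^sup>+y. charged_part n M' \<nu> y \<partial>L) = (\<integral>\<^sup>+y. base_weight n \<nu> y * ?f M' (-\<infinity>) y \<partial>L)
      + (\<integral>\<^sup>+s. ?W M' s \<partial>lborel)" if "finite_borel_slice n M'" for M'
  proof -
    interpret s: finite_borel_slice n M' by (rule that)
    have pm: "(\<lambda>(y, s). line_weight n \<nu> y s * ?f M' (ereal s) y) \<in> borel_measurable (L \<Otimes>\<^sub>M lborel)"
      using s.charged_integrand_measurable[of \<nu>] by (simp add: case_prod_beta' cong: measurable_cong_sets)
    have im: "(\<lambda>y. \<integral>\<^sup>+s. line_weight n \<nu> y s * ?f M' (ereal s) y \<partial>lborel) \<in> borel_measurable L"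
      by (rule lborel.borel_measurable_nn_integral[OF pm])
    have "(\<integral>\<^sup>+y. charged_part n M' \<nu> y \<partial>L) = (\<integral>\<^sup>+y. base_weight n \<nu> y * ?f M' (-\<infinity>) y \<partial>L)
      + (\<integral>\<^sup>+y. (\<integral>\<^sup>+s. line_weight n \<nu> y s * ?f M' (ereal s) y \<partial>lborel) \<partial>L)"
      unfolding charged_part_def by (rule nn_integral_add[OF _ im]) measurable
    also have "(\<integral>\<^sup>+y. (\<integral>\<^sup>+s. line_weight n \<nu> y s * ?f M' (ereal s) y \<partial>lborel) \<partial>L)
        = (\<integral>\<^sup>+s. ?W M' s \<partial>lborel)"
      by (rule Fubini'[OF pm, symmetric])
    finally show ?thesis .
  qed
  \<comment> \<open>The order of integration puts \<open>s\<close> outside, since semicontinuity is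
    available for each fixed \<open>s\<close>. The dominating function is the weight itself, as the
    other factor is at most 1.\<close>
  have lim2: "limsup (\<lambda>k. \<integral>\<^sup>+s. ?W (M k) s \<partial>lborel)
      \<le> (\<integral>\<^sup>+s. ?W \<mu> s \<partial>lborel)"
  proof (rule limsup_nn_integral_le_lower[where D = "\<lambda>_. 0" and B = "\<lambda>s. \<integral>\<^sup>+y. line_weight n \<nu> y s \<partial>L"])
    have Bm: "(\<lambda>s. \<integral>\<^sup>+y. line_weight n \<nu> y s \<partial>L) \<in> borel_measurable lborel"
    proof (rule L.borel_measurable_nn_integral)
      have "(\<lambda>p. line_weight n \<nu> (snd p) (fst p)) \<in> borel_measurable (borel \<Otimes>\<^sub>M borel)"
        using measurable_compose[OF measurable_pair_swap' line_weight_measurable[of n \<nu>]] by (simp add: case_prod_beta')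
      then show "(\<lambda>(s, y). line_weight n \<nu> y s) \<in> borel_measurable (lborel \<Otimes>\<^sub>M L)"
        by (simp add: case_prod_beta' cong: measurable_cong_sets)
    qed
    then show "(\<lambda>s. \<integral>\<^sup>+y. line_weight n \<nu> y s \<partial>L) \<in> borel_measurable lborel" .
    have "AE s in lborel. ?base s \<noteq> \<infinity>"
      using w2 by (intro nn_integral_noteq_infinite[OF Bm]) simp
    then show "AE s in lborel. limsup (\<lambda>k. ?W (M k) s)
        \<le> ?W \<mu> s"
    proof (rule eventually_mono)
      fix s assume "?base s \<noteq> \<infinity>"
      then show "limsup (\<lambda>k. ?W (M k) s) \<le> ?W \<mu> s"
        by (intro key line_weight_measurable2) (simp add: less_top[symmetric])
    qed
    show "AE s in lborel. ?W (M k) s \<le> 0 + ?base s" for k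
    proof (rule AE_I2)
      fix s
      have "line_weight n \<nu> y s * ?f (M k) (ereal s) y \<le> line_weight n \<nu> y s * 1" for y
        by (rule mult_left_mono) simp_all
      then show "?W (M k) s \<le> 0 + ?base s"
        by (simp add: nn_integral_mono)
    qed
  qed (use w2 in simp_all)
  \<comment> \<open>Projection does not increase the norm, so the projected mass outside the ball
    comes from points with \<open>norm x > R\<close>.\<close>
  have "?U k \<le> ?V k + ennreal e" for k
  proof -
    interpret s: finite_borel_slice n "M k" by (rule sk)
    have "?U k \<le> (\<integral>\<^sup>+y. charged_part n (M k) \<nu> y * indicator (cball 0 R) y + ennreal (slice_density n (M k) y) * indicator (- cball 0 R) y \<partial>perp_lborel n)"
      by (intro nn_integral_mono) (simp add: indicator_def s.charged_part_le)
    also have "\<dots> = (\<integral>\<^sup>+y\<in>cball 0 R. charged_part n (M k) \<nu> y \<partial>perp_lborel n) + (\<integral>\<^sup>+y\<in>- cball 0 R. ennreal (slice_density n (M k) y) \<partial>perp_lborel n)"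
      by (rule nn_integral_add) measurable
    also have "(\<integral>\<^sup>+y\<in>cball 0 R. charged_part n (M k) \<nu> y \<partial>perp_lborel n) = ?V k"
      by (rule intL[symmetric]) measurable
    finally have 1: "?U k \<le> ?V k + (\<integral>\<^sup>+y\<in>- cball 0 R. ennreal (slice_density n (M k) y) \<partial>perp_lborel n)" .
    have "(\<integral>\<^sup>+y\<in>- cball 0 R. ennreal (slice_density n (M k) y) \<partial>perp_lborel n) \<le> emeasure (M k) {x. proj n x \<in> - cball 0 R}"
      by (rule s.set_integral_slice_density_le) simp
    also have "\<dots> \<le> emeasure (M k) {x. norm x > R}"
    proof (rule emeasure_mono)
      show "{x. proj n x \<in> - cball 0 R} \<subseteq> {x. norm x > R}"
        using norm_proj_le[OF n] by (auto simp: not_le intro: less_le_trans)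
      show "{x. norm x > R} \<in> sets (M k)" by (simp add: s.setsM)
    qed
    also have "\<dots> \<le> ennreal e" by (rule less_imp_le[OF R])
    finally have "(\<integral>\<^sup>+y\<in>- cball 0 R. ennreal (slice_density n (M k) y) \<partial>perp_lborel n) \<le> ennreal e" .
    from order_trans[OF 1 add_left_mono[OF this]] show ?thesis .
  qed
  then have "limsup (\<lambda>k. ?U k) \<le> limsup (\<lambda>k. ennreal e + ?V k)"
    by (intro Limsup_mono always_eventually allI) (simp add: add.commute)
  also have "\<dots> = ennreal e + limsup (\<lambda>k. ?V k)"
    by (rule Limsup_const_add) simp
  also have "\<dots> \<le> ennreal e + (\<integral>\<^sup>+y. charged_part n \<mu> \<nu> y \<partial>L)"
    unfolding split[OF sk] split[OF m.finite_borel_slice_axioms]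
    by (intro add_left_mono limsup_add_ennreal_le key lim2 w1 base_weight_measurable)
  also have "\<dots> \<le> ennreal e + (\<integral>\<^sup>+y. charged_part n \<mu> \<nu> y \<partial>perp_lborel n)"
    unfolding intL[OF m.charged_part_measurable]
    by (intro add_left_mono nn_integral_mono) (simp add: indicator_def)
  finally show "limsup (\<lambda>k. ?U k) \<le> (\<integral>\<^sup>+y. charged_part n \<mu> \<nu> y \<partial>perp_lborel n) + ennreal e"
    by (simp add: add.commute)
qed

text \<open>Shifting the index removes the term at 0, about which the hypotheses say nothing,
  without lowering the upper limit.\<close>

lemma limsup_le_limsup_Suc:
  fixes u :: "nat \<Rightarrow> 'a::complete_lattice"
  shows "limsup u \<le> limsup (\<lambda>k. u (Suc k))"
  unfolding limsup_INF_SUP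
proof (rule INF_greatest)
  fix n
  have "(INF n. SUP m\<in>{n..}. u m) \<le> (SUP m\<in>{Suc n..}. u m)" by (rule INF_lower) simp
  also have "\<dots> \<le> (SUP m\<in>{n..}. u (Suc m))"
  proof (rule SUP_least)
    fix m assume "m \<in> {Suc n..}"
    then have "m - 1 \<in> {n..}" "Suc (m - 1) = m" by auto
    then show "u m \<le> (SUP m\<in>{n..}. u (Suc m))"
      using SUP_upper[of "m - 1" "{n..}" "\<lambda>m. u (Suc m)"] by simp
  qed
  finally show "(INF n. SUP m\<in>{n..}. u m) \<le> (SUP m\<in>{n..}. u (Suc m))" .
qed

lemma norm_eq_1_if_sphere_measure: "n \<in> space sphere_measure \<Longrightarrow> norm n = 1"
  by (simp add: sphere_measure_def space_scale_measure space_restrict_space)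

theorem lemma2p4:
  fixes \<mu>\<^sub>k :: "nat \<Rightarrow> 'a::euclidean_space measure" and \<mu> \<nu> :: "'a measure"
    and C :: real and \<eta> :: "'a \<Rightarrow> real"
  assumes radon_k: "\<And>k. k \<ge> 1 \<Longrightarrow> radon_measure (\<mu>\<^sub>k k)"
    and radon: "radon_measure \<mu>"
    and weak_conv: "weakly_converges \<mu>\<^sub>k \<mu>"
    and boundedness: "\<And>k. k \<ge> 1 \<Longrightarrow> emeasure (\<mu>\<^sub>k k) UNIV \<le> ennreal C"
    and tightness: "\<And>\<epsilon>::real. \<epsilon> > 0 \<Longrightarrow>
      \<exists>R::real. \<forall>k\<ge>1. emeasure (\<mu>\<^sub>k k) {x. norm x > R} < ennreal \<epsilon>"
    and eta_integrable: "integrable sphere_measure \<eta>"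
    and eta_nonneg: "AE n in sphere_measure. 0 \<le> \<eta> n"
    and radon_nu: "radon_measure \<nu>"
    and ac_nu: "absolutely_continuous lborel \<nu>"
  shows "S_eta \<eta> \<mu> \<nu> \<ge> limsup (\<lambda>k. S_eta \<eta> (\<mu>\<^sub>k k) \<nu>)"
proof -
  \<comment> \<open>The hypotheses on the sequence start at index 1; after the shift they hold for
    every natural number.\<close>
  define M where "M k = \<mu>\<^sub>k (Suc k)" for k
  have radon_M: "radon_measure (M k)" for k unfolding M_def by (rule radon_k) simp
  have bdd: "emeasure (M k) UNIV \<le> ennreal C" for k unfolding M_def by (rule boundedness) simp
  have tight: "\<exists>R::real. \<forall>k. emeasure (M k) {x. norm x > R} < ennreal \<epsilon>" if "0 < \<epsilon>" for \<epsilon>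
    using tightness[OF that] unfolding M_def by (metis le_add1 plus_1_eq_Suc)
  have weak: "weakly_converges M \<mu>"
    using weak_conv unfolding weakly_converges_def M_def by (intro allI impI LIMSEQ_Suc) blast
  have finite: "finite_measure N" if "radon_measure N" "emeasure N UNIV \<le> ennreal C" for N :: "'a measure"
  proof (rule finite_measureI)
    have "sets N = sets borel" using that(1) by (simp add: radon_measure_def)
    then have "space N = UNIV" using sets_eq_imp_space_eq by fastforce
    then show "emeasure N (space N) \<noteq> \<infinity>" using that(2) by (auto simp: top_unique)
  qed
  note fin_M = finite[OF radon_M bdd]
  note fin = finite[OF radon weak_limit_mass_le[OF radon_M radon weak bdd]]
  have slice: "finite_borel_slice n N" if "norm n = 1" "radon_measure N" "finite_measure N" for n and N :: "'a measure"
    using that by (intro finite_borel_slice.intro) (simp_all add: radon_measure_def)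
  define D where "D n = (\<integral>\<^sup>+y. weight_defect n \<nu> y \<partial>perp_lborel n)" for n :: 'a
  have S: "S_dir n N \<nu> = D n + (\<integral>\<^sup>+y. charged_part n N \<nu> y \<partial>perp_lborel n)"
    if "norm n = 1" "radon_measure N" "finite_measure N" for n N
    unfolding D_def by (rule finite_borel_slice.S_dir_eq[OF slice[OF that]])
  have "limsup (\<lambda>k. S_eta \<eta> (\<mu>\<^sub>k k) \<nu>) \<le> limsup (\<lambda>k. S_eta \<eta> (M k) \<nu>)"
    unfolding M_def by (rule limsup_le_limsup_Suc)
  also have "\<dots> \<le> S_eta \<eta> \<mu> \<nu>"
    unfolding S_eta_def
  \<comment> \<open>\<open>D n\<close> is the common defect term, possibly infinite, and lies below
    the integrand for the limit. The charged parts are bounded by \<open>C\<close> uniformly in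
    \<open>k\<close> and \<open>n\<close>, which leaves the integrable function
    \<open>C * \<eta>\<close> as \<open>B\<close>.\<close>
  proof (rule limsup_nn_integral_le_lower[where D = "\<lambda>n. D n * ennreal (\<eta> n)" and B = "\<lambda>n. ennreal C * ennreal (\<eta> n)"])
    show "AE n in sphere_measure. limsup (\<lambda>k. S_dir n (M k) \<nu> * ennreal (\<eta> n)) \<le> S_dir n \<mu> \<nu> * ennreal (\<eta> n)"
    proof (rule AE_I2)
      fix n :: 'a assume "n \<in> space sphere_measure"
      then have n: "norm n = 1" by (rule norm_eq_1_if_sphere_measure)
      have "limsup (\<lambda>k. S_dir n (M k) \<nu>) = D n + limsup (\<lambda>k. \<integral>\<^sup>+y. charged_part n (M k) \<nu> y \<partial>perp_lborel n)"
        unfolding S[OF n radon_M fin_M] by (rule Limsup_const_add) simp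
      also have "\<dots> \<le> S_dir n \<mu> \<nu>"
        unfolding S[OF n radon fin]
        by (intro add_left_mono limsup_integral_charged_part_le[OF n radon_M fin_M radon fin weak tight])
      finally show "limsup (\<lambda>k. S_dir n (M k) \<nu> * ennreal (\<eta> n)) \<le> S_dir n \<mu> \<nu> * ennreal (\<eta> n)"
        by (rule limsup_mult_ennreal_le) simp
    qed
    show "AE n in sphere_measure. D n * ennreal (\<eta> n) \<le> S_dir n \<mu> \<nu> * ennreal (\<eta> n)"
    proof (rule AE_I2)
      fix n :: 'a assume "n \<in> space sphere_measure"
      then have n: "norm n = 1" by (rule norm_eq_1_if_sphere_measure)
      show "D n * ennreal (\<eta> n) \<le> S_dir n \<mu> \<nu> * ennreal (\<eta> n)"
        unfolding S[OF n radon fin] by (rule mult_right_mono) simp_all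
    qed
    show "AE n in sphere_measure. S_dir n (M k) \<nu> * ennreal (\<eta> n) \<le> D n * ennreal (\<eta> n) + ennreal C * ennreal (\<eta> n)" for k
    proof (rule AE_I2)
      fix n :: 'a assume "n \<in> space sphere_measure"
      then have n: "norm n = 1" by (rule norm_eq_1_if_sphere_measure)
      have "(\<integral>\<^sup>+y. charged_part n (M k) \<nu> y \<partial>perp_lborel n) \<le> ennreal C"
        by (rule order_trans[OF finite_borel_slice.integral_charged_part_le[OF slice[OF n radon_M fin_M]] bdd])
      then show "S_dir n (M k) \<nu> * ennreal (\<eta> n) \<le> D n * ennreal (\<eta> n) + ennreal C * ennreal (\<eta> n)"
        unfolding S[OF n radon_M fin_M] distrib_right[symmetric] by (intro mult_right_mono add_left_mono) simp_all
    qed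
    have [measurable]: "\<eta> \<in> borel_measurable sphere_measure" using eta_integrable by simp
    show "(\<lambda>n. ennreal C * ennreal (\<eta> n)) \<in> borel_measurable sphere_measure" by measurable
    have "(\<integral>\<^sup>+n. ennreal (\<eta> n) \<partial>sphere_measure) < \<infinity>"
      using eta_integrable by (simp add: real_integrable_def less_top[symmetric])
    then show "(\<integral>\<^sup>+n. ennreal C * ennreal (\<eta> n) \<partial>sphere_measure) < \<infinity>"
      by (subst nn_integral_cmult) (simp_all add: ennreal_mult_less_top)
  qed
  finally show ?thesis .
qed

end
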